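(* Consider the stochastic block model $G_N$ with $M$ blocks of equal size $N/M$, with identical intra-block edge probabilities $p_1=\dots=p_M=p=p(N)$ and inter-block edge probability $q=q(N)$, and let $w\in V_N$. Assume that $$\frac{M\log^4N}{Np(1-p)+N(M-1)q(1-q)}\xrightarrow[N\to\infty]{}0\qquad\text{and}\qquad q\gg\sqrt{\frac{p\log N}{NM(1-p)}},$$ that the limit $$\tilde\kappa=\lim_{N\to\infty}\frac{(M-1)q(1-q)}{p(1-p)}\in[0,\infty]$$ is well defined, and that the limit $\zeta=\lim_{N\to\infty}\frac{1-p}{1-q}$ is well defined and is either a positive constant or (if $\tilde\kappa\in\{0,\infty\}$) equal to $\tilde\kappa$. Then $$\rho_N(H_w-N)\Longrightarrow\mathcal N(0,1-\alpha)\qquad(N\to\infty),$$ where $\Longrightarrow$ denotes convergence in distribution, $$\rho_N=\begin{cases}\sqrt{\dfrac{p}{NM(1-p)}},&\text{if }\tilde\kappa<\infty,\\[2mm]\sqrt{\dfrac{(M-1)q}{NM(1-q)}},&\text{if }\tilde\kappa=\infty,\end{cases}\qquad \alpha=\begin{cases}\dfrac{\tilde\kappa(2\zeta-1+\tilde\kappa\zeta^2)}{(1+\zeta\tilde\kappa)^2},&\text{if }\tilde\kappa\in(0,\infty),\\[2mm]0,&\text{if }\tilde\kappa\in\{0,\infty\}.\end{cases}$$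
   Context: Model: $M$ is the (fixed) number of blocks and $N\to\infty$ runs through multiples of $M$ with $M<N$. The vertex set $V=V_N=\{1,\dots,N\}$ is partitioned into blocks $V^{(1)},\dots,V^{(M)}$ of size $N/M$ each. $p,q\in[0,1]$ depend on $N$. In the random graph $G_N=(V_N,E_N)$ the edge indicators of the unordered pairs $\{v,w\}$ (loops $v=w$ allowed) are independent; the edge $\{v,w\}$ is present with probability $p$ if $v,w$ are in the same block, and with probability $q$ if they are in different blocks. $a_{v,w}$ is the indicator of the edge $\{v,w\}$, $d_v=\sum_{w\in V}a_{v,w}$ (a loop counts once). $E$ is the edge set (including loops) and $L$ the set of loops, so $\sum_v d_v=2|E|-|L|$. Random walk: for a realization of $G_N$, the simple random walk in discrete time jumps from $v$ to $w$ with probability $1/d_v$ if $\{v,w\}\in E$, and $0$ otherwise. Its invariant distribution is $\pi_v=d_v/(2|E|-|L|)$. $H_{vw}$ is the expected time for the walk started in $v$ to reach $w$ (so $H_{ww}=0$), a random variable through the graph. Define $H_w=\sum_{v\in V}\pi_vH_{vw}$. The realization is tacitly assumed connected. Convention: $b_N\gg a_N$ means $a_N/b_N\to0$. *)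

theory Defs
  imports "HOL-Probability.Probability"
begin

definition verts :: "nat \<Rightarrow> nat set" where
  "verts N = {1..N}"

text \<open>\<open>B i\<close> is the \<open>i\<close>-th block; the partition itself is arbitrary.\<close>

definition equal_blocks :: "nat \<Rightarrow> nat \<Rightarrow> (nat \<Rightarrow> nat set) \<Rightarrow> bool" where
  "equal_blocks M N B \<longleftrightarrow>
     disjoint_family_on B {1..M} \<and> (\<Union>i\<in>{1..M}. B i) = verts N \<and>
     (\<forall>i\<in>{1..M}. real (card (B i)) = real N / real M)"

text \<open>Unordered pairs are sets \<open>{v, w}\<close>; a loop at \<open>v\<close> is the singleton \<open>{v, v} = {v}\<close>.\<close>

definition vpairs :: "nat \<Rightarrow> nat set set" where
  "vpairs N = {{v, w} | v w. v \<in> verts N \<and> w \<in> verts N}"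

definition edge_prob :: "nat \<Rightarrow> (nat \<Rightarrow> nat set) \<Rightarrow> real \<Rightarrow> real \<Rightarrow> nat set \<Rightarrow> real" where
  "edge_prob M B p q e = (if \<exists>i\<in>{1..M}. e \<subseteq> B i then p else q)"

text \<open>The law of the edge set. Under \<open>Pi_pmf\<close> the edge indicators \<open>a e\<close> of the pairs are
  independent, and \<open>a e\<close> is false when \<open>e\<close> is not a pair.\<close>

definition sbm :: "nat \<Rightarrow> nat \<Rightarrow> (nat \<Rightarrow> nat set) \<Rightarrow> real \<Rightarrow> real \<Rightarrow> nat set set pmf" where
  "sbm M N B p q =
     map_pmf (\<lambda>a. {e. a e}) (Pi_pmf (vpairs N) False (\<lambda>e. bernoulli_pmf (edge_prob M B p q e)))"

definition nbrs :: "nat \<Rightarrow> nat set set \<Rightarrow> nat \<Rightarrow> nat set" where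
  "nbrs N E v = {w \<in> verts N. {v, w} \<in> E}"

definition deg :: "nat \<Rightarrow> nat set set \<Rightarrow> nat \<Rightarrow> nat" where
  "deg N E v = card (nbrs N E v)"

definition loops :: "nat set set \<Rightarrow> nat set set" where
  "loops E = {e \<in> E. \<exists>v. e = {v}}"

definition inv_distr :: "nat \<Rightarrow> nat set set \<Rightarrow> nat \<Rightarrow> real" where
  "inv_distr N E v = real (deg N E v) / (2 * real (card E) - real (card (loops E)))"

text \<open>An isolated vertex, which does not occur in a connected realization with at least two
  vertices, is made absorbing.\<close>

definition walk_step :: "nat \<Rightarrow> nat set set \<Rightarrow> nat \<Rightarrow> nat pmf" where
  "walk_step N E v = (if nbrs N E v = {} then return_pmf v else pmf_of_set (nbrs N E v))"

text \<open>The conditional law of the position at time \<open>n\<close> of the walk started in \<open>v\<close>, given the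
  positions \<open>\<omega> 0, \<dots>, \<omega> (n - 1)\<close>.\<close>

definition walk_kernel :: "nat \<Rightarrow> nat set set \<Rightarrow> nat \<Rightarrow> nat \<Rightarrow> (nat \<Rightarrow> nat) \<Rightarrow> nat measure" where
  "walk_kernel N E v n \<omega> =
     measure_pmf (case n of 0 \<Rightarrow> return_pmf v | Suc m \<Rightarrow> walk_step N E (\<omega> m))"

lemma Ionescu_Tulcea_walk_kernel:
  "Ionescu_Tulcea (walk_kernel N E v) (\<lambda>_. count_space UNIV)"
proof (rule Ionescu_Tulcea.intro)
  show "walk_kernel N E v n \<in>
      measurable (PiM {0..<n} (\<lambda>_. count_space UNIV)) (subprob_algebra (count_space UNIV))" for n
  proof (cases n)
    case 0
    have "measure_pmf (return_pmf v) \<in> space (subprob_algebra (count_space UNIV))"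
      by (simp add: space_subprob_algebra prob_space_imp_subprob_space prob_space_measure_pmf)
    then show ?thesis
      by (simp add: 0 walk_kernel_def [abs_def])
  next
    case (Suc m)
    have "(\<lambda>\<omega>. \<omega> m) \<in> measurable (PiM {0..<Suc m} (\<lambda>_. count_space UNIV)) (count_space UNIV)"
      by (rule measurable_component_singleton) simp
    moreover have "(\<lambda>x. measure_pmf (walk_step N E x)) \<in>
        measurable (count_space UNIV) (subprob_algebra (count_space UNIV))"
      by (simp add: space_subprob_algebra prob_space_imp_subprob_space prob_space_measure_pmf)
    ultimately show ?thesis
      by (auto simp: Suc walk_kernel_def [abs_def] intro: measurable_compose)
  qed
  show "prob_space (walk_kernel N E v n \<omega>)" for n \<omega>
    by (simp add: walk_kernel_def prob_space_measure_pmf)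
qed

text \<open>The law on trajectories with these transition kernels (Ionescu-Tulcea).\<close>

definition walk :: "nat \<Rightarrow> nat set set \<Rightarrow> nat \<Rightarrow> (nat \<Rightarrow> nat) measure" where
  "walk N E v =
     projective_family.lim UNIV
       (Ionescu_Tulcea.CI (walk_kernel N E v) (\<lambda>_. count_space UNIV)) (\<lambda>_. count_space UNIV)"

lemma prob_space_walk: "prob_space (walk N E v)"
proof -
  interpret Ionescu_Tulcea "walk_kernel N E v" "\<lambda>_. count_space UNIV"
    by (rule Ionescu_Tulcea_walk_kernel)
  have "emeasure PF.lim (PF.emb UNIV {} {\<lambda>_. undefined}) = emeasure (CI {}) {\<lambda>_. undefined}"
    by (rule lim) (auto simp: PiM_empty)
  also have "\<dots> = 1"
    using prob_space.emeasure_space_1 [OF PF.prob_space_P [of "{}"]] PF.space_P [of "{}"]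
    by (simp add: space_PiM)
  also have "PF.emb UNIV {} {\<lambda>_. undefined} = space PF.lim"
    by (auto simp: prod_emb_def PF.space_lim space_PiM restrict_def)
  finally show ?thesis
    unfolding walk_def by (rule prob_spaceI)
qed

text \<open>First time (from 0 on) at which a trajectory visits \<open>w\<close>; \<open>\<infinity>\<close> if it never does.\<close>

definition hit_time :: "nat \<Rightarrow> (nat \<Rightarrow> nat) \<Rightarrow> ennreal" where
  "hit_time w \<omega> = (INF n\<in>{n. \<omega> n = w}. of_nat n)"

definition hitting :: "nat \<Rightarrow> nat set set \<Rightarrow> nat \<Rightarrow> nat \<Rightarrow> ennreal" where
  "hitting N E v w = (\<integral>\<^sup>+ \<omega>. hit_time w \<omega> \<partial>walk N E v)"

text \<open>This is finite for connected \<open>E\<close>. It may be \<open>\<infinity>\<close> for disconnected \<open>E\<close>, where \<open>enn2real\<close> maps it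
  to 0; in the regime considered the probability of such \<open>E\<close> tends to 0, so that the value
  chosen there has no influence on a limit in distribution.\<close>

definition target_hitting :: "nat \<Rightarrow> nat set set \<Rightarrow> nat \<Rightarrow> ennreal" where
  "target_hitting N E w = (\<Sum>v\<in>verts N. ennreal (inv_distr N E v) * hitting N E v w)"

definition rho :: "nat \<Rightarrow> ereal \<Rightarrow> nat \<Rightarrow> real \<Rightarrow> real \<Rightarrow> real" where
  "rho M \<kappa> N p q =
     (if \<kappa> < \<infinity> then sqrt (p / (real N * real M * (1 - p)))
      else sqrt ((real M - 1) * q / (real N * real M * (1 - q))))"

definition alpha :: "ereal \<Rightarrow> ereal \<Rightarrow> real" where
  "alpha \<kappa> \<zeta> =
     (if 0 < \<kappa> \<and> \<kappa> < \<infinity> then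
        (let k = real_of_ereal \<kappa>; z = real_of_ereal \<zeta>
         in k * (2 * z - 1 + k * z\<^sup>2) / (1 + z * k)\<^sup>2)
      else 0)"

text \<open>\<open>density lborel (normal_density \<mu> \<sigma>)\<close> is parametrized by the standard deviation \<open>\<sigma>\<close>.\<close>

definition normal_law :: "real \<Rightarrow> real \<Rightarrow> real measure" where
  "normal_law \<mu> var = density lborel (normal_density \<mu> (sqrt var))"

text \<open>Quotients that occur in hypotheses on limits are formed in \<^typ>\<open>ereal\<close>, where \<open>c / 0 = \<infinity>\<close>
  for \<open>c > 0\<close>. With real division, where \<open>c / 0 = 0\<close>, a vanishing denominator would satisfy
  them vacuously.\<close>

definition eratio :: "real \<Rightarrow> real \<Rightarrow> ereal" where
  "eratio a b = ereal a / ereal b"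

definition much_greater :: "(nat \<Rightarrow> real) \<Rightarrow> (nat \<Rightarrow> real) \<Rightarrow> bool" (infix \<open>\<ggreater>\<close> 50) where
  "b \<ggreater> a \<longleftrightarrow> (\<lambda>k. eratio (a k) (b k)) \<longlonglongrightarrow> 0"

lemma eratio_eq: "b \<noteq> 0 \<Longrightarrow> eratio a b = ereal (a / b)"
  by (simp add: eratio_def)

lemma eratio_zero: "a > 0 \<Longrightarrow> eratio a 0 = \<infinity>"
  by (simp add: eratio_def divide_ereal_def)

end

theory Submission
  imports Defs
begin

text \<open>
  Let \<open>d v\<close> be the degrees, \<open>vol\<close> their sum, \<open>D\<close> and \<open>\<sigma>\<^sup>2\<close> the mean and variance of the degree of
  \<open>w\<close>. The function \<open>y v = H\<^sub>w - H\<^sub>v\<^sub>w\<close> solves \<open>L y = vol \<delta>\<^sub>w - d\<close> for the graph Laplacian \<open>L\<close>,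
  and \<open>H\<^sub>w\<close> is its energy divided by \<open>vol\<close>. Comparing \<open>y\<close> with \<open>(vol / d w) \<delta>\<^sub>w - 1\<close> gives
  \<open>H\<^sub>w = vol / d w - 2 + \<dots>\<close>, where the remainder is controlled by a spectral gap of \<open>L\<close>. Such a gap
  follows from Cheeger's inequality, since the edges between different blocks (all edges if \<open>M = 1\<close>)
  form an expander with high probability, by Chernoff bounds for all cuts. The sum \<open>vol\<close> concentrates
  so strongly around \<open>N D\<close> that only the fluctuation of the single degree \<open>d w\<close> is seen: up to a
  vanishing error, \<open>\<rho>\<^sub>N (H\<^sub>w - N)\<close> is \<open>- (\<rho>\<^sub>N N \<sigma> / D)\<close> times the standardized degree of \<open>w\<close>, which is
  a sum of independent variables with a normal limit, and \<open>(\<rho>\<^sub>N N \<sigma> / D)\<^sup>2\<close> tends to \<open>1 - \<alpha>\<close>.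
\<close>

section \<open>Sums of independent Bernoulli variables\<close>

text \<open>Cheeger's inequality gives a gap of order h^2 / dm, with h the expansion of cuts and dm
  the maximal degree. For M >= 2 and p much larger than q, applying it to the whole graph would lose
  a factor of order p / q, since edges inside blocks dominate dm but not h. Those edges are
  discarded first: they only enlarge the Dirichlet form, and for the remaining graph h and dm are
  both of order N q, hence so is the gap. Two facts make this enough: N q exceeds every multiple of
  log N, as a union bound over all cuts requires, and rho_N / q tends to 0, since the spectral part
  of the remainder is of order 1 / q. Both come from the hypothesis on q together with the one on
  the variance. The comparison function makes every term of the energy expansion explicit except the
  energy of the difference, so a crude gap suffices. All estimates before the limit are explicit,
  because the summands of the degree change with N; exceptional graphs then cost at most twice their
  probability in the characteristic function.\<close>

locale bernoulli_product =
  fixes A :: "'e set" and pr :: "'e \<Rightarrow> real"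
  assumes finite_A: "finite A" and pr_nonneg: "\<And>e. 0 \<le> pr e" and pr_le_1: "\<And>e. pr e \<le> 1"
begin

definition Q :: "('e \<Rightarrow> bool) pmf" where
  "Q = Pi_pmf A False (\<lambda>e. bernoulli_pmf (pr e))"

lemma finite_set_pmf_Q: "finite (set_pmf Q)"
proof -
  have "set_pmf Q \<subseteq> PiE_dflt A False (\<lambda>_. UNIV)"
    using set_Pi_pmf_subset'[OF finite_A, of False "\<lambda>e. bernoulli_pmf (pr e)"]
    unfolding Q_def by (force simp: PiE_dflt_def)
  then show ?thesis
    using finite_PiE_dflt[OF finite_A, of "\<lambda>_. UNIV :: bool set" False] by (auto intro: finite_subset)
qed

lemma integrable_Q [simp]: "integrable Q (f :: _ \<Rightarrow> 'b :: {banach, second_countable_topology})"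
  by (rule integrable_measure_pmf_finite[OF finite_set_pmf_Q])

lemma expectation_component:
  fixes f :: "bool \<Rightarrow> 'b :: {banach, second_countable_topology}"
  assumes "e \<in> A"
  shows "(\<integral>a. f (a e) \<partial>Q) = pr e *\<^sub>R f True + (1 - pr e) *\<^sub>R f False"
proof -
  have "(\<integral>a. f (a e) \<partial>Q) = (\<integral>b. f b \<partial>map_pmf (\<lambda>a. a e) Q)"
    by simp
  also have "map_pmf (\<lambda>a. a e) Q = bernoulli_pmf (pr e)"
    unfolding Q_def using Pi_pmf_component[OF finite_A, of e] assms by simp
  also have "(\<integral>b. f b \<partial>bernoulli_pmf (pr e)) = (\<Sum>b\<in>UNIV. pmf (bernoulli_pmf (pr e)) b *\<^sub>R f b)"
    by (rule integral_measure_pmf) auto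
  finally show ?thesis
    using pr_nonneg pr_le_1 by (simp add: UNIV_bool add.commute)
qed

lemma expectation_prod:
  fixes f :: "'e \<Rightarrow> bool \<Rightarrow> 'b :: {real_normed_field, banach, second_countable_topology}"
  assumes "S \<subseteq> A"
  shows "(\<integral>a. (\<Prod>e\<in>S. f e (a e)) \<partial>Q) = (\<Prod>e\<in>S. pr e *\<^sub>R f e True + (1 - pr e) *\<^sub>R f e False)"
proof -
  have "prob_space.indep_vars Q (\<lambda>_. count_space UNIV) (\<lambda>e a. a e) A"
    unfolding Q_def by (rule indep_vars_Pi_pmf[OF finite_A])
  then have "prob_space.indep_vars Q (\<lambda>_. count_space UNIV) (\<lambda>e a. a e) S"
    using assms by (rule prob_space.indep_vars_subset[OF prob_space_measure_pmf])
  then have "prob_space.indep_vars Q (\<lambda>_. borel) (\<lambda>e. f e \<circ> (\<lambda>a. a e)) S"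
    by (rule prob_space.indep_vars_compose[OF prob_space_measure_pmf]) simp
  then have ind: "prob_space.indep_vars Q (\<lambda>_. borel) (\<lambda>e a. f e (a e)) S"
    by (simp add: comp_def)
  have "finite S" using assms finite_A finite_subset by blast
  then have "(\<integral>a. (\<Prod>e\<in>S. f e (a e)) \<partial>Q) = (\<Prod>e\<in>S. \<integral>a. f e (a e) \<partial>Q)"
    by (intro prob_space.indep_vars_lebesgue_integral[OF prob_space_measure_pmf _ ind]) auto
  also have "\<dots> = (\<Prod>e\<in>S. pr e *\<^sub>R f e True + (1 - pr e) *\<^sub>R f e False)"
    using assms by (intro prod.cong refl expectation_component) auto
  finally show ?thesis .
qed

section \<open>Exponential and second-moment tail bounds\<close>

lemma mgf_le:
  assumes "S \<subseteq> A"
  shows "(\<integral>a. exp (\<theta> * (\<Sum>e\<in>S. of_bool (a e))) \<partial>Q) \<le> exp ((exp \<theta> - 1) * (\<Sum>e\<in>S. pr e))"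
proof -
  have fin: "finite S" using assms finite_A finite_subset by blast
  have "(\<integral>a. exp (\<theta> * (\<Sum>e\<in>S. of_bool (a e))) \<partial>Q) = (\<integral>a. (\<Prod>e\<in>S. exp (\<theta> * of_bool (a e))) \<partial>Q)"
    unfolding sum_distrib_left exp_sum[OF fin] ..
  also have "\<dots> = (\<Prod>e\<in>S. 1 + (exp \<theta> - 1) * pr e)"
    unfolding expectation_prod[OF assms, of "\<lambda>e b. exp (\<theta> * of_bool b)"]
    by (intro prod.cong refl) (simp add: algebra_simps)
  also have "\<dots> \<le> (\<Prod>e\<in>S. exp ((exp \<theta> - 1) * pr e))"
  proof (rule prod_mono)
    fix e
    have "1 + (exp \<theta> - 1) * pr e = (1 - pr e) + exp \<theta> * pr e" by (simp add: algebra_simps)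
    also have "\<dots> \<ge> 0" using pr_nonneg[of e] pr_le_1[of e] by simp
    finally show "0 \<le> 1 + (exp \<theta> - 1) * pr e \<and> 1 + (exp \<theta> - 1) * pr e \<le> exp ((exp \<theta> - 1) * pr e)"
      using exp_ge_add_one_self by auto
  qed
  also have "\<dots> = exp ((exp \<theta> - 1) * (\<Sum>e\<in>S. pr e))"
    by (simp add: sum_distrib_left exp_sum fin)
  finally show ?thesis .
qed

lemma markov_Q:
  assumes "\<And>a. X a \<ge> (0::real)" "c > 0"
  shows "measure Q {a. X a \<ge> c} \<le> (\<integral>a. X a \<partial>Q) / c"
  using integral_Markov_inequality_measure[of "measure_pmf Q" X "{}" c] assms by simp

text \<open>Multiplying both sides by \<open>\<theta>\<close> lets one statement serve both tails: a
  negative \<open>\<theta>\<close> reverses the inequality between sum and threshold.\<close>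

lemma chernoff:
  assumes "S \<subseteq> A"
  shows "measure Q {a. \<theta> * (\<Sum>e\<in>S. of_bool (a e)) \<ge> \<theta> * x}
    \<le> exp ((exp \<theta> - 1) * (\<Sum>e\<in>S. pr e) - \<theta> * x)"
proof -
  have "measure Q {a. \<theta> * (\<Sum>e\<in>S. of_bool (a e)) \<ge> \<theta> * x}
      = measure Q {a. exp (\<theta> * (\<Sum>e\<in>S. of_bool (a e))) \<ge> exp (\<theta> * x)}" by simp
  also have "\<dots> \<le> (\<integral>a. exp (\<theta> * (\<Sum>e\<in>S. of_bool (a e))) \<partial>Q) / exp (\<theta> * x)"
    by (rule markov_Q) auto
  also have "\<dots> \<le> exp ((exp \<theta> - 1) * (\<Sum>e\<in>S. pr e)) / exp (\<theta> * x)"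
    by (intro divide_right_mono mgf_le assms) auto
  finally show ?thesis by (simp add: exp_diff)
qed

lemma lower_tail:
  assumes "S \<subseteq> A" and "m \<le> (\<Sum>e\<in>S. pr e)"
  shows "measure Q {a. (\<Sum>e\<in>S. of_bool (a e)) \<le> m / 2} \<le> exp (- m / 8)"
proof (cases "m \<ge> 0")
  case True
  \<comment> \<open>With \<open>\<theta>\<close> = -1/2 it is enough that exp(-1/2) - 1 <= -3/8: the
    exponent is then at most -3m/8 + m/4 = -m/8.\<close>
  have "1 + 1 / 2 + (1 / 2)\<^sup>2 / 2 \<le> exp (1 / 2 :: real)" by (rule exp_lower_Taylor_quadratic) simp
  then have "exp (1 / 2 :: real) \<ge> 13 / 8" by (simp add: power2_eq_square)
  then have "inverse (exp (1 / 2 :: real)) \<le> inverse (13 / 8)" by (intro le_imp_inverse_le) auto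
  then have e: "exp (- 1 / 2 :: real) - 1 \<le> - 3 / 8" by (simp add: exp_minus)
  have "measure Q {a. (\<Sum>e\<in>S. of_bool (a e)) \<le> m / 2}
      = measure Q {a. (- 1 / 2) * (\<Sum>e\<in>S. of_bool (a e)) \<ge> (- 1 / 2) * (m / 2)}"
    by (intro arg_cong2[where f = measure] refl Collect_cong) (simp add: field_simps)
  also have "\<dots> \<le> exp ((exp (- 1 / 2) - 1) * (\<Sum>e\<in>S. pr e) - (- 1 / 2) * (m / 2))"
    by (rule chernoff[OF assms(1)])
  also have "\<dots> \<le> exp (- m / 8)"
  proof -
    have "(exp (- 1 / 2) - 1) * (\<Sum>e\<in>S. pr e) \<le> (- 3 / 8) * (\<Sum>e\<in>S. pr e)"
      using e by (intro mult_right_mono sum_nonneg pr_nonneg) auto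
    then show ?thesis using assms(2) by simp
  qed
  finally show ?thesis .
next
  case False
  then have "exp (- m / 8) \<ge> 1" by simp
  then show ?thesis using measure_pmf.prob_le_1 order_trans by blast
qed

lemma upper_tail:
  assumes "S \<subseteq> A" and "(\<Sum>e\<in>S. pr e) \<le> m"
  shows "measure Q {a. (\<Sum>e\<in>S. of_bool (a e)) \<ge> 3 * m} \<le> exp (- m)"
proof -
  have m: "m \<ge> 0" using assms(2) sum_nonneg[of S pr] pr_nonneg by force
  have "measure Q {a. (\<Sum>e\<in>S. of_bool (a e)) \<ge> 3 * m}
      = measure Q {a. 1 * (\<Sum>e\<in>S. of_bool (a e)) \<ge> 1 * (3 * m)}" by simp
  \<comment> \<open>Here \<open>\<theta>\<close> = 1 and e <= 3, so the exponent is at most 2m -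
    3m.\<close>
  also have "\<dots> \<le> exp ((exp 1 - 1) * (\<Sum>e\<in>S. pr e) - 1 * (3 * m))"
    by (rule chernoff[OF assms(1)])
  also have "\<dots> \<le> exp (- m)"
  proof -
    have "(exp 1 - 1) * (\<Sum>e\<in>S. pr e) \<le> 2 * m"
      using exp_le assms(2) m by (intro mult_mono sum_nonneg pr_nonneg) auto
    then show ?thesis by simp
  qed
  finally show ?thesis .
qed

text \<open>Off-diagonal terms vanish by independence and centring. The weights \<open>c\<close>
  allow edges to be counted with multiplicity, as the degree sum counts them.\<close>

lemma second_moment:
  assumes "S \<subseteq> A"
  shows "(\<integral>a. (\<Sum>e\<in>S. c e * (of_bool (a e) - pr e))\<^sup>2 \<partial>Q) = (\<Sum>e\<in>S. (c e)\<^sup>2 * (pr e * (1 - pr e)))"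
proof -
  have fin: "finite S" using assms finite_A finite_subset by blast
  define X where "X e a = c e * (of_bool (a e) - pr e)" for e and a :: "'e \<Rightarrow> bool"
  have E: "(\<integral>a. X e a * X f a \<partial>Q) = of_bool (e = f) * ((c e)\<^sup>2 * (pr e * (1 - pr e)))"
    if ef: "e \<in> S" "f \<in> S" for e f
  proof (cases "e = f")
    case True
    have "(\<integral>a. X e a * X e a \<partial>Q) = (\<integral>a. (\<lambda>b. (c e)\<^sup>2 * (of_bool b - pr e)\<^sup>2) (a e) \<partial>Q)"
      by (simp add: X_def power2_eq_square mult.assoc mult.left_commute)
    also have "\<dots> = (c e)\<^sup>2 * (pr e * (1 - pr e))"
      using ef assms by (subst expectation_component) (auto simp: power2_eq_square algebra_simps)
    finally show ?thesis using True by simp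
  next
    case False
    have "(\<integral>a. X e a * X f a \<partial>Q) = (\<integral>a. (\<Prod>g\<in>{e, f}. (\<lambda>g b. c g * (of_bool b - pr g)) g (a g)) \<partial>Q)"
      using False by (simp add: X_def)
    also have "\<dots> = 0"
      using ef assms False by (subst expectation_prod) (auto simp: algebra_simps)
    finally show ?thesis using False by simp
  qed
  have "(\<integral>a. (\<Sum>e\<in>S. X e a)\<^sup>2 \<partial>Q) = (\<integral>a. (\<Sum>e\<in>S. \<Sum>f\<in>S. X e a * X f a) \<partial>Q)"
    by (simp add: power2_eq_square sum_product)
  also have "\<dots> = (\<Sum>e\<in>S. \<Sum>f\<in>S. \<integral>a. X e a * X f a \<partial>Q)" by simp
  also have "\<dots> = (\<Sum>e\<in>S. \<Sum>f\<in>S. of_bool (e = f) * ((c e)\<^sup>2 * (pr e * (1 - pr e))))"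
    by (intro sum.cong refl E)
  also have "\<dots> = (\<Sum>e\<in>S. (c e)\<^sup>2 * (pr e * (1 - pr e)))"
    using fin by (intro sum.cong refl) (simp add: sum_distrib_right[symmetric] of_bool_def)
  finally show ?thesis by (simp add: X_def)
qed

lemma chebyshev:
  assumes "S \<subseteq> A" "x > 0"
  shows "measure Q {a. \<bar>\<Sum>e\<in>S. c e * (of_bool (a e) - pr e)\<bar> \<ge> x}
    \<le> (\<Sum>e\<in>S. (c e)\<^sup>2 * (pr e * (1 - pr e))) / x\<^sup>2"
proof -
  have "measure Q {a. \<bar>\<Sum>e\<in>S. c e * (of_bool (a e) - pr e)\<bar> \<ge> x}
      = measure Q {a. (\<Sum>e\<in>S. c e * (of_bool (a e) - pr e))\<^sup>2 \<ge> x\<^sup>2}"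
    using assms(2) by (intro arg_cong2[where f = measure] refl Collect_cong)
      (simp add: abs_le_square_iff[symmetric])
  also have "\<dots> \<le> (\<integral>a. (\<Sum>e\<in>S. c e * (of_bool (a e) - pr e))\<^sup>2 \<partial>Q) / x\<^sup>2"
    using assms(2) by (intro markov_Q) auto
  finally show ?thesis unfolding second_moment[OF assms(1)] .
qed

end

text \<open>Both terms are compared with the second-order expansion 1 - s^2 p (1 - p) / 2. Every
  error keeps a factor p (1 - p), and summed over the edges these factors give the variance,
  whatever the individual probabilities are.\<close>

lemma norm_bernoulli_char_diff_le:
  assumes p: "0 \<le> p" "p \<le> (1::real)"
  shows "cmod (p *\<^sub>R iexp (s * (1 - p)) + (1 - p) *\<^sub>R iexp (s * (0 - p)) - exp (- (s\<^sup>2 * (p * (1 - p)) / 2)))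
    \<le> \<bar>s\<bar> ^ 3 * (p * (1 - p)) + s ^ 4 * (p * (1 - p))"
proof -
  define v where "v = p * (1 - p)"
  have v0: "v \<ge> 0" using p by (simp add: v_def)
  have v1: "v \<le> 1" using mult_mono[of p 1 "1 - p" 1] p by (simp add: v_def)
  define P where "P x = 1 + \<i> * complex_of_real x - (complex_of_real x)\<^sup>2 / 2" for x
  have ap: "cmod (iexp x - P x) \<le> \<bar>x\<bar> ^ 3 / 6" for x
  proof -
    have "(\<Sum>k\<le>2. (\<i> * complex_of_real x) ^ k / fact k) = P x"
      by (simp add: P_def numeral_2_eq_2 power2_eq_square algebra_simps fact_2)
    then show ?thesis using iexp_approx1[of x 2] by (simp add: fact_numeral numeral_3_eq_3)
  qed
  have mean: "p *\<^sub>R P (s * (1 - p)) + (1 - p) *\<^sub>R P (s * (0 - p)) = complex_of_real (1 - s\<^sup>2 * v / 2)"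
    by (simp add: P_def v_def scaleR_conv_of_real power2_eq_square field_simps)
  \<comment> \<open>The centred third absolute moment is v ((1 - p)^2 + p^2) = v (1 - 2 v).\<close>
  have c3: "\<bar>s * (1 - p)\<bar> ^ 3 * p + \<bar>s * (0 - p)\<bar> ^ 3 * (1 - p) \<le> \<bar>s\<bar> ^ 3 * v"
  proof -
    have "\<bar>s * (1 - p)\<bar> ^ 3 * p + \<bar>s * (0 - p)\<bar> ^ 3 * (1 - p) = \<bar>s\<bar> ^ 3 * v * (1 - 2 * v)"
    proof -
      have a: "\<bar>s * (1 - p)\<bar> = \<bar>s\<bar> * (1 - p)" "\<bar>s * (0 - p)\<bar> = \<bar>s\<bar> * p" using p by (simp_all add: abs_mult)
      show ?thesis unfolding a power_mult_distrib by (simp add: v_def power3_eq_cube algebra_simps)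
    qed
    also have "\<dots> \<le> \<bar>s\<bar> ^ 3 * v * 1" using v0 by (intro mult_left_mono) auto
    finally show ?thesis by simp
  qed
  have 1: "cmod (p *\<^sub>R iexp (s * (1 - p)) + (1 - p) *\<^sub>R iexp (s * (0 - p)) - complex_of_real (1 - s\<^sup>2 * v / 2))
      \<le> \<bar>s\<bar> ^ 3 * v / 6"
  proof -
    have "p *\<^sub>R iexp (s * (1 - p)) + (1 - p) *\<^sub>R iexp (s * (0 - p)) - complex_of_real (1 - s\<^sup>2 * v / 2)
        = p *\<^sub>R (iexp (s * (1 - p)) - P (s * (1 - p))) + (1 - p) *\<^sub>R (iexp (s * (0 - p)) - P (s * (0 - p)))"
      unfolding mean[symmetric] by (simp add: scaleR_diff_right)
    also have "cmod \<dots> \<le> p * (\<bar>s * (1 - p)\<bar> ^ 3 / 6) + (1 - p) * (\<bar>s * (0 - p)\<bar> ^ 3 / 6)"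
    proof (intro norm_triangle_le add_mono)
      show "cmod (p *\<^sub>R (iexp (s * (1 - p)) - P (s * (1 - p)))) \<le> p * (\<bar>s * (1 - p)\<bar> ^ 3 / 6)"
        unfolding norm_scaleR abs_of_nonneg[OF p(1)] by (intro mult_left_mono ap p)
      show "cmod ((1 - p) *\<^sub>R (iexp (s * (0 - p)) - P (s * (0 - p)))) \<le> (1 - p) * (\<bar>s * (0 - p)\<bar> ^ 3 / 6)"
        using p mult_left_mono[OF ap[of "s * (0 - p)"], of "1 - p"] unfolding norm_scaleR by simp
    qed
    also have "\<dots> = (\<bar>s * (1 - p)\<bar> ^ 3 * p + \<bar>s * (0 - p)\<bar> ^ 3 * (1 - p)) / 6"
      by (simp add: field_simps)
    also have "\<dots> \<le> \<bar>s\<bar> ^ 3 * v / 6" using c3 by (intro divide_right_mono) auto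
    finally show ?thesis .
  qed
  define y where "y = s\<^sup>2 * v / 2"
  have y0: "y \<ge> 0" using v0 by (simp add: y_def)
  \<comment> \<open>exp(-y) lies between 1 - y and 1 / (1 + y), and the latter is at most 1 - y +
    y^2 because (1 - y + y^2) (1 + y) = 1 + y^3.\<close>
  have 2: "\<bar>(1 - y) - exp (- y)\<bar> \<le> y\<^sup>2"
  proof -
    have "exp (- y) \<ge> 1 - y" using exp_ge_add_one_self[of "- y"] by simp
    moreover have "exp (- y) \<le> 1 / (1 + y)"
      using exp_ge_add_one_self[of y] y0 by (simp add: exp_minus divide_inverse le_imp_inverse_le)
    moreover have "1 / (1 + y) \<le> 1 - y + y\<^sup>2"
    proof -
      have "1 \<le> (1 - y + y\<^sup>2) * (1 + y)" using y0 by (simp add: power2_eq_square algebra_simps)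
      then show ?thesis using y0 by (simp add: field_simps)
    qed
    ultimately show ?thesis by linarith
  qed
  have 3: "y\<^sup>2 \<le> s ^ 4 * v"
  proof -
    have "y\<^sup>2 = s ^ 4 * (v * v) / 4" by (simp add: y_def power2_eq_square power4_eq_xxxx)
    also have "\<dots> \<le> s ^ 4 * (v * 1) / 4" using v0 v1 by (intro divide_right_mono mult_left_mono) auto
    also have "\<dots> \<le> s ^ 4 * v" using v0 by simp
    finally show ?thesis .
  qed
  have "cmod (complex_of_real (1 - y) - exp (complex_of_real (- y))) = \<bar>(1 - y) - exp (- y)\<bar>"
    by (metis exp_of_real norm_of_real of_real_diff)
  then have 4: "cmod (complex_of_real (1 - y) - exp (complex_of_real (- y))) \<le> s ^ 4 * v" using 2 3 by linarith
  have "cmod (p *\<^sub>R iexp (s * (1 - p)) + (1 - p) *\<^sub>R iexp (s * (0 - p)) - exp (complex_of_real (- y)))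
      \<le> cmod (p *\<^sub>R iexp (s * (1 - p)) + (1 - p) *\<^sub>R iexp (s * (0 - p)) - complex_of_real (1 - y))
        + cmod (complex_of_real (1 - y) - exp (complex_of_real (- y)))"
    by (rule norm_diff_triangle_le[OF order_refl order_refl])
  also have "\<dots> \<le> \<bar>s\<bar> ^ 3 * v / 6 + s ^ 4 * v" using 1 4 by (intro add_mono) (auto simp: y_def)
  also have "\<dots> \<le> \<bar>s\<bar> ^ 3 * v + s ^ 4 * v" using v0 by simp
  finally show ?thesis unfolding exp_of_real y_def v_def .
qed

text \<open>A quantitative central limit theorem. Products of numbers of modulus at most 1 differ by
  at most the sum of the factorwise differences; these are |s|^3 v + s^4 v with s = t / sig, and the
  v add up to sig^2.\<close>

lemma (in bernoulli_product) char_standardized_sum: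
  assumes "S \<subseteq> A" and sig: "sig > 0" "sig\<^sup>2 = (\<Sum>e\<in>S. pr e * (1 - pr e))"
  shows "cmod ((\<integral>a. iexp (t * ((\<Sum>e\<in>S. of_bool (a e) - pr e) / sig)) \<partial>Q) - exp (- (t\<^sup>2 / 2)))
    \<le> \<bar>t\<bar> ^ 3 / sig + t ^ 4 / sig\<^sup>2"
proof -
  have fin: "finite S" using assms finite_A finite_subset by blast
  define s where "s = t / sig"
  define v where "v e = pr e * (1 - pr e)" for e
  define \<phi> where "\<phi> e = pr e *\<^sub>R iexp (s * (1 - pr e)) + (1 - pr e) *\<^sub>R iexp (s * (0 - pr e))" for e
  define \<psi> where "\<psi> e = complex_of_real (exp (- (s\<^sup>2 * v e / 2)))" for e
  have "(\<integral>a. iexp (t * ((\<Sum>e\<in>S. of_bool (a e) - pr e) / sig)) \<partial>Q)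
      = (\<integral>a. (\<Prod>e\<in>S. (\<lambda>e b. iexp (s * (of_bool b - pr e))) e (a e)) \<partial>Q)"
    by (simp add: exp_sum[symmetric] fin s_def sum_distrib_left sum_divide_distrib)
  also have "\<dots> = (\<Prod>e\<in>S. \<phi> e)"
    by (subst expectation_prod[OF assms(1)]) (simp add: \<phi>_def)
  finally have E: "(\<integral>a. iexp (t * ((\<Sum>e\<in>S. of_bool (a e) - pr e) / sig)) \<partial>Q) = (\<Prod>e\<in>S. \<phi> e)" .
  have "(\<Prod>e\<in>S. \<psi> e) = complex_of_real (exp (\<Sum>e\<in>S. - (s\<^sup>2 * v e / 2)))"
    by (simp add: \<psi>_def exp_sum fin)
  also have "(\<Sum>e\<in>S. - (s\<^sup>2 * v e / 2)) = - (t\<^sup>2 / 2)"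
  proof -
    have "(\<Sum>e\<in>S. - (s\<^sup>2 * v e / 2)) = - (s\<^sup>2 * sig\<^sup>2 / 2)"
      unfolding sig(2) v_def by (simp add: sum_negf sum_divide_distrib sum_distrib_left)
    also have "s\<^sup>2 * sig\<^sup>2 = t\<^sup>2" using sig(1) by (simp add: s_def power_divide)
    finally show ?thesis .
  qed
  finally have P: "(\<Prod>e\<in>S. \<psi> e) = exp (- (t\<^sup>2 / 2))" .
  have "cmod (\<phi> e) \<le> 1" for e
  proof -
    have "cmod (\<phi> e) \<le> pr e * 1 + (1 - pr e) * 1"
      unfolding \<phi>_def using pr_nonneg[of e] pr_le_1[of e] by (intro norm_triangle_le add_mono) auto
    then show ?thesis by simp
  qed
  moreover have "cmod (\<psi> e) \<le> 1" for e
    using pr_nonneg[of e] pr_le_1[of e] by (simp add: \<psi>_def v_def)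
  ultimately have "cmod ((\<Prod>e\<in>S. \<phi> e) - (\<Prod>e\<in>S. \<psi> e)) \<le> (\<Sum>e\<in>S. cmod (\<phi> e - \<psi> e))"
    by (intro norm_prod_diff) auto
  also have "\<dots> \<le> (\<Sum>e\<in>S. \<bar>s\<bar> ^ 3 * v e + s ^ 4 * v e)"
    unfolding \<phi>_def \<psi>_def v_def by (intro sum_mono norm_bernoulli_char_diff_le pr_nonneg pr_le_1)
  also have "\<dots> = \<bar>s\<bar> ^ 3 * sig\<^sup>2 + s ^ 4 * sig\<^sup>2"
    by (simp add: sum.distrib sum_distrib_left[symmetric] v_def sig(2))
  also have "\<dots> = \<bar>t\<bar> ^ 3 / sig + t ^ 4 / sig\<^sup>2"
    using sig(1) by (simp add: s_def power_divide abs_divide power2_eq_square power3_eq_cube power4_eq_xxxx)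
  finally show ?thesis unfolding E P .
qed

section \<open>A Cheeger inequality\<close>

text \<open>Ordered pairs count every edge twice, so half of this is the energy of the graph
  Laplacian. Loops contribute nothing.\<close>

definition dirichlet :: "'v set \<Rightarrow> ('v \<Rightarrow> 'v \<Rightarrow> real) \<Rightarrow> ('v \<Rightarrow> real) \<Rightarrow> real" where
  "dirichlet V a f = (\<Sum>x\<in>V. \<Sum>y\<in>V. a x y * (f x - f y)\<^sup>2)"

text \<open>A spectral gap in variational form: for symmetric \<open>a\<close>, \<open>lam\<close>
  is a lower bound for the Laplacian on functions of mean zero.\<close>

definition poincare :: "'v set \<Rightarrow> ('v \<Rightarrow> 'v \<Rightarrow> real) \<Rightarrow> real \<Rightarrow> bool" where
  "poincare V a lam \<longleftrightarrow>
     (\<forall>f. lam * (\<Sum>v\<in>V. (f v - (\<Sum>u\<in>V. f u) / real (card V))\<^sup>2) \<le> dirichlet V a f / 2)"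

lemma sum_abs_diff_indicator:
  fixes a :: "'v \<Rightarrow> 'v \<Rightarrow> real"
  assumes "finite V" and "S \<subseteq> V" and sym: "\<And>x y. a x y = a y x"
  shows "(\<Sum>x\<in>V. \<Sum>y\<in>V. a x y * \<bar>of_bool (x \<in> S) - of_bool (y \<in> S)\<bar>)
    = 2 * (\<Sum>x\<in>S. \<Sum>y\<in>V - S. a x y)"
proof -
  have split: "(\<Sum>y\<in>V. g y) = (\<Sum>y\<in>S. g y) + (\<Sum>y\<in>V - S. g y)" for g :: "'v \<Rightarrow> real"
    using assms by (metis add.commute sum.subset_diff)
  have "(\<Sum>y\<in>V. a x y * \<bar>of_bool (x \<in> S) - of_bool (y \<in> S)\<bar>) =
      (if x \<in> S then \<Sum>y\<in>V - S. a x y else \<Sum>y\<in>S. a x y)" for x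
    by (auto simp: split intro!: sum.cong sum.neutral)
  then have "(\<Sum>x\<in>V. \<Sum>y\<in>V. a x y * \<bar>of_bool (x \<in> S) - of_bool (y \<in> S)\<bar>)
      = (\<Sum>x\<in>S. \<Sum>y\<in>V - S. a x y) + (\<Sum>x\<in>V - S. \<Sum>y\<in>S. a x y)"
    by (simp add: split)
  also have "(\<Sum>x\<in>V - S. \<Sum>y\<in>S. a x y) = (\<Sum>x\<in>S. \<Sum>y\<in>V - S. a x y)"
    by (subst sum.swap) (intro sum.cong refl sym)
  finally show ?thesis by simp
qed

text \<open>Induction on the size of the support: subtract a multiple of its indicator.\<close>

lemma coarea_ge:
  fixes a :: "'v \<Rightarrow> 'v \<Rightarrow> real" and h :: real
  assumes V: "finite V" and sym: "\<And>x y. a x y = a y x" and nn: "\<And>x y. a x y \<ge> 0"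
    and cut: "\<And>S. S \<subseteq> V \<Longrightarrow> 2 * card S \<le> card V \<Longrightarrow> h * card S \<le> (\<Sum>x\<in>S. \<Sum>y\<in>V - S. a x y)"
    and "\<And>x. x \<in> V \<Longrightarrow> F x \<ge> 0" and "2 * card {x \<in> V. F x \<noteq> 0} \<le> card V"
  shows "2 * h * (\<Sum>x\<in>V. F x) \<le> (\<Sum>x\<in>V. \<Sum>y\<in>V. a x y * \<bar>F x - F y\<bar>)"
  using assms(5,6)
proof (induction "card {x \<in> V. F x \<noteq> 0}" arbitrary: F rule: less_induct)
  case less
  define S where "S = {x \<in> V. F x \<noteq> 0}"
  have SV: "S \<subseteq> V" "finite S" using V by (auto simp: S_def)
  show ?case
  proof (cases "S = {}")
    case True
    then have "(\<Sum>x\<in>V. F x) = 0" by (auto simp: S_def intro!: sum.neutral)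
    then show ?thesis by (simp add: sum_nonneg nn)
  next
    case False
    \<comment> \<open>Subtracting the least value on the support keeps \<open>F'\<close> nonnegative
      and removes a minimizer from the support, so the induction applies.\<close>
    define c where "c = Min (F ` S)"
    define F' where "F' x = F x - c * of_bool (x \<in> S)" for x
    have c: "c \<le> F x" if "x \<in> S" for x using SV that by (simp add: c_def)
    have "c \<in> F ` S" unfolding c_def using SV False by (intro Min_in) auto
    then obtain x0 where x0: "x0 \<in> S" "F x0 = c" by auto
    have c0: "c > 0" using x0 less.prems(1)[of x0] by (auto simp: S_def order_less_le)
    have F0: "F x = 0" if "x \<in> V" "x \<notin> S" for x using that by (auto simp: S_def)
    have sub: "{x \<in> V. F' x \<noteq> 0} \<subset> S"
    proof
      show "{x \<in> V. F' x \<noteq> 0} \<subseteq> S" using F0 by (auto simp: F'_def)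
      show "{x \<in> V. F' x \<noteq> 0} \<noteq> S" 
      proof -
        have "x0 \<notin> {x \<in> V. F' x \<noteq> 0}" using x0 by (simp add: F'_def)
        then show ?thesis using x0(1) by blast
      qed
    qed
    have card: "card {x \<in> V. F' x \<noteq> 0} < card S" using sub SV by (intro psubset_card_mono) auto
    have nn': "F' x \<ge> 0" if "x \<in> V" for x
      using c[of x] less.prems(1)[OF that] by (auto simp: F'_def)
    have IH: "2 * h * (\<Sum>x\<in>V. F' x) \<le> (\<Sum>x\<in>V. \<Sum>y\<in>V. a x y * \<bar>F' x - F' y\<bar>)"
    proof (rule less.hyps)
      show "card {x \<in> V. F' x \<noteq> 0} < card {x \<in> V. F x \<noteq> 0}" using card by (simp add: S_def)
      show "2 * card {x \<in> V. F' x \<noteq> 0} \<le> card V" using card less.prems(2) by (simp add: S_def)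
    qed (use nn' in auto)
    \<comment> \<open>The absolute values add exactly: \<open>F'\<close> is nonnegative on
      \<open>S\<close> and vanishes on the rest of \<open>V\<close>, so across the boundary of
      \<open>S\<close> both differences have the same sign.\<close>
    have pt: "\<bar>F x - F y\<bar> = \<bar>F' x - F' y\<bar> + c * \<bar>of_bool (x \<in> S) - of_bool (y \<in> S)\<bar>"
      if "x \<in> V" "y \<in> V" for x y
      using c[of x] c[of y] F0[of x] F0[of y] that c0 by (auto simp: F'_def)
    have "(\<Sum>x\<in>V. \<Sum>y\<in>V. a x y * \<bar>F x - F y\<bar>) =
        (\<Sum>x\<in>V. \<Sum>y\<in>V. a x y * \<bar>F' x - F' y\<bar> + c * (a x y * \<bar>of_bool (x \<in> S) - of_bool (y \<in> S)\<bar>))"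
      by (intro sum.cong refl) (simp add: pt algebra_simps)
    also have "\<dots> = (\<Sum>x\<in>V. \<Sum>y\<in>V. a x y * \<bar>F' x - F' y\<bar>)
        + c * (\<Sum>x\<in>V. \<Sum>y\<in>V. a x y * \<bar>of_bool (x \<in> S) - of_bool (y \<in> S)\<bar>)"
      by (simp add: sum.distrib sum_distrib_left)
    also have "\<dots> = (\<Sum>x\<in>V. \<Sum>y\<in>V. a x y * \<bar>F' x - F' y\<bar>)
        + c * (2 * (\<Sum>x\<in>S. \<Sum>y\<in>V - S. a x y))"
      by (simp add: sum_abs_diff_indicator[OF V SV(1) sym])
    also have "\<dots> \<ge> 2 * h * (\<Sum>x\<in>V. F' x) + c * (2 * (h * card S))"
      using IH cut[of S] SV less.prems(2) c0 by (intro add_mono mult_left_mono) (auto simp: S_def)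
    also have "2 * h * (\<Sum>x\<in>V. F' x) + c * (2 * (h * card S)) = 2 * h * (\<Sum>x\<in>V. F x)"
      using V SV by (simp add: F'_def sum_subtractf sum_distrib_left[symmetric] algebra_simps
          of_bool_def sum.If_cases Int_absorb1)
    finally show ?thesis .
  qed
qed

text \<open>The coarea inequality is applied to \<open>g\<^sup>2\<close>; the AM-GM inequality replaces Cauchy-Schwarz.\<close>

lemma cheeger_half:
  fixes a :: "'v \<Rightarrow> 'v \<Rightarrow> real" and h :: real
  assumes V: "finite V" and sym: "\<And>x y. a x y = a y x" and nn: "\<And>x y. a x y \<ge> 0"
    and cut: "\<And>S. S \<subseteq> V \<Longrightarrow> 2 * card S \<le> card V \<Longrightarrow> h * card S \<le> (\<Sum>x\<in>S. \<Sum>y\<in>V - S. a x y)"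
    and dm: "\<And>x. x \<in> V \<Longrightarrow> (\<Sum>y\<in>V. a x y) \<le> dm" and "h > 0" "dm > 0"
    and g: "\<And>x. x \<in> V \<Longrightarrow> g x \<ge> 0" and supp: "2 * card {x \<in> V. g x \<noteq> 0} \<le> card V"
  shows "h\<^sup>2 * (\<Sum>x\<in>V. (g x)\<^sup>2) \<le> dm * dirichlet V a g"
proof -
  define G where "G = (\<Sum>x\<in>V. (g x)\<^sup>2)"
  \<comment> \<open>From 0 <= (2 dm |s - t| - h |s + t|)^2. With this weighting the part with s + t
    sums to at most 2 h^2 G, half of the left-hand side 4 h^2 G, and is absorbed.\<close>
  have amgm: "2 * h * \<bar>s\<^sup>2 - t\<^sup>2\<bar> \<le> 2 * dm * (s - t)\<^sup>2 + h\<^sup>2 / (2 * dm) * (s + t)\<^sup>2" for s t :: real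
  proof -
    have "0 \<le> (2 * dm * \<bar>s - t\<bar> - h * \<bar>s + t\<bar>)\<^sup>2" by simp
    also have "\<dots> = 4 * dm\<^sup>2 * (s - t)\<^sup>2 + h\<^sup>2 * (s + t)\<^sup>2 - 4 * dm * h * \<bar>s\<^sup>2 - t\<^sup>2\<bar>"
      by (simp add: power2_diff power_mult_distrib square_diff_square_factored power2_eq_square[of s]
          power2_eq_square[of t] abs_mult)
    finally show ?thesis
      using \<open>dm > 0\<close> by (simp add: field_simps power2_eq_square)
  qed
  have sq: "(s + t)\<^sup>2 \<le> 2 * (s\<^sup>2 + t\<^sup>2)" for s t :: real
    using zero_le_power2[of "s - t"] by (simp add: power2_eq_square algebra_simps)
  have deg: "(\<Sum>x\<in>V. \<Sum>y\<in>V. a x y * (g x)\<^sup>2) \<le> dm * G"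
    unfolding G_def sum_distrib_left sum_distrib_right[symmetric]
    by (intro sum_mono mult_right_mono dm) auto
  have deg': "(\<Sum>x\<in>V. \<Sum>y\<in>V. a x y * (g y)\<^sup>2) \<le> dm * G"
    using deg by (subst sum.swap) (subst sym)
  have plus: "(\<Sum>x\<in>V. \<Sum>y\<in>V. a x y * (g x + g y)\<^sup>2) \<le> 4 * dm * G"
  proof -
    have "(\<Sum>x\<in>V. \<Sum>y\<in>V. a x y * (g x + g y)\<^sup>2) \<le> (\<Sum>x\<in>V. \<Sum>y\<in>V. a x y * (2 * ((g x)\<^sup>2 + (g y)\<^sup>2)))"
      by (intro sum_mono mult_left_mono nn sq)
    also have "\<dots> = 2 * ((\<Sum>x\<in>V. \<Sum>y\<in>V. a x y * (g x)\<^sup>2) + (\<Sum>x\<in>V. \<Sum>y\<in>V. a x y * (g y)\<^sup>2))"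
      by (simp add: sum.distrib sum_distrib_left algebra_simps)
    also have "\<dots> \<le> 2 * (dm * G + dm * G)" using deg deg' by (intro mult_left_mono add_mono) auto
    finally show ?thesis by (simp add: mult.commute mult.left_commute)
  qed
  have co: "2 * h * (\<Sum>x\<in>V. (g x)\<^sup>2) \<le> (\<Sum>x\<in>V. \<Sum>y\<in>V. a x y * \<bar>(g x)\<^sup>2 - (g y)\<^sup>2\<bar>)"
    by (rule coarea_ge[OF V sym nn cut]) (use supp in auto)
  have "2 * h * (2 * h * (\<Sum>x\<in>V. (g x)\<^sup>2)) \<le> 2 * h * (\<Sum>x\<in>V. \<Sum>y\<in>V. a x y * \<bar>(g x)\<^sup>2 - (g y)\<^sup>2\<bar>)"
    using \<open>h > 0\<close> by (intro mult_left_mono co) auto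
  also have "\<dots> = (\<Sum>x\<in>V. \<Sum>y\<in>V. a x y * (2 * h * \<bar>(g x)\<^sup>2 - (g y)\<^sup>2\<bar>))"
    by (simp add: sum_distrib_left mult.left_commute)
  also have "\<dots> \<le> (\<Sum>x\<in>V. \<Sum>y\<in>V. a x y * (2 * dm * (g x - g y)\<^sup>2 + h\<^sup>2 / (2 * dm) * (g x + g y)\<^sup>2))"
    by (intro sum_mono mult_left_mono nn amgm)
  also have "\<dots> = 2 * dm * dirichlet V a g + h\<^sup>2 / (2 * dm) * (\<Sum>x\<in>V. \<Sum>y\<in>V. a x y * (g x + g y)\<^sup>2)"
    by (simp add: dirichlet_def distrib_left sum.distrib sum_distrib_left mult.left_commute)
  also have "\<dots> \<le> 2 * dm * dirichlet V a g + h\<^sup>2 / (2 * dm) * (4 * dm * G)"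
    using \<open>dm > 0\<close> by (intro add_left_mono mult_left_mono plus) auto
  also have "\<dots> = 2 * dm * dirichlet V a g + 2 * h\<^sup>2 * G" using \<open>dm > 0\<close> by simp
  finally show ?thesis by (simp add: G_def power2_eq_square algebra_simps)
qed

text \<open>Splitting a function at a median leaves a positive and a negative part, each supported
  on at most half of the vertices, which is where the cut hypothesis is available.\<close>

lemma median_exists:
  fixes f :: "'v \<Rightarrow> real"
  assumes V: "finite V" "V \<noteq> {}"
  obtains m where "2 * card {x \<in> V. f x > m} \<le> card V" "2 * card {x \<in> V. f x < m} \<le> card V"
proof -
  define P where "P = {m \<in> f ` V. 2 * card {x \<in> V. f x > m} \<le> card V}"
  have "Max (f ` V) \<in> P"
  proof -
    have "f x \<le> Max (f ` V)" if "x \<in> V" for x using V that by simp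
    then have "{x \<in> V. f x > Max (f ` V)} = {}" using V by (fastforce simp: not_less simp del: Max_less_iff Max_gr_iff Max_ge)
    then show ?thesis using V unfolding P_def by (simp del: Max_less_iff Max_gr_iff Collect_empty_eq)
  qed
  then have P: "P \<noteq> {}" by blast
  have "finite P" unfolding P_def using V by simp
  note P = P this
  define m where "m = Min P"
  have mP: "m \<in> P" unfolding m_def using P by simp
  have "2 * card {x \<in> V. f x < m} \<le> card V"
  proof (rule ccontr)
    assume *: "\<not> ?thesis"
    define T where "T = {x \<in> V. f x < m}"
    have T: "finite T" using V by (simp add: T_def)
    moreover have "card T > 0" using * by (simp add: T_def)
    ultimately have T: "T \<noteq> {}" "finite T" by auto
    \<comment> \<open>If more than half of the points had values below \<open>m\<close>, the largest
      such value would be exceeded by fewer than half of the points, against the minimality of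
      \<open>m\<close>.\<close>
    define m' where "m' = Max (f ` T)"
    have "m' \<in> f ` T" unfolding m'_def using T by simp
    then have m': "m' < m" "m' \<in> f ` V" by (auto simp: T_def)
    have "{x \<in> V. f x > m'} \<subseteq> V - T"
      using T by (auto simp: m'_def T_def)
    then have "card {x \<in> V. f x > m'} \<le> card (V - T)" using V by (intro card_mono) auto
    also have "\<dots> = card V - card T" using V by (subst card_Diff_subset) (auto simp: T_def)
    finally have "2 * card {x \<in> V. f x > m'} \<le> card V" using * by (simp add: T_def)
    then have "m' \<in> P" using m' by (simp add: P_def)
    then have "m \<le> m'" unfolding m_def using P by simp
    then show False using m' by simp
  qed
  with mP that show ?thesis by (auto simp: P_def)
qed

lemma sum_sq_deviation_le:
  fixes f :: "'v \<Rightarrow> real"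
  assumes "finite V"
  shows "(\<Sum>v\<in>V. (f v - (\<Sum>u\<in>V. f u) / real (card V))\<^sup>2) \<le> (\<Sum>v\<in>V. (f v - m)\<^sup>2)"
proof (cases "V = {}")
  case False
  define n where "n = real (card V)"
  have n: "n > 0" using False assms by (simp add: n_def card_gt_0_iff)
  define s where "s = (\<Sum>u\<in>V. f u)"
  have exp: "(\<Sum>v\<in>V. (f v - c)\<^sup>2) = (\<Sum>v\<in>V. (f v)\<^sup>2) - 2 * c * s + n * c\<^sup>2" for c
    by (simp add: power2_diff sum.distrib sum_subtractf s_def n_def sum_distrib_left
        mult.assoc mult.left_commute[of c] mult.commute[of _ c])
  have "0 \<le> n * (m - s / n)\<^sup>2" using n by simp
  also have "\<dots> = n * m\<^sup>2 - 2 * m * s - (n * (s / n)\<^sup>2 - 2 * (s / n) * s)"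
    using n by (simp add: power2_eq_square field_simps)
  finally show ?thesis unfolding s_def[symmetric] n_def[symmetric] exp by linarith
qed simp

lemma cheeger_poincare:
  fixes a :: "'v \<Rightarrow> 'v \<Rightarrow> real" and h :: real
  assumes V: "finite V" and sym: "\<And>x y. a x y = a y x" and nn: "\<And>x y. a x y \<ge> 0"
    and cut: "\<And>S. S \<subseteq> V \<Longrightarrow> 2 * card S \<le> card V \<Longrightarrow> h * card S \<le> (\<Sum>x\<in>S. \<Sum>y\<in>V - S. a x y)"
    and dm: "\<And>x. x \<in> V \<Longrightarrow> (\<Sum>y\<in>V. a x y) \<le> dm" and "h > 0" "dm > 0"
  shows "poincare V a (h\<^sup>2 / (2 * dm))"
proof (cases "V = {}")
  case True
  then show ?thesis by (simp add: poincare_def dirichlet_def)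
next
  case False
  show ?thesis unfolding poincare_def
  proof
    fix f :: "'v \<Rightarrow> real"
    obtain m where m: "2 * card {x \<in> V. f x > m} \<le> card V" "2 * card {x \<in> V. f x < m} \<le> card V"
      using median_exists[OF V False] by blast
    define g1 where "g1 x = max 0 (f x - m)" for x
    define g2 where "g2 x = max 0 (m - f x)" for x
    have "{x \<in> V. g1 x \<noteq> 0} = {x \<in> V. f x > m}" "{x \<in> V. g2 x \<noteq> 0} = {x \<in> V. f x < m}"
      by (auto simp: g1_def g2_def max_def)
    then have h1: "h\<^sup>2 * (\<Sum>x\<in>V. (g1 x)\<^sup>2) \<le> dm * dirichlet V a g1"
      and h2: "h\<^sup>2 * (\<Sum>x\<in>V. (g2 x)\<^sup>2) \<le> dm * dirichlet V a g2"
      using m assms by (intro cheeger_half; simp add: g1_def g2_def)+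
    have pt: "(g1 x - g1 y)\<^sup>2 + (g2 x - g2 y)\<^sup>2 \<le> (f x - f y)\<^sup>2" for x y
    proof -
      have e: "f x - f y = (g1 x - g1 y) - (g2 x - g2 y)" by (simp add: g1_def g2_def max_def)
      \<comment> \<open>At every vertex one of \<open>g1\<close>, \<open>g2\<close> vanishes, so
        only the two mixed terms remain.\<close>
      have "(g1 x - g1 y) * (g2 x - g2 y) = - (g1 x * g2 y + g1 y * g2 x)"
        by (simp add: g1_def g2_def max_def algebra_simps)
      also have "- (g1 x * g2 y + g1 y * g2 x) \<le> 0" unfolding neg_le_0_iff_le by (intro add_nonneg_nonneg mult_nonneg_nonneg) (auto simp: g1_def g2_def)
      finally have "(g1 x - g1 y) * (g2 x - g2 y) \<le> 0" .
      moreover have "(s - t)\<^sup>2 = s\<^sup>2 + t\<^sup>2 - 2 * (s * t)" for s t :: real by (simp add: power2_diff)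
      note this[of "g1 x - g1 y" "g2 x - g2 y"]
      ultimately show ?thesis unfolding e by linarith
    qed
    have E: "dirichlet V a g1 + dirichlet V a g2 \<le> dirichlet V a f"
      unfolding dirichlet_def sum.distrib[symmetric] distrib_left[symmetric]
      by (intro sum_mono mult_left_mono nn pt)
    have sq: "(g1 x)\<^sup>2 + (g2 x)\<^sup>2 = (f x - m)\<^sup>2" for x
      by (simp add: g1_def g2_def max_def power2_commute)
    have "h\<^sup>2 * (\<Sum>v\<in>V. (f v - (\<Sum>u\<in>V. f u) / real (card V))\<^sup>2) \<le> h\<^sup>2 * (\<Sum>v\<in>V. (f v - m)\<^sup>2)"
      by (intro mult_left_mono sum_sq_deviation_le V) auto
    also have "\<dots> = h\<^sup>2 * (\<Sum>x\<in>V. (g1 x)\<^sup>2) + h\<^sup>2 * (\<Sum>x\<in>V. (g2 x)\<^sup>2)"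
      by (simp add: sq[symmetric] sum.distrib distrib_left)
    also have "\<dots> \<le> dm * (dirichlet V a g1 + dirichlet V a g2)"
      using h1 h2 by (simp add: distrib_left)
    also have "\<dots> \<le> dm * dirichlet V a f" using E \<open>dm > 0\<close> by simp
    finally show "h\<^sup>2 / (2 * dm) * (\<Sum>v\<in>V. (f v - (\<Sum>u\<in>V. f u) / real (card V))\<^sup>2) \<le> dirichlet V a f / 2"
      using \<open>dm > 0\<close> by (simp add: field_simps)
  qed
qed

text \<open>Adding edges can only increase the Dirichlet form. This reduces the gap of the full
  graph to that of a subgraph with balanced degrees.\<close>

lemma poincare_mono:
  assumes "poincare V a lam" and "\<And>x y. x \<in> V \<Longrightarrow> y \<in> V \<Longrightarrow> a x y \<le> b x y"
  shows "poincare V b lam"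
  unfolding poincare_def
proof
  fix f :: "'a \<Rightarrow> real"
  have "dirichlet V a f \<le> dirichlet V b f"
    unfolding dirichlet_def by (intro sum_mono mult_right_mono assms(2)) auto
  moreover have "lam * (\<Sum>v\<in>V. (f v - (\<Sum>u\<in>V. f u) / real (card V))\<^sup>2) \<le> dirichlet V a f / 2"
    using assms(1) unfolding poincare_def by blast
  ultimately show "lam * (\<Sum>v\<in>V. (f v - (\<Sum>u\<in>V. f u) / real (card V))\<^sup>2) \<le> dirichlet V b f / 2"
    by linarith
qed

section \<open>Hitting times and the graph Laplacian\<close>

text \<open>Summation by parts: the right-hand side is the inner product of \<open>f\<close> with
  its Laplacian.\<close>

lemma half_dirichlet_eq:
  fixes a :: "'v \<Rightarrow> 'v \<Rightarrow> real"
  assumes V: "finite V" and sym: "\<And>x y. a x y = a y x"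
  shows "dirichlet V a f / 2 = (\<Sum>v\<in>V. f v * ((\<Sum>u\<in>V. a v u) * f v - (\<Sum>u\<in>V. a v u * f u)))"
proof -
  have s: "(\<Sum>x\<in>V. \<Sum>y\<in>V. a x y * (f y)\<^sup>2) = (\<Sum>x\<in>V. \<Sum>y\<in>V. a x y * (f x)\<^sup>2)"
    by (subst sum.swap) (subst sym, rule refl)
  have "dirichlet V a f = (\<Sum>x\<in>V. \<Sum>y\<in>V. a x y * (f x)\<^sup>2 + a x y * (f y)\<^sup>2 - 2 * (a x y * (f x * f y)))"
    unfolding dirichlet_def by (intro sum.cong refl) (simp add: power2_diff algebra_simps)
  also have "\<dots> = 2 * (\<Sum>x\<in>V. \<Sum>y\<in>V. a x y * (f x)\<^sup>2 - a x y * (f x * f y))"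
    by (simp add: sum.distrib sum_subtractf s sum_distrib_left[symmetric] right_diff_distrib)
  also have "(\<Sum>x\<in>V. \<Sum>y\<in>V. a x y * (f x)\<^sup>2 - a x y * (f x * f y)) =
      (\<Sum>v\<in>V. f v * ((\<Sum>u\<in>V. a v u) * f v - (\<Sum>u\<in>V. a v u * f u)))"
    by (intro sum.cong refl)
      (simp add: sum_subtractf sum_distrib_left sum_distrib_right right_diff_distrib power2_eq_square
        mult.commute mult.left_commute)
  finally show ?thesis by simp
qed

text \<open>The indicator of a vertex of degree 0 has no energy, but it is not constant once there
  are two vertices.\<close>

lemma poincare_imp_degree_pos:
  fixes a :: "'v \<Rightarrow> 'v \<Rightarrow> real"
  assumes V: "finite V" "card V \<ge> 2" and sym: "\<And>x y. a x y = a y x" and nn: "\<And>x y. a x y \<ge> 0"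
    and P: "poincare V a lam" "lam > 0" and v: "v \<in> V"
  shows "(\<Sum>u\<in>V. a v u) > 0"
proof (rule ccontr)
  assume "\<not> ?thesis"
  then have d: "(\<Sum>u\<in>V. a v u) = 0" using sum_nonneg[of V "a v"] nn by force
  define f :: "'v \<Rightarrow> real" where "f x = of_bool (x = v)" for x
  have sf: "(\<Sum>u\<in>V. f u) = 1" using V v by (simp add: f_def of_bool_def)
  have az: "a v u = 0" if "u \<in> V" for u
    using d that V nn by (simp add: sum_nonneg_eq_0_iff)
  have "dirichlet V a f / 2 = 0"
    unfolding half_dirichlet_eq[OF V(1) sym] using d az by (intro sum.neutral) (auto simp: f_def)
  then have "lam * (\<Sum>x\<in>V. (f x - 1 / real (card V))\<^sup>2) \<le> 0"
    using P(1) unfolding poincare_def by (metis sf)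
  then have "(\<Sum>x\<in>V. (f x - 1 / real (card V))\<^sup>2) \<le> 0"
    using P(2) by (simp add: mult_le_0_iff)
  moreover have "(f v - 1 / real (card V))\<^sup>2 \<le> (\<Sum>x\<in>V. (f x - 1 / real (card V))\<^sup>2)"
    by (rule member_le_sum) (use V v in auto)
  moreover have "(f v - 1 / real (card V))\<^sup>2 > 0"
    using V(2) by (simp add: f_def field_simps)
  ultimately show False by simp
qed

text \<open>Applied to the partial sums of the series for the hitting times, this shows that these are finite.\<close>

lemma hitting_bound_of_poincare:
  fixes a :: "'v \<Rightarrow> 'v \<Rightarrow> real"
  assumes V: "finite V" and sym: "\<And>x y. a x y = a y x" and nn: "\<And>x y. a x y \<ge> 0"
    and le1: "\<And>x y. a x y \<le> 1"
    and P: "poincare V a lam" "lam > 0" and w: "w \<in> V" and fw: "f w = 0"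
    and f0: "\<And>v. v \<in> V \<Longrightarrow> f v \<ge> 0"
    and f: "\<And>v. v \<in> V \<Longrightarrow> v \<noteq> w \<Longrightarrow>
      (\<Sum>u\<in>V. a v u) * f v \<le> (\<Sum>u\<in>V. a v u) + (\<Sum>u\<in>V. a v u * f u)"
    and v: "v \<in> V"
  shows "f v \<le> 2 * (real (card V))\<^sup>2 / lam"
proof -
  define mx where "mx = Max (f ` V)"
  define n where "n = real (card V)"
  have "mx \<in> f ` V" unfolding mx_def using V w by (intro Max_in) auto
  then obtain v0 where v0: "v0 \<in> V" "f v0 = mx" by auto
  have le: "f x \<le> mx" if "x \<in> V" for x using that V by (simp add: mx_def)
  have "mx \<le> 2 * n\<^sup>2 / lam"
  proof (cases "v0 = w")
    case True
    then show ?thesis using v0 fw P(2) by simp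
  next
    case False
    have deg: "(\<Sum>u\<in>V. a x u) \<le> n" for x
      using sum_mono[of V "a x" "\<lambda>_. 1"] le1 by (simp add: n_def)
    have mx0: "mx \<ge> 0" using f0 v0 by force
    define m where "m = (\<Sum>u\<in>V. f u) / real (card V)"
    have "lam * (\<Sum>v\<in>V. (f v - m)\<^sup>2) \<le> dirichlet V a f / 2"
      using P(1) by (simp add: poincare_def m_def)
    also have "\<dots> \<le> (\<Sum>v\<in>V. mx * n)"
      unfolding half_dirichlet_eq[OF V sym]
    proof (rule sum_mono)
      fix x assume x: "x \<in> V"
      show "f x * ((\<Sum>u\<in>V. a x u) * f x - (\<Sum>u\<in>V. a x u * f u)) \<le> mx * n"
      proof (cases "x = w")
        case True
        then show ?thesis using fw mx0 by (simp add: n_def)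
      next
        case False
        have "(\<Sum>u\<in>V. a x u) * f x - (\<Sum>u\<in>V. a x u * f u) \<le> n" using f[OF x False] deg[of x] by linarith
        then have "f x * ((\<Sum>u\<in>V. a x u) * f x - (\<Sum>u\<in>V. a x u * f u)) \<le> f x * n"
          using f0[OF x] by (intro mult_left_mono)
        also have "\<dots> \<le> mx * n" using le[OF x] by (intro mult_right_mono) (auto simp: n_def)
        finally show ?thesis .
      qed
    qed
    also have "\<dots> = n\<^sup>2 * mx" by (simp add: n_def power2_eq_square)
    finally have 1: "lam * (\<Sum>v\<in>V. (f v - m)\<^sup>2) \<le> n\<^sup>2 * mx" .
    \<comment> \<open>The values \<open>mx\<close> at \<open>v0\<close> and 0 at \<open>w\<close>
      alone force squared deviations of at least mx^2 / 2, while the energy is at most n^2 mx.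
      Comparing the two bounds \<open>mx\<close>.\<close>
    have "(\<Sum>v\<in>{v0, w}. (f v - m)\<^sup>2) \<le> (\<Sum>v\<in>V. (f v - m)\<^sup>2)"
      using V v0 w by (intro sum_mono2) auto
    then have "(mx - m)\<^sup>2 + m\<^sup>2 \<le> (\<Sum>v\<in>V. (f v - m)\<^sup>2)"
      using False v0 fw by simp
    moreover have "mx\<^sup>2 / 2 \<le> (mx - m)\<^sup>2 + m\<^sup>2"
      using zero_le_power2[of "mx - 2 * m"] by (simp add: power2_eq_square algebra_simps)
    ultimately have "lam * (mx\<^sup>2 / 2) \<le> lam * (\<Sum>v\<in>V. (f v - m)\<^sup>2)" using P(2) by (intro mult_left_mono) auto
    with 1 have "mx * (lam * mx) \<le> mx * (2 * n\<^sup>2)" by (simp add: power2_eq_square algebra_simps)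
    then have "mx = 0 \<or> lam * mx \<le> 2 * n\<^sup>2" using mx0 by (auto simp add: mult_le_cancel_left)
    then show ?thesis using P(2) by (auto simp: field_simps)
  qed
  then show ?thesis using le[OF v] by (simp add: n_def)
qed

text \<open>With c = vol / d w and u = c \<delta> - 1, where \<delta> is the indicator of w, L u
  contains the point mass vol \<delta> exactly, so x = y - u has the source b v = c a v w - d v. In
  the energy of y = u + x everything is explicit except the energy of x, which is nonnegative and,
  by the gap, at most the sum of the b^2 divided by lam.\<close>

lemma target_hitting_approx:
  fixes a :: "'v \<Rightarrow> 'v \<Rightarrow> real"
  assumes V: "finite V" and sym: "\<And>x y. a x y = a y x" and a01: "\<And>x y. a x y \<in> {0, 1}"
    and P: "poincare V a lam" "lam > 0" and w: "w \<in> V" and hw: "h w = 0"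
    and d: "\<And>v. d v = (\<Sum>u\<in>V. a v u)" and dw: "d w > 0"
    and h: "\<And>v. v \<in> V \<Longrightarrow> v \<noteq> w \<Longrightarrow> d v * h v = d v + (\<Sum>u\<in>V. a v u * h u)"
    and vol: "vol = (\<Sum>v\<in>V. d v)" and H: "H = (\<Sum>v\<in>V. d v * h v) / vol"
  shows "\<bar>H - vol / d w\<bar> \<le> 2 + vol / (d w)\<^sup>2 + (vol / d w + real (card V)) / lam"
proof -
  define n where "n = real (card V)"
  have nn: "a x y \<ge> 0" for x y using a01[of x y] by auto
  have a2: "(a x y)\<^sup>2 = a x y" for x y using a01[of x y] by auto
  have d0: "d v \<ge> 0" for v unfolding d by (simp add: sum_nonneg nn)
  have dn: "d v \<le> n" for v
  proof -
    have "a v u \<le> 1" for u using a01[of v u] by auto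
    then show ?thesis using sum_mono[of V "a v" "\<lambda>_. 1"] by (simp add: d n_def)
  qed
  have volpos: "vol > 0"
    using member_le_sum[of w V d] w d0 V dw by (simp add: vol)
  define c where "c = vol / d w"
  have c0: "c > 0" using volpos dw by (simp add: c_def)
  have cdw: "c * d w = vol" using dw by (simp add: c_def)
  define L where "L f v = d v * f v - (\<Sum>u\<in>V. a v u * f u)" for f v
  define u where "u v = c * of_bool (v = w) - 1" for v
  define y where "y v = H - h v" for v
  define x where "x v = y v - u v" for v
  define b where "b v = c * a v w - d v" for v
  have su: "(\<Sum>v\<in>V. g v * of_bool (v = w)) = g w" for g :: "'v \<Rightarrow> real"
    using V w by (simp add: of_bool_def if_distrib cong: if_cong)
  have swap: "(\<Sum>v\<in>V. \<Sum>u\<in>V. a v u * f u) = (\<Sum>v\<in>V. d v * f v)" for f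
    by (subst sum.swap) (simp add: d sum_distrib_right sym)
  have sumL: "(\<Sum>v\<in>V. L f v) = 0" for f
    by (simp add: L_def sum_subtractf swap)
  have Lconst: "L (\<lambda>v. k * f v + l * g v + m) v = k * L f v + l * L g v" for k l m f g v
    by (simp add: L_def d sum.distrib sum_distrib_left sum_distrib_right algebra_simps)
  have Lh: "L h v = d v" if "v \<in> V" "v \<noteq> w" for v using h[OF that] by (simp add: L_def)
  \<comment> \<open>The equation for \<open>h\<close> is given only off \<open>w\<close>; the value
    at \<open>w\<close> is forced because the entries of a Laplacian sum to 0.\<close>
  have Lhw: "L h w = d w - vol"
  proof -
    have "0 = L h w + (\<Sum>v\<in>V - {w}. L h v)" using sumL[of h] V w by (simp add: sum.remove)
    also have "(\<Sum>v\<in>V - {w}. L h v) = (\<Sum>v\<in>V - {w}. d v)" by (intro sum.cong refl) (auto intro: Lh)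
    also have "\<dots> = vol - d w" using V w by (simp add: vol sum.remove[of V w])
    finally show ?thesis by simp
  qed
  have Ly: "L y v = vol * of_bool (v = w) - d v" if "v \<in> V" for v
    using Lconst[of "-1" h 0 h H v] Lh[OF that] Lhw by (auto simp: y_def[abs_def])
  have Lu: "L u v = vol * of_bool (v = w) - c * a v w" for v
  proof -
    have "L (\<lambda>v. of_bool (v = w)) v = d w * of_bool (v = w) - a v w"
      by (simp add: L_def su)
    then show ?thesis
      using Lconst[of c "\<lambda>v. of_bool (v = w)" 0 "\<lambda>v. 0" "-1" v] cdw
      by (auto simp: u_def[abs_def] right_diff_distrib)
  qed
  have Lx: "L x v = b v" if "v \<in> V" for v
    using Lconst[of 1 y "-1" u 0 v] Ly[OF that] Lu[of v] by (simp add: x_def[abs_def] b_def)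
  have energy: "dirichlet V a f / 2 = (\<Sum>v\<in>V. f v * L f v)" for f
    unfolding half_dirichlet_eq[OF V sym] L_def d ..
  have selfadj: "(\<Sum>v\<in>V. f v * L g v) = (\<Sum>v\<in>V. g v * L f v)" for f g
  proof -
    have "(\<Sum>v\<in>V. \<Sum>u\<in>V. f v * (a v u * g u)) = (\<Sum>v\<in>V. \<Sum>u\<in>V. g v * (a v u * f u))"
      by (subst sum.swap) (simp add: sym mult.commute mult.left_commute)
    then show ?thesis
      by (simp add: L_def right_diff_distrib sum_subtractf sum_distrib_left mult.commute mult.left_commute)
  qed
  define \<epsilon> where "\<epsilon> = (\<Sum>v\<in>V. x v * L x v)"
  \<comment> \<open>\<open>H\<close> is the degree-weighted mean of \<open>h\<close>, so
    \<open>y\<close> has weighted mean 0. This removes the part \<open>- d\<close> of its source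
    from the energy and leaves vol times y w.\<close>
  have dy: "(\<Sum>v\<in>V. d v * y v) = 0"
    using volpos by (simp add: y_def right_diff_distrib sum_subtractf sum_distrib_right[symmetric] vol[symmetric])
      (simp add: H)
  have yw: "y w = H" by (simp add: y_def hw)
  have 1: "(\<Sum>v\<in>V. y v * L y v) = vol * H"
  proof -
    have "(\<Sum>v\<in>V. y v * L y v) = (\<Sum>v\<in>V. vol * (y v * of_bool (v = w)) - d v * y v)"
      by (intro sum.cong refl) (simp add: Ly algebra_simps)
    also have "\<dots> = vol * H" by (simp add: sum_subtractf sum_distrib_left[symmetric] su dy yw)
    finally show ?thesis .
  qed
  have 2: "(\<Sum>v\<in>V. y v * L y v) = \<epsilon> + 2 * (\<Sum>v\<in>V. u v * L x v) + (\<Sum>v\<in>V. u v * L u v)"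
  proof -
    have y: "y v = x v + u v" for v by (simp add: x_def)
    have "L y v = L x v + L u v" for v using Lconst[of 1 y "-1" u 0 v] by (simp add: x_def[abs_def])
    then have "(\<Sum>v\<in>V. y v * L y v) = (\<Sum>v\<in>V. x v * L x v) + (\<Sum>v\<in>V. u v * L x v)
        + ((\<Sum>v\<in>V. x v * L u v) + (\<Sum>v\<in>V. u v * L u v))"
      by (simp add: y distrib_left distrib_right sum.distrib)
    then show ?thesis by (simp add: \<epsilon>_def selfadj[of x u])
  qed
  have 3: "(\<Sum>v\<in>V. u v * L x v) = c\<^sup>2 * a w w - vol"
  proof -
    have "(\<Sum>v\<in>V. u v * L x v) = (\<Sum>v\<in>V. c * (b v * of_bool (v = w)) - b v)"
      by (intro sum.cong refl) (simp add: Lx u_def algebra_simps)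
    also have "\<dots> = c * b w - (\<Sum>v\<in>V. b v)" by (simp add: sum_subtractf sum_distrib_left[symmetric] su)
    also have "(\<Sum>v\<in>V. b v) = 0"
      using sumL[of x] Lx by simp
    finally show ?thesis using cdw by (simp add: b_def power2_eq_square algebra_simps)
  qed
  have 4: "(\<Sum>v\<in>V. u v * L u v) = c * vol - c\<^sup>2 * a w w"
  proof -
    have "(\<Sum>v\<in>V. u v * L u v) = (\<Sum>v\<in>V. c * (L u v * of_bool (v = w)) - L u v)"
      by (intro sum.cong refl) (simp add: u_def algebra_simps)
    also have "\<dots> = c * L u w" by (simp add: sum_subtractf sum_distrib_left[symmetric] su sumL)
    finally show ?thesis by (simp add: Lu power2_eq_square algebra_simps)
  qed
  \<comment> \<open>The loop term c^2 a w w enters twice from the mixed part and once, negatively,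
    from the energy of \<open>u\<close>.\<close>
  have eq: "vol * H = \<epsilon> + c\<^sup>2 * a w w - 2 * vol + c * vol"
    using 1 2 3 4 by linarith
  \<comment> \<open>The cross term of the square is at most 0 and is dropped; c^2 d w equals c vol,
    and the squared degrees sum to at most n vol.\<close>
  have b2: "(\<Sum>v\<in>V. (b v)\<^sup>2) \<le> vol * (c + n)"
  proof -
    have "(\<Sum>v\<in>V. (b v)\<^sup>2) \<le> (\<Sum>v\<in>V. c\<^sup>2 * a w v + d v * n)"
    proof (rule sum_mono)
      fix v
      have "(b v)\<^sup>2 = c\<^sup>2 * (a v w)\<^sup>2 + (d v)\<^sup>2 - 2 * (c * a v w * d v)"
        by (simp add: b_def power2_diff power_mult_distrib)
      also have "\<dots> \<le> c\<^sup>2 * a w v + d v * d v"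
        using nn d0 c0 a2[of v w] by (simp add: sym[of v w] power2_eq_square[of "d v"])
      also have "\<dots> \<le> c\<^sup>2 * a w v + d v * n" using dn[of v] d0[of v] by (simp add: mult_left_mono)
      finally show "(b v)\<^sup>2 \<le> c\<^sup>2 * a w v + d v * n" .
    qed
    also have "\<dots> = c\<^sup>2 * d w + vol * n"
      by (simp add: sum.distrib sum_distrib_left[symmetric] sum_distrib_right[symmetric] d[symmetric] vol)
    also have "\<dots> = vol * (c + n)" using cdw by (simp add: power2_eq_square algebra_simps)
    finally show ?thesis .
  qed
  have eps0: "\<epsilon> \<ge> 0"
    unfolding \<epsilon>_def energy[symmetric] dirichlet_def by (simp add: sum_nonneg nn)
  have eps: "\<epsilon> \<le> vol * (c + n) / lam"
  proof -
    define m where "m = (\<Sum>v\<in>V. x v) / real (card V)"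
    define Q where "Q = (\<Sum>v\<in>V. (x v - m)\<^sup>2)"
    have PQ: "lam * Q \<le> \<epsilon>"
      using P(1) unfolding poincare_def Q_def m_def \<epsilon>_def energy[symmetric] by blast
    \<comment> \<open>The entries of \<open>b\<close> sum to 0, so the mean of \<open>x\<close> may
      be subtracted, as the gap requires.\<close>
    have "(\<Sum>v\<in>V. x v * b v) = (\<Sum>v\<in>V. (x v - m) * b v)"
      using sumL[of x] Lx by (simp add: left_diff_distrib sum_subtractf sum_distrib_left[symmetric])
    then have e: "\<epsilon> = (\<Sum>v\<in>V. (x v - m) * b v)" using Lx by (simp add: \<epsilon>_def)
    \<comment> \<open>Young's inequality with weight \<open>lam\<close>: by the gap the first half
      is at most one copy of \<open>\<epsilon>\<close> and is absorbed.\<close>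
    have "2 * \<epsilon> \<le> (\<Sum>v\<in>V. lam * (x v - m)\<^sup>2 + (b v)\<^sup>2 / lam)"
      unfolding e sum_distrib_left
    proof (rule sum_mono)
      fix v
      have "0 \<le> (lam * (x v - m) - b v)\<^sup>2 / lam" using P(2) by simp
      also have "\<dots> = lam * (x v - m)\<^sup>2 + (b v)\<^sup>2 / lam - 2 * ((x v - m) * b v)"
        using P(2) by (simp add: power2_eq_square field_simps)
      finally show "2 * ((x v - m) * b v) \<le> lam * (x v - m)\<^sup>2 + (b v)\<^sup>2 / lam" by simp
    qed
    also have "\<dots> = lam * Q + (\<Sum>v\<in>V. (b v)\<^sup>2) / lam"
      by (simp add: sum.distrib sum_distrib_left Q_def sum_divide_distrib)
    also have "\<dots> \<le> \<epsilon> + vol * (c + n) / lam"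
      using PQ b2 P(2) by (intro add_mono divide_right_mono) auto
    finally show ?thesis by simp
  qed
  have "H - c = \<epsilon> / vol + c\<^sup>2 * a w w / vol - 2"
    using eq volpos by (simp add: field_simps)
  moreover have "\<epsilon> / vol \<le> (c + n) / lam"
    using eps volpos P(2) by (simp add: field_simps)
  moreover have "\<epsilon> / vol \<ge> 0" using eps0 volpos by simp
  moreover have "c\<^sup>2 * a w w / vol \<le> vol / (d w)\<^sup>2"
  proof -
    have "c\<^sup>2 * a w w / vol \<le> c\<^sup>2 * 1 / vol"
      using a01[of w w] volpos by (intro divide_right_mono mult_left_mono) auto
    also have "\<dots> = vol / (d w)\<^sup>2" using volpos by (simp add: c_def power2_eq_square)
    finally show ?thesis .
  qed
  moreover have "c\<^sup>2 * a w w / vol \<ge> 0" using nn volpos by simp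
  ultimately show ?thesis unfolding c_def[symmetric] n_def[symmetric] by linarith
qed

section \<open>Hitting times of the walk as sums of survival probabilities\<close>

text \<open>The transition operator of the walk killed at \<open>w\<close>.\<close>

definition killed_step :: "nat \<Rightarrow> nat set set \<Rightarrow> nat \<Rightarrow> (nat \<Rightarrow> ennreal) \<Rightarrow> nat \<Rightarrow> ennreal" where
  "killed_step N E w g v = of_bool (v \<noteq> w) * (\<integral>\<^sup>+x. g x \<partial>walk_step N E v)"

text \<open>The probability that the walk avoids \<open>w\<close> at the times 0 to
  \<open>n\<close>, both included: \<open>n\<close> steps involve \<open>n + 1\<close>
  positions.\<close>

definition surv :: "nat \<Rightarrow> nat set set \<Rightarrow> nat \<Rightarrow> nat \<Rightarrow> nat \<Rightarrow> ennreal" where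
  "surv N E w n = (killed_step N E w ^^ n) (\<lambda>x. of_bool (x \<noteq> w))"

lemma borel_measurable_prod_avoid [measurable]:
  "n \<le> m \<Longrightarrow> (\<lambda>\<omega>. \<Prod>i<n. of_bool (\<omega> i \<noteq> w) :: ennreal) \<in> borel_measurable (PiM {0..<m::nat} (\<lambda>_. count_space UNIV))"
  by (intro borel_measurable_prod_ennreal measurable_compose[OF measurable_component_singleton]) auto

text \<open>The function \<open>g\<close> of the last position makes the induction work: integrating
  out one more position replaces \<open>g\<close> by one step of the walk and leaves a statement
  about a shorter trajectory.\<close>

lemma nn_integral_walk_C:
  assumes "Ionescu_Tulcea (walk_kernel N E v) (\<lambda>_. count_space UNIV)"
  shows "(\<integral>\<^sup>+\<omega>. (\<Prod>i<Suc n. of_bool (\<omega> i \<noteq> w)) * g (\<omega> n)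
      \<partial>Ionescu_Tulcea.C (walk_kernel N E v) (\<lambda>_. count_space UNIV) 0 (Suc n) (\<lambda>_. undefined))
    = (killed_step N E w ^^ n) (\<lambda>x. of_bool (x \<noteq> w) * g x) v"
proof (induction n arbitrary: g)
  case 0
  interpret Ionescu_Tulcea "walk_kernel N E v" "\<lambda>_. count_space UNIV" by fact
  have [measurable]: "(\<lambda>\<omega>. of_bool (\<omega> 0 \<noteq> w) * g (\<omega> 0)) \<in> borel_measurable (PiM {0..<Suc 0} (\<lambda>_. count_space UNIV))"
    by (rule measurable_compose[OF measurable_component_singleton]) auto
  have "C 0 (Suc 0) (\<lambda>_. undefined) = eP 0 (\<lambda>_. undefined)"
    using bind_return[OF measurable_eP, of "\<lambda>_. undefined" 0] by (simp add: space_PiM)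
  have "(\<integral>\<^sup>+\<omega>. of_bool (\<omega> 0 \<noteq> w) * g (\<omega> 0) \<partial>C 0 (Suc 0) (\<lambda>_. undefined)) = of_bool (v \<noteq> w) * g v"
    unfolding \<open>C 0 (Suc 0) (\<lambda>_. undefined) = eP 0 (\<lambda>_. undefined)\<close>
    by (subst nn_integral_eP) (simp_all add: space_PiM walk_kernel_def nn_integral_return measure_return_pmf)
  then show ?case by simp
next
  case (Suc n)
  interpret Ionescu_Tulcea "walk_kernel N E v" "\<lambda>_. count_space UNIV" by fact
  have m0: "(\<lambda>\<omega>. g (\<omega> (Suc n))) \<in> borel_measurable (PiM {0..<Suc (Suc n)} (\<lambda>_. count_space UNIV))"
    by (rule measurable_compose[OF measurable_component_singleton]) auto
  have m: "(\<lambda>\<omega>. (\<Prod>i<Suc (Suc n). of_bool (\<omega> i \<noteq> w)) * g (\<omega> (Suc n)))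
      \<in> borel_measurable (PiM {0..<Suc (Suc n)} (\<lambda>_. count_space UNIV))"
    using m0 borel_measurable_prod_avoid[of "Suc (Suc n)" "Suc (Suc n)" w]
    by (intro borel_measurable_times_ennreal) auto
  let ?u = "\<lambda>_::nat. undefined :: nat"
  have u: "?u \<in> space (PiM {0..<0} (\<lambda>_. count_space UNIV))" by (simp add: space_PiM)
  have "(\<integral>\<^sup>+\<omega>. (\<Prod>i<Suc (Suc n). of_bool (\<omega> i \<noteq> w)) * g (\<omega> (Suc n)) \<partial>C 0 (Suc (Suc n)) ?u)
      = (\<integral>\<^sup>+\<omega>. \<integral>\<^sup>+\<omega>'. (\<Prod>i<Suc (Suc n). of_bool (\<omega>' i \<noteq> w)) * g (\<omega>' (Suc n)) \<partial>eP (Suc n) \<omega> \<partial>C 0 (Suc n) ?u)"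
  proof -
    have "C 0 (Suc (Suc n)) ?u = C 0 (Suc n) ?u \<bind> eP (Suc n)" by simp
    moreover have "eP (Suc n) \<in> C 0 (Suc n) ?u \<rightarrow>\<^sub>M subprob_algebra (PiM {0..<Suc (Suc n)} (\<lambda>_. count_space UNIV))"
      unfolding measurable_cong_sets[OF sets_C[OF u, of "Suc n"] refl] add_0 by (rule measurable_eP)
    ultimately show ?thesis by (simp only: nn_integral_bind[OF m])
  qed
  also have "\<dots> = (\<integral>\<^sup>+\<omega>. (\<Prod>i<Suc n. of_bool (\<omega> i \<noteq> w)) *
      (\<lambda>y. \<integral>\<^sup>+x. of_bool (x \<noteq> w) * g x \<partial>walk_step N E y) (\<omega> n) \<partial>C 0 (Suc n) ?u)"
  proof (rule nn_integral_cong)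
    fix \<omega> assume "\<omega> \<in> space (C 0 (Suc n) ?u)"
    then have \<omega>: "\<omega> \<in> space (PiM {0..<Suc n} (\<lambda>_. count_space UNIV))" using space_C[OF u, of "Suc n"] by (simp del: C.simps)
    have "(\<integral>\<^sup>+\<omega>'. (\<Prod>i<Suc (Suc n). of_bool (\<omega>' i \<noteq> w)) * g (\<omega>' (Suc n)) \<partial>eP (Suc n) \<omega>)
        = (\<integral>\<^sup>+x. (\<Prod>i<Suc (Suc n). of_bool (fun_upd \<omega> (Suc n) x i \<noteq> w)) * g x \<partial>walk_step N E (\<omega> n))"
      by (subst nn_integral_eP[OF \<omega> m]) (simp add: walk_kernel_def)
    also have "\<dots> = (\<integral>\<^sup>+x. (\<Prod>i<Suc n. of_bool (\<omega> i \<noteq> w)) * (of_bool (x \<noteq> w) * g x) \<partial>walk_step N E (\<omega> n))"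
      by (intro nn_integral_cong) (simp add: mult.assoc)
    also have "\<dots> = (\<Prod>i<Suc n. of_bool (\<omega> i \<noteq> w)) * (\<integral>\<^sup>+x. of_bool (x \<noteq> w) * g x \<partial>walk_step N E (\<omega> n))"
      by (rule nn_integral_cmult) simp
    finally show "(\<integral>\<^sup>+\<omega>'. (\<Prod>i<Suc (Suc n). of_bool (\<omega>' i \<noteq> w)) * g (\<omega>' (Suc n)) \<partial>eP (Suc n) \<omega>)
      = (\<Prod>i<Suc n. of_bool (\<omega> i \<noteq> w)) * (\<lambda>y. \<integral>\<^sup>+x. of_bool (x \<noteq> w) * g x \<partial>walk_step N E y) (\<omega> n)"
      by simp
  qed
  also have "\<dots> = (killed_step N E w ^^ n)
      (\<lambda>x. of_bool (x \<noteq> w) * (\<integral>\<^sup>+x. of_bool (x \<noteq> w) * g x \<partial>walk_step N E x)) v"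
    by (rule Suc.IH)
  also have "\<dots> = (killed_step N E w ^^ Suc n) (\<lambda>x. of_bool (x \<noteq> w) * g x) v"
  proof -
    have "(\<lambda>x. of_bool (x \<noteq> w) * (\<integral>\<^sup>+x. of_bool (x \<noteq> w) * g x \<partial>walk_step N E x))
        = killed_step N E w (\<lambda>x. of_bool (x \<noteq> w) * g x)"
      by (simp add: killed_step_def[abs_def])
    then show ?thesis by (simp only: funpow_Suc_right o_apply)
  qed
  finally show ?case .
qed

lemma sets_walk: "sets (walk N E v) = sets (PiM UNIV (\<lambda>_. count_space UNIV))"
proof -
  interpret Ionescu_Tulcea "walk_kernel N E v" "\<lambda>_. count_space UNIV"
    by (rule Ionescu_Tulcea_walk_kernel)
  show ?thesis unfolding walk_def by (rule PF.sets_lim)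
qed

text \<open>The event depends only on the first \<open>n + 1\<close> coordinates, so the projective
  limit reduces to the iterated kernels.\<close>

lemma emeasure_walk_avoid: "emeasure (walk N E v) {\<omega>. \<forall>i<Suc n. \<omega> i \<noteq> w} = surv N E w n v"
proof -
  interpret Ionescu_Tulcea "walk_kernel N E v" "\<lambda>_. count_space UNIV"
    by (rule Ionescu_Tulcea_walk_kernel)
  let ?P = "PiM {0..<Suc n} (\<lambda>_. count_space UNIV) :: (nat \<Rightarrow> nat) measure"
  let ?u = "\<lambda>_::nat. undefined :: nat"
  have u: "?u \<in> space (PiM {0..<0} (\<lambda>_. count_space UNIV))" by (simp add: space_PiM)
  define X where "X = {\<omega> \<in> space ?P. (\<Prod>i<Suc n. of_bool (\<omega> i \<noteq> w) :: ennreal) = 1}"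
  have X: "X \<in> sets ?P"
    using borel_measurable_prod_avoid[of "Suc n" "Suc n" w] unfolding X_def by measurable
  have prod: "(\<Prod>i<Suc n. of_bool (\<omega> i \<noteq> w) :: ennreal) = of_bool (\<forall>i<Suc n. \<omega> i \<noteq> w)" for \<omega> :: "nat \<Rightarrow> nat"
    by (cases "\<forall>i<Suc n. \<omega> i \<noteq> w") (auto simp del: prod.lessThan_Suc)
  have "{\<omega>. \<forall>i<Suc n. \<omega> i \<noteq> w} = PF.emb UNIV {0..<Suc n} X"
    by (auto simp: X_def prod prod_emb_def space_PiM simp del: prod.lessThan_Suc)
  then have "emeasure (walk N E v) {\<omega>. \<forall>i<Suc n. \<omega> i \<noteq> w} = emeasure (CI {0..<Suc n}) X"
    unfolding walk_def by (simp only: lim[OF finite_atLeastLessThan X])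
  also have "\<dots> = emeasure (C 0 (Suc n) ?u) X"
    using emeasure_CI[OF order_refl X] X by (simp add: prod_emb_id[OF sets.sets_into_space[OF X, simplified space_PiM]])
  also have "\<dots> = (\<integral>\<^sup>+\<omega>. indicator X \<omega> \<partial>C 0 (Suc n) ?u)"
    using X sets_C[OF u, of "Suc n"] by (subst nn_integral_indicator) auto
  also have "\<dots> = (\<integral>\<^sup>+\<omega>. (\<Prod>i<Suc n. of_bool (\<omega> i \<noteq> w)) * (\<lambda>_. 1) (\<omega> n) \<partial>C 0 (Suc n) ?u)"
    using space_C[OF u, of "Suc n"]
    by (intro nn_integral_cong) (auto simp: X_def prod indicator_def simp del: prod.lessThan_Suc C.simps)
  also have "\<dots> = surv N E w n v"
    by (subst nn_integral_walk_C[OF Ionescu_Tulcea_axioms]) (simp add: surv_def)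
  finally show ?thesis .
qed

text \<open>Term \<open>n\<close> is 1 exactly as long as \<open>n\<close> is below the hitting
  time. If \<open>w\<close> is never visited, all terms are 1 and both sides are infinite.\<close>

lemma hit_time_eq_suminf: "hit_time w \<omega> = (\<Sum>n. of_bool (\<forall>i<Suc n. \<omega> i \<noteq> w))"
proof (cases "\<exists>n. \<omega> n = w")
  case True
  define k where "k = (LEAST n. \<omega> n = w)"
  have k: "\<omega> k = w" using LeastI_ex[OF True] by (simp add: k_def)
  have less: "\<omega> i \<noteq> w" if "i < k" for i using not_less_Least that by (auto simp: k_def)
  have le: "k \<le> n" if "\<omega> n = w" for n using that by (simp add: k_def Least_le)
  have "hit_time w \<omega> = of_nat k"
    unfolding hit_time_def
    by (rule antisym) (auto intro!: INF_lower2[of k] INF_greatest k le)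
  moreover have "(\<forall>i<Suc n. \<omega> i \<noteq> w) \<longleftrightarrow> n < k" for n
    using k less by (metis less_Suc_eq_le le_less_trans linorder_not_less)
  moreover have "(\<Sum>n. of_bool (n < k) :: ennreal) = (\<Sum>n<k. of_bool (n < k))"
    by (rule suminf_finite) auto
  ultimately show ?thesis by simp
next
  case False
  then have "hit_time w \<omega> = \<infinity>" by (simp add: hit_time_def)
  moreover have "(\<Sum>n. 1 :: ennreal) = \<infinity>"
    by (simp add: suminf_eq_SUP ennreal_SUP_of_nat_eq_top)
  ultimately show ?thesis using False by simp
qed

lemma hitting_eq_suminf: "hitting N E v w = (\<Sum>n. surv N E w n v)"
proof -
  have sp: "space (walk N E v) = UNIV"
    using sets_eq_imp_space_eq[OF sets_walk[of N E v]] by (simp add: space_PiM)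
  have S: "{\<omega>. \<forall>i<Suc n. \<omega> i \<noteq> w} \<in> sets (walk N E v)" for n
  proof -
    have "{\<omega> \<in> space (PiM UNIV (\<lambda>_. count_space UNIV)). \<forall>i<Suc n. \<omega> i \<noteq> w} \<in> sets (PiM UNIV (\<lambda>_::nat. count_space (UNIV::nat set)))"
      by measurable
    then show ?thesis by (simp add: sets_walk space_PiM)
  qed
  have "hitting N E v w = (\<integral>\<^sup>+\<omega>. (\<Sum>n. indicator {\<omega>. \<forall>i<Suc n. \<omega> i \<noteq> w} \<omega>) \<partial>walk N E v)"
    unfolding hitting_def hit_time_eq_suminf by (intro nn_integral_cong suminf_cong) (simp add: indicator_def)
  also have "\<dots> = (\<Sum>n. \<integral>\<^sup>+\<omega>. indicator {\<omega>. \<forall>i<Suc n. \<omega> i \<noteq> w} \<omega> \<partial>walk N E v)"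
    using S by (intro nn_integral_suminf borel_measurable_indicator)
  also have "\<dots> = (\<Sum>n. surv N E w n v)"
    using S by (simp add: emeasure_walk_avoid del: less_Suc_eq)
  finally show ?thesis .
qed

section \<open>Adjacency, volume and the Laplacian equation for the hitting times\<close>

definition adj :: "nat set set \<Rightarrow> nat \<Rightarrow> nat \<Rightarrow> real" where
  "adj E x y = of_bool ({x, y} \<in> E)"

lemma adj_commute: "adj E x y = adj E y x"
  by (simp add: adj_def insert_commute)

lemma finite_verts [simp]: "finite (verts N)" and card_verts [simp]: "card (verts N) = N"
  by (simp_all add: verts_def)

lemma finite_nbrs [simp]: "finite (nbrs N E v)"
  by (simp add: nbrs_def)

lemma sum_adj_mult: "(\<Sum>u\<in>verts N. adj E v u * f u) = (\<Sum>u\<in>nbrs N E v. f u)"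
proof -
  have "(\<Sum>u\<in>verts N. adj E v u * f u) = (\<Sum>u\<in>verts N. if {v, u} \<in> E then f u else 0)"
    by (intro sum.cong) (auto simp: adj_def)
  then show ?thesis by (simp add: nbrs_def sum.inter_filter)
qed

lemma sum_adj: "(\<Sum>u\<in>verts N. adj E v u) = real (deg N E v)"
  using sum_adj_mult[where f = "\<lambda>_. 1"] by (simp add: deg_def)

text \<open>A pair of distinct vertices comes from two ordered pairs, a loop from one. The same
  weights serve the handshake identity and the deviation of the volume.\<close>

lemma sum_pairs_eq_sum_vpairs:
  fixes F :: "nat set \<Rightarrow> real"
  shows "(\<Sum>v\<in>verts N. \<Sum>u\<in>verts N. F {v, u})
    = (\<Sum>e\<in>vpairs N. (if \<exists>v. e = {v} then 1 else 2) * F e)"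
proof -
  let ?V = "verts N"
  let ?g = "\<lambda>(v, u). {v, u} :: nat set"
  have im: "vpairs N = ?g ` (?V \<times> ?V)" by (auto simp: vpairs_def)
  have "(\<Sum>v\<in>?V. \<Sum>u\<in>?V. F {v, u}) = (\<Sum>z\<in>?V \<times> ?V. F (?g z))"
    by (simp add: sum.cartesian_product case_prod_beta)
  also have "\<dots> = (\<Sum>e\<in>vpairs N. \<Sum>z\<in>{z \<in> ?V \<times> ?V. ?g z = e}. F (?g z))"
    unfolding im by (intro sum.image_gen) simp
  also have "\<dots> = (\<Sum>e\<in>vpairs N. (if \<exists>v. e = {v} then 1 else 2) * F e)"
  proof (rule sum.cong[OF refl])
    fix e assume "e \<in> vpairs N"
    then obtain v u where e: "e = {v, u}" "v \<in> ?V" "u \<in> ?V" by (auto simp: vpairs_def)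
    have fib: "{z \<in> ?V \<times> ?V. ?g z = e} = {(v, u), (u, v)}"
    proof (intro set_eqI)
      fix z
      obtain x y where z: "z = (x :: nat, y :: nat)" by (cases z)
      have "{x, y} = {v, u} \<longleftrightarrow> (x = v \<and> y = u) \<or> (x = u \<and> y = v)" by (rule doubleton_eq_iff)
      then show "z \<in> {z \<in> ?V \<times> ?V. ?g z = e} \<longleftrightarrow> z \<in> {(v, u), (u, v)}"
        unfolding z e(1) using e(2,3) by simp blast
    qed
    have "(\<Sum>z\<in>{z \<in> ?V \<times> ?V. ?g z = e}. F (?g z)) = (\<Sum>z\<in>{(v, u), (u, v)}. F e)"
    proof (rule sum.cong[OF fib])
      fix z assume "z \<in> {(v, u), (u, v)}"
      then have "?g z = e" using e(1) by (elim insertE) (simp_all add: insert_commute)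
      then show "F (?g z) = F e" by (rule arg_cong)
    qed
    also have "\<dots> = (if \<exists>v. e = {v} then 1 else 2) * F e"
    proof (cases "v = u")
      case False
      then have "\<nexists>x. e = {x}" unfolding e(1) by (metis singletonD insertI1 insertI2)
      with False show ?thesis by simp
    qed (simp add: e(1))
    finally show "(\<Sum>z\<in>{z \<in> ?V \<times> ?V. ?g z = e}. F (?g z)) = (if \<exists>v. e = {v} then 1 else 2) * F e" .
  qed
  finally show ?thesis .
qed

lemma finite_vpairs [simp]: "finite (vpairs N)"
proof -
  have "vpairs N = (\<lambda>(v, u). {v, u}) ` (verts N \<times> verts N)" by (auto simp: vpairs_def)
  then show ?thesis by simp
qed

definition vol :: "nat \<Rightarrow> nat set set \<Rightarrow> real" where
  "vol N E = (\<Sum>v\<in>verts N. real (deg N E v))"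

text \<open>A loop counts once in the degree, hence the correction. This turns the denominator of
  \<open>inv_distr\<close> into the degree sum.\<close>

lemma handshake:
  assumes "E \<subseteq> vpairs N"
  shows "2 * real (card E) - real (card (loops E)) = vol N E"
proof -
  have fin: "finite E" using assms finite_subset finite_vpairs by blast
  have "vol N E = (\<Sum>v\<in>verts N. \<Sum>u\<in>verts N. of_bool ({v, u} \<in> E))"
    by (simp add: vol_def sum_adj[symmetric] adj_def)
  also have "\<dots> = (\<Sum>e\<in>vpairs N. (if \<exists>v. e = {v} then 1 else 2) * of_bool (e \<in> E))"
    by (rule sum_pairs_eq_sum_vpairs)
  also have "\<dots> = (\<Sum>e\<in>E. if \<exists>v. e = {v} then 1 else 2)"
    using assms by (intro sum.mono_neutral_cong_right) auto
  also have "\<dots> = (\<Sum>e\<in>E. 2 - of_bool (\<exists>v. e = {v}))" by (intro sum.cong) auto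
  also have "\<dots> = 2 * real (card E) - real (card (loops E))"
    using fin by (simp add: sum_subtractf loops_def of_bool_def sum.inter_filter[symmetric])
  finally show ?thesis by simp
qed

lemma surv_0: "surv N E w 0 v = of_bool (v \<noteq> w)"
  by (simp add: surv_def)

lemma surv_Suc:
  assumes "nbrs N E v \<noteq> {}"
  shows "surv N E w (Suc n) v = of_bool (v \<noteq> w) * ((\<Sum>x\<in>nbrs N E v. surv N E w n x) / of_nat (deg N E v))"
  using assms by (simp add: surv_def killed_step_def walk_step_def nn_integral_pmf_of_set deg_def)

lemma surv_le_1: "surv N E w n v \<le> 1"
proof -
  interpret prob_space "walk N E v" by (rule prob_space_walk)
  show ?thesis unfolding emeasure_walk_avoid[symmetric] by (rule emeasure_le_1)
qed

text \<open>The gap bounds the partial sums of the survival probabilities uniformly, so their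
  one-step recursion passes to a finite limit.\<close>

lemma hitting_equation:
  assumes N: "N \<ge> 2" and P: "poincare (verts N) (adj E) lam" "lam > 0" and w: "w \<in> verts N"
  shows "\<exists>h. h w = 0 \<and> (\<forall>v\<in>verts N. h v \<ge> 0 \<and> hitting N E v w = ennreal (h v)) \<and>
    (\<forall>v\<in>verts N. v \<noteq> w \<longrightarrow> real (deg N E v) * h v
       = real (deg N E v) + (\<Sum>u\<in>verts N. adj E v u * h u))"
proof -
  define s where "s n v = enn2real (surv N E w n v)" for n v
  have s: "surv N E w n v = ennreal (s n v)" for n v
    using surv_le_1[of N E w n v] unfolding s_def by (metis ennreal_enn2real ennreal_one_less_top le_less_trans)
  have s0: "s n v \<ge> 0" for n v by (simp add: s_def)
  have deg: "real (deg N E v) > 0" if "v \<in> verts N" for v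
    using poincare_imp_degree_pos[OF finite_verts, of N "adj E" lam v] N P that adj_commute
    by (simp add: adj_def sum_adj[symmetric])
  have nb: "nbrs N E v \<noteq> {}" if "v \<in> verts N" for v using deg[OF that] by (auto simp: deg_def)
  have sw: "s n w = 0" for n
    by (cases n) (simp_all add: s_def surv_0 surv_Suc nb w)
  have sz: "s 0 v = 1" if "v \<noteq> w" for v using that by (simp add: s_def surv_0)
  have sS: "real (deg N E v) * s (Suc n) v = (\<Sum>u\<in>verts N. adj E v u * s n u)"
    if v: "v \<in> verts N" "v \<noteq> w" for v n
  proof -
    have "surv N E w (Suc n) v = ennreal ((\<Sum>x\<in>nbrs N E v. s n x) / real (deg N E v))"
      unfolding surv_Suc[OF nb[OF v(1)]] s using v deg[OF v(1)]
      by (simp add: s0 sum_nonneg divide_ennreal ennreal_of_nat_eq_real_of_nat)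
    then have "s (Suc n) v = (\<Sum>x\<in>nbrs N E v. s n x) / real (deg N E v)"
      unfolding s_def[of "Suc n" v] by (simp add: s0 sum_nonneg)
    then show ?thesis using deg[OF v(1)] by (simp add: sum_adj_mult)
  qed
  define hk where "hk k v = (\<Sum>n<k. s n v)" for k v
  \<comment> \<open>A shift of the sum: off \<open>w\<close> the zeroth term is 1, and the later
    terms average the shorter partial sum over the neighbours.\<close>
  have hkS: "real (deg N E v) * hk (Suc k) v = real (deg N E v) + (\<Sum>u\<in>verts N. adj E v u * hk k u)"
    if v: "v \<in> verts N" "v \<noteq> w" for v k
  proof -
    have "hk (Suc k) v = s 0 v + (\<Sum>n<k. s (Suc n) v)" unfolding hk_def by (rule sum.lessThan_Suc_shift)
    moreover have "(\<Sum>n<k. real (deg N E v) * s (Suc n) v) = (\<Sum>u\<in>verts N. adj E v u * hk k u)"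
      unfolding sS[OF v] hk_def sum_distrib_left by (rule sum.swap)
    ultimately show ?thesis using v by (simp add: sz distrib_left sum_distrib_left)
  qed
  have bound: "hk k v \<le> 2 * (real (card (verts N)))\<^sup>2 / lam" if v: "v \<in> verts N" for k v
  proof (rule hitting_bound_of_poincare[where V = "verts N" and a = "adj E" and lam = lam and w = w])
    \<comment> \<open>Partial sums increase with \<open>k\<close>, so the recursion yields an
      inequality with the same \<open>k\<close> on both sides.\<close>
    show "(\<Sum>u\<in>verts N. adj E v u) * hk k v \<le> (\<Sum>u\<in>verts N. adj E v u) + (\<Sum>u\<in>verts N. adj E v u * hk k u)"
      if v: "v \<in> verts N" "v \<noteq> w" for v
    proof -
      have "real (deg N E v) * hk k v \<le> real (deg N E v) * hk (Suc k) v"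
        by (intro mult_left_mono) (auto simp: hk_def s0)
      then show ?thesis by (simp add: sum_adj hkS v)
    qed
  qed (use P w v in \<open>auto simp: adj_commute[of E] adj_def hk_def s0 sw sum_nonneg insert_commute\<close>)
  define h where "h v = (\<Sum>n. s n v)" for v
  have summ: "summable (\<lambda>n. s n v)" if "v \<in> verts N" for v
    using bound[OF that] by (intro summableI_nonneg_bounded[where x = "2 * (real (card (verts N)))\<^sup>2 / lam"])
      (auto simp: s0 hk_def)
  have lim: "(\<lambda>k. hk k v) \<longlonglongrightarrow> h v" if "v \<in> verts N" for v
    using summable_LIMSEQ[OF summ[OF that]] by (simp add: hk_def[abs_def] h_def)
  have "real (deg N E v) * h v = real (deg N E v) + (\<Sum>u\<in>verts N. adj E v u * h u)"
    if v: "v \<in> verts N" "v \<noteq> w" for v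
  proof (rule LIMSEQ_unique)
    show "(\<lambda>k. real (deg N E v) * hk (Suc k) v) \<longlonglongrightarrow> real (deg N E v) * h v"
      using LIMSEQ_Suc[OF lim[OF v(1)]] by (intro tendsto_intros)
    show "(\<lambda>k. real (deg N E v) * hk (Suc k) v) \<longlonglongrightarrow> real (deg N E v) + (\<Sum>u\<in>verts N. adj E v u * h u)"
      unfolding hkS[OF v] by (intro tendsto_intros lim)
  qed
  moreover have "hitting N E v w = ennreal (h v)" if "v \<in> verts N" for v
    unfolding hitting_eq_suminf s h_def by (intro suminf_ennreal2 s0 summ that)
  moreover have "h v \<ge> 0" if "v \<in> verts N" for v
    unfolding h_def by (intro suminf_nonneg s0 summ that)
  moreover have "h w = 0" by (simp add: h_def sw)
  ultimately show ?thesis by blast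
qed

lemma abs_target_hitting_diff_le:
  assumes N: "N \<ge> 2" and E: "E \<subseteq> vpairs N"
    and P: "poincare (verts N) (adj E) lam" "lam > 0" and w: "w \<in> verts N"
  shows "\<bar>enn2real (target_hitting N E w) - vol N E / real (deg N E w)\<bar>
    \<le> 2 + vol N E / (real (deg N E w))\<^sup>2 + (vol N E / real (deg N E w) + real N) / lam"
proof -
  obtain h where h: "h w = 0" "\<And>v. v \<in> verts N \<Longrightarrow> h v \<ge> 0"
    "\<And>v. v \<in> verts N \<Longrightarrow> hitting N E v w = ennreal (h v)"
    "\<And>v. v \<in> verts N \<Longrightarrow> v \<noteq> w \<Longrightarrow> real (deg N E v) * h v
       = real (deg N E v) + (\<Sum>u\<in>verts N. adj E v u * h u)"
    using hitting_equation[OF N P w] by blast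
  have dw: "real (deg N E w) > 0"
    using poincare_imp_degree_pos[OF finite_verts, of N "adj E" lam w] N P w adj_commute
    by (simp add: adj_def sum_adj[symmetric])
  have v0: "vol N E \<ge> 0" by (simp add: vol_def sum_nonneg)
  have "target_hitting N E w = (\<Sum>v\<in>verts N. ennreal (real (deg N E v) / vol N E * h v))"
    unfolding target_hitting_def inv_distr_def handshake[OF E]
  proof (rule sum.cong[OF refl])
    fix v assume v: "v \<in> verts N"
    show "ennreal (real (deg N E v) / vol N E) * hitting N E v w = ennreal (real (deg N E v) / vol N E * h v)"
      unfolding h(3)[OF v] using h(2)[OF v] v0 by (intro ennreal_mult[symmetric]) auto
  qed
  also have "\<dots> = ennreal (\<Sum>v\<in>verts N. real (deg N E v) / vol N E * h v)"
    by (intro sum_ennreal) (simp add: h v0)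
  finally have "enn2real (target_hitting N E w) = (\<Sum>v\<in>verts N. real (deg N E v) / vol N E * h v)"
    by (simp add: h v0 sum_nonneg)
  also have "\<dots> = (\<Sum>v\<in>verts N. real (deg N E v) * h v) / vol N E"
    by (simp add: sum_divide_distrib)
  finally have "enn2real (target_hitting N E w) = (\<Sum>v\<in>verts N. real (deg N E v) * h v) / vol N E" .
  then show ?thesis
    by (simp only:) (rule target_hitting_approx[where V = "verts N" and a = "adj E" and h = h, simplified card_verts];
      (use P w h dw in \<open>simp_all add: sum_adj vol_def adj_commute[of E]\<close>)?; simp add: adj_def)
qed

section \<open>Expansion of the random graph\<close>

locale block_model =
  fixes M N :: nat and B :: "nat \<Rightarrow> nat set" and p q :: real
  assumes M: "M \<ge> 1" and blocks: "equal_blocks M N B" and p01: "p \<in> {0..1}" and q01: "q \<in> {0..1}"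
begin

sublocale bernoulli_product "vpairs N" "edge_prob M B p q"
  using p01 q01 by unfold_locales (auto simp: edge_prob_def)

definition same_block :: "nat \<Rightarrow> nat \<Rightarrow> bool" where
  "same_block x y \<longleftrightarrow> (\<exists>i\<in>{1..M}. x \<in> B i \<and> y \<in> B i)"

lemma edge_prob_pair: "edge_prob M B p q {x, y} = (if same_block x y then p else q)"
  by (simp add: edge_prob_def same_block_def)

lemma same_block_commute: "same_block x y = same_block y x"
  by (auto simp: same_block_def)

lemma finite_block: "i \<in> {1..M} \<Longrightarrow> finite (B i)"
  and block_subset: "i \<in> {1..M} \<Longrightarrow> B i \<subseteq> verts N"
  and card_block: "i \<in> {1..M} \<Longrightarrow> real (card (B i)) = real N / real M"
proof -
  show sub: "i \<in> {1..M} \<Longrightarrow> B i \<subseteq> verts N" for i using blocks unfolding equal_blocks_def by blast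
  show "i \<in> {1..M} \<Longrightarrow> finite (B i)" using sub finite_verts finite_subset by blast
  show "i \<in> {1..M} \<Longrightarrow> real (card (B i)) = real N / real M" using blocks unfolding equal_blocks_def by blast
qed

lemma block_exists:
  assumes "x \<in> verts N"
  obtains i where "i \<in> {1..M}" "x \<in> B i"
proof -
  have "x \<in> (\<Union>i\<in>{1..M}. B i)" using assms blocks unfolding equal_blocks_def by simp
  then show ?thesis using that by (elim UN_E)
qed

lemma block_unique:
  assumes "i \<in> {1..M}" "j \<in> {1..M}" "x \<in> B i" "x \<in> B j"
  shows "i = j"
proof (rule ccontr)
  assume "i \<noteq> j"
  then have "B i \<inter> B j = {}"
    using assms(1,2) blocks unfolding equal_blocks_def by (intro disjoint_family_onD) auto
  then show False using assms(3,4) by (simp add: disjoint_iff)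
qed

text \<open>Every vertex sees N / M vertices in its own block, itself included, so mean and variance
  of a degree do not depend on the vertex.\<close>

lemma sum_same_block:
  assumes "x \<in> verts N"
  shows "(\<Sum>y\<in>verts N. if same_block x y then a else b) = real N / real M * a + (real N - real N / real M) * (b::real)"
proof -
  obtain i where i: "i \<in> {1..M}" "x \<in> B i" using block_exists[OF assms] by blast
  have eq: "same_block x y \<longleftrightarrow> y \<in> B i" for y
    using i block_unique unfolding same_block_def by blast
  have "(\<Sum>y\<in>verts N. if same_block x y then a else b) = (\<Sum>y\<in>verts N. b + (a - b) * of_bool (y \<in> B i))"
    by (intro sum.cong) (auto simp: eq)
  also have "\<dots> = real N * b + (a - b) * real (card (verts N \<inter> B i))"
    by (simp add: sum.distrib sum_distrib_left[symmetric])
  also have "verts N \<inter> B i = B i" using block_subset[OF i(1)] by blast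
  finally show ?thesis unfolding card_block[OF i(1)] 
    by (simp add: left_diff_distrib right_diff_distrib diff_divide_distrib mult.commute)
qed

text \<open>The edges that make the graph an expander: their probability \<open>rate\<close> is the one that the
  hypothesis on \<open>q\<close> bounds from below if \<open>M \<ge> 2\<close>.\<close>

definition active :: "nat \<Rightarrow> nat \<Rightarrow> bool" where
  "active x y \<longleftrightarrow> M = 1 \<or> \<not> same_block x y"

definition rate :: real where
  "rate = (if M = 1 then p else q)"

lemma active_commute: "active x y = active y x"
  by (simp add: active_def same_block_commute)

lemma rate01: "0 \<le> rate" "rate \<le> 1"
  using p01 q01 by (auto simp: rate_def)

lemma edge_prob_active:
  assumes "active x y" "x \<in> verts N" "y \<in> verts N"
  shows "edge_prob M B p q {x, y} = rate"
proof (cases "M = 1")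
  case True
  then have "same_block x y"
  proof -
    obtain i where "i \<in> {1..M}" "x \<in> B i" using block_exists[OF assms(2)] .
    moreover obtain j where "j \<in> {1..M}" "y \<in> B j" using block_exists[OF assms(3)] .
    ultimately have "i \<in> {1..M}" "x \<in> B i" "y \<in> B i" using True by simp_all
    then show ?thesis unfolding same_block_def by blast
  qed
  then show ?thesis unfolding edge_prob_pair rate_def using True by (simp only: if_True simp_thms)
qed (use assms in \<open>simp add: edge_prob_pair active_def rate_def\<close>)

text \<open>If \<open>S\<close> has s_i points in block i, the count is the sum of s_i (N / M -
  s_i), and by convexity the squares sum to at least |S|^2 / M.\<close>

lemma sum_same_block_cut_le:
  assumes S: "S \<subseteq> verts N"
  shows "(\<Sum>x\<in>S. \<Sum>y\<in>verts N - S. of_bool (same_block x y))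
    \<le> real N / real M * real (card S) - (real (card S))\<^sup>2 / real M"
proof -
  have fin: "finite S" using S finite_verts finite_subset by blast
  define s where "s i = real (card (S \<inter> B i))" for i
  have le: "of_bool (same_block x y) \<le> (\<Sum>i\<in>{1..M}. of_bool (x \<in> B i) * of_bool (y \<in> B i) :: real)" for x y
  proof (cases "same_block x y")
    case True
    then obtain i where i: "i \<in> {1..M}" "x \<in> B i" "y \<in> B i" by (auto simp: same_block_def)
    have "of_bool (x \<in> B i) * of_bool (y \<in> B i) \<le> (\<Sum>i\<in>{1..M}. of_bool (x \<in> B i) * of_bool (y \<in> B i) :: real)"
      by (rule member_le_sum) (use i in auto)
    then show ?thesis using i True by simp
  qed (simp add: sum_nonneg)
  have ss: "(\<Sum>i\<in>{1..M}. s i) = real (card S)"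
  proof -
    have "(\<Sum>i\<in>{1..M}. s i) = (\<Sum>i\<in>{1..M}. \<Sum>x\<in>S. of_bool (x \<in> B i))"
      using fin by (simp add: s_def)
    also have "\<dots> = (\<Sum>x\<in>S. \<Sum>i\<in>{1..M}. of_bool (x \<in> B i))" by (rule sum.swap)
    also have "\<dots> = (\<Sum>x\<in>S. 1)"
    proof (rule sum.cong[OF refl])
      fix x assume "x \<in> S"
      then obtain i where i: "i \<in> {1..M}" "x \<in> B i" using S block_exists by blast
      then have "{1..M} \<inter> {i. x \<in> B i} = {i}" using block_unique by blast
      then show "(\<Sum>i\<in>{1..M}. of_bool (x \<in> B i)) = (1::real)" by simp
    qed
    finally show ?thesis by simp
  qed
  have "(\<Sum>x\<in>S. \<Sum>y\<in>verts N - S. of_bool (same_block x y))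
      \<le> (\<Sum>x\<in>S. \<Sum>y\<in>verts N - S. \<Sum>i\<in>{1..M}. of_bool (x \<in> B i) * of_bool (y \<in> B i) :: real)"
    by (intro sum_mono le)
  also have "\<dots> = (\<Sum>i\<in>{1..M}. (\<Sum>x\<in>S. of_bool (x \<in> B i)) * (\<Sum>y\<in>verts N - S. of_bool (y \<in> B i)))"
    unfolding sum_product by (subst sum.swap[of _ "{1..M}"]) (subst sum.swap[of _ "{1..M}"], rule refl)
  also have "\<dots> = (\<Sum>i\<in>{1..M}. s i * (real N / real M - s i))"
  proof (intro sum.cong refl arg_cong2[where f = "(*)"])
    fix i assume i: "i \<in> {1..M}"
    show "(\<Sum>x\<in>S. of_bool (x \<in> B i)) = s i" using fin by (simp add: s_def)
    have "(verts N - S) \<inter> B i = B i - (S \<inter> B i)" using block_subset[OF i] by blast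
    then have "(\<Sum>y\<in>verts N - S. of_bool (y \<in> B i)) = real (card (B i - (S \<inter> B i)))" by simp
    also have "\<dots> = real (card (B i)) - s i"
      using finite_block[OF i] by (simp add: s_def card_Diff_subset card_mono)
    finally show "(\<Sum>y\<in>verts N - S. of_bool (y \<in> B i)) = real N / real M - s i" by (simp add: card_block[OF i])
  qed
  \<comment> \<open>The square is replaced by its tangent line at the average |S| / M.\<close>
  also have "\<dots> \<le> (\<Sum>i\<in>{1..M}. s i * (real N / real M) - (2 * (real (card S) / real M) * s i - (real (card S) / real M)\<^sup>2))"
  proof (rule sum_mono)
    fix i
    have "0 \<le> (s i - real (card S) / real M)\<^sup>2" by simp
    then show "s i * (real N / real M - s i)
        \<le> s i * (real N / real M) - (2 * (real (card S) / real M) * s i - (real (card S) / real M)\<^sup>2)"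
      by (simp add: power2_eq_square algebra_simps)
  qed
  also have "\<dots> = real (card S) * (real N / real M)
      - (2 * (real (card S) / real M) * real (card S) - real M * (real (card S) / real M)\<^sup>2)"
    unfolding sum_subtractf sum_distrib_left[symmetric] sum_distrib_right[symmetric] ss by simp
  also have "\<dots> = real N / real M * real (card S) - (real (card S))\<^sup>2 / real M"
  proof -
    have "real M * (c / real M)\<^sup>2 = c\<^sup>2 / real M" "2 * (c / real M) * c = 2 * (c\<^sup>2 / real M)" for c
      using M by (simp_all add: power2_eq_square)
    then show ?thesis by (simp only:) (simp add: mult.commute)
  qed
  finally show ?thesis .
qed

text \<open>For M >= 2 at most a share 1 / M, hence at most half, of the s (n - s) pairs across the
  cut lie within a block; and n - s >= n / 2.\<close>

lemma active_cut_ge: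
  assumes S: "S \<subseteq> verts N" "2 * card S \<le> N"
  shows "real (card S) * real N / 4 \<le> (\<Sum>x\<in>S. \<Sum>y\<in>verts N - S. of_bool (active x y))"
proof -
  define s n m where "s = real (card S)" and "n = real N" and "m = real M"
  have fin: "finite S" using S finite_verts finite_subset by blast
  have s: "0 \<le> s" "2 * s \<le> n" using S(2) by (simp_all add: s_def n_def)
  have card: "real (card (verts N - S)) = n - s"
    using S fin card_mono[OF finite_verts S(1)] by (simp add: card_Diff_subset s_def n_def of_nat_diff)
  have tot: "(\<Sum>x\<in>S. \<Sum>y\<in>verts N - S. 1) = s * (n - s)" using card by (simp add: s_def)
  have half: "s * n / 4 \<le> s * (n - s) / 2"
    using s mult_left_mono[of "n / 2" "n - s" s] by (simp add: algebra_simps)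
  show ?thesis
  proof (cases "M = 1")
    case True
    have "0 \<le> s * (n - s)" using s by (intro mult_nonneg_nonneg) auto
    moreover have "(\<Sum>x\<in>S. \<Sum>y\<in>verts N - S. of_bool (active x y)) = s * (n - s)"
      unfolding tot[symmetric] active_def using True by simp
    moreover have "s * (n - s) / 2 \<le> s * (n - s)" using \<open>0 \<le> s * (n - s)\<close> by linarith
    ultimately show ?thesis using half unfolding s_def[symmetric] n_def[symmetric] by linarith
  next
    case False
    then have m: "m \<ge> 2" using M by (simp add: m_def)
    have "(\<Sum>x\<in>S. \<Sum>y\<in>verts N - S. of_bool (active x y))
        = (\<Sum>x\<in>S. \<Sum>y\<in>verts N - S. 1) - (\<Sum>x\<in>S. \<Sum>y\<in>verts N - S. of_bool (same_block x y) :: real)"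
      unfolding sum_subtractf[symmetric] using False by (intro sum.cong refl) (simp add: active_def)
    also have "\<dots> \<ge> s * (n - s) - (n / m * s - s\<^sup>2 / m)"
      using sum_same_block_cut_le[OF S(1)] unfolding tot s_def[symmetric] n_def[symmetric] m_def[symmetric]
      by linarith
    also have "s * (n - s) - (n / m * s - s\<^sup>2 / m) = s * (n - s) * (1 - 1 / m)"
    proof -
      have "s * (n - s) * (1 - 1 / m) = s * (n - s) - s * (n - s) / m" by (simp add: right_diff_distrib)
      also have "s * (n - s) / m = n / m * s - s\<^sup>2 / m"
        by (simp add: power2_eq_square right_diff_distrib diff_divide_distrib)
      finally show ?thesis by simp
    qed
    also have "\<dots> \<ge> s * (n - s) * (1 / 2)"
      using s m by (intro mult_left_mono mult_nonneg_nonneg) (auto simp: field_simps)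
    finally show ?thesis using half unfolding s_def[symmetric] n_def[symmetric] by linarith
  qed
qed

definition active_adj :: "(nat set \<Rightarrow> bool) \<Rightarrow> nat \<Rightarrow> nat \<Rightarrow> real" where
  "active_adj a x y = of_bool (active x y) * of_bool (a {x, y})"

text \<open>The cut separates the two endpoints, so distinct ordered pairs give distinct, hence
  independent, edges. The mean is at least N rate |S| / 4; half of it is the threshold and an eighth
  of it the exponent, which is linear in |S| so that the bounds can be summed over all cuts.\<close>

lemma prob_small_cut:
  assumes S: "S \<subseteq> verts N" "2 * card S \<le> N"
  shows "measure Q {a. (\<Sum>x\<in>S. \<Sum>y\<in>verts N - S. active_adj a x y) \<le> real N * rate / 8 * real (card S)}
    \<le> exp (- (real N * rate / 32)) ^ card S"
proof -
  have fin: "finite S" using S finite_verts finite_subset by blast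
  define P where "P = {z \<in> S \<times> (verts N - S). active (fst z) (snd z)}"
  define g where "g z = {fst z, snd z}" for z :: "nat \<times> nat"
  have finP: "finite P" using fin by (simp add: P_def)
  have inj: "inj_on g P"
    by (rule inj_onI) (auto simp: P_def g_def doubleton_eq_iff)
  have pair: "{x, y} \<in> vpairs N" if "x \<in> verts N" "y \<in> verts N" for x y
    unfolding vpairs_def using that by (intro CollectI exI[of _ x] exI[of _ y]) auto
  have sub: "g ` P \<subseteq> vpairs N"
    using S(1) by (intro image_subsetI) (simp add: P_def g_def pair subset_iff mem_Times_iff)
  have sum: "(\<Sum>x\<in>S. \<Sum>y\<in>verts N - S. of_bool (active x y) * f {x, y}) = (\<Sum>e\<in>g ` P. f e)" for f :: "nat set \<Rightarrow> real"
  proof -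
    have "(\<Sum>x\<in>S. \<Sum>y\<in>verts N - S. of_bool (active x y) * f {x, y})
        = (\<Sum>z\<in>S \<times> (verts N - S). if active (fst z) (snd z) then f (g z) else 0)"
      unfolding sum.cartesian_product by (rule sum.cong[OF refl]) (simp add: g_def case_prod_beta)
    also have "\<dots> = (\<Sum>z\<in>P. f (g z))" using fin by (simp add: P_def sum.inter_filter)
    also have "\<dots> = (\<Sum>e\<in>g ` P. f e)" by (simp add: sum.reindex[OF inj])
    finally show ?thesis .
  qed
  have "(\<Sum>e\<in>g ` P. edge_prob M B p q e) = (\<Sum>e\<in>g ` P. rate)"
    using S by (intro sum.cong refl) (auto simp: P_def g_def intro!: edge_prob_active)
  also have "\<dots> = rate * (\<Sum>x\<in>S. \<Sum>y\<in>verts N - S. of_bool (active x y))"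
    using sum[of "\<lambda>_. 1"] by simp
  also have "\<dots> \<ge> rate * (real (card S) * real N / 4)"
    by (intro mult_left_mono active_cut_ge S rate01)
  finally have ge: "rate * (real (card S) * real N / 4) \<le> (\<Sum>e\<in>g ` P. edge_prob M B p q e)" .
  have "measure Q {a. (\<Sum>e\<in>g ` P. of_bool (a e)) \<le> rate * (real (card S) * real N / 4) / 2}
      \<le> exp (- (rate * (real (card S) * real N / 4)) / 8)"
    by (rule lower_tail[OF sub ge])
  also have "\<dots> = exp (- (real N * rate / 32)) ^ card S"
    by (simp add: exp_of_nat_mult[symmetric] field_simps)
  finally show ?thesis
    unfolding active_adj_def sum[of "\<lambda>e. of_bool (a e)" for a] by (simp add: field_simps)
qed

lemma prob_large_active_degree:
  assumes x: "x \<in> verts N"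
  shows "measure Q {a. (\<Sum>y\<in>verts N. active_adj a x y) \<ge> 3 * (real N * rate)} \<le> exp (- (real N * rate))"
proof -
  define P where "P = {y \<in> verts N. active x y}"
  define g where "g y = {x, y}" for y
  have inj: "inj_on g P"
    by (rule inj_onI) (auto simp: g_def doubleton_eq_iff)
  have pair: "{x, y} \<in> vpairs N" if "y \<in> verts N" for y
    unfolding vpairs_def using x that by (intro CollectI exI[of _ x] exI[of _ y]) auto
  have sub: "g ` P \<subseteq> vpairs N" by (intro image_subsetI) (simp add: P_def g_def pair)
  have sum: "(\<Sum>y\<in>verts N. of_bool (active x y) * f {x, y}) = (\<Sum>e\<in>g ` P. f e)" for f :: "nat set \<Rightarrow> real"
  proof -
    have "(\<Sum>y\<in>verts N. of_bool (active x y) * f {x, y}) = (\<Sum>y\<in>verts N. if active x y then f (g y) else 0)"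
      by (intro sum.cong) (auto simp: g_def)
    also have "\<dots> = (\<Sum>y\<in>P. f (g y))" by (simp add: P_def sum.inter_filter)
    also have "\<dots> = (\<Sum>e\<in>g ` P. f e)" by (simp add: sum.reindex[OF inj])
    finally show ?thesis .
  qed
  have "(\<Sum>e\<in>g ` P. edge_prob M B p q e) = (\<Sum>e\<in>g ` P. rate)"
    using x by (intro sum.cong refl) (auto simp: P_def g_def intro!: edge_prob_active)
  also have "\<dots> = real (card P) * rate" using inj by (simp add: card_image)
  also have "\<dots> \<le> real N * rate"
    using card_mono[of "verts N" P] rate01 by (intro mult_right_mono) (auto simp: P_def)
  finally have le: "(\<Sum>e\<in>g ` P. edge_prob M B p q e) \<le> real N * rate" .
  show ?thesis
    using upper_tail[OF sub le] unfolding active_adj_def sum[of "\<lambda>e. of_bool (a e)" for a] .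
qed

text \<open>Off the bad events Cheeger's inequality applies with h = N rate / 8 and dm = 3 N rate,
  and h^2 / (2 dm) = N rate / 384. In the union bound, z^|S| summed over the nonempty S gives (1 +
  z)^N - 1.\<close>

lemma prob_not_poincare_le:
  assumes rate: "rate > 0" and N: "N \<ge> 1"
  shows "measure Q {a. \<not> poincare (verts N) (adj {e. a e}) (real N * rate / 384)}
    \<le> (1 + exp (- (real N * rate / 32))) ^ N - 1 + real N * exp (- (real N * rate))"
proof -
  \<comment> \<open>The empty set is left out because its event \<open>C {}\<close> always
    occurs.\<close>
  define F where "F = {S. S \<subseteq> verts N \<and> S \<noteq> {} \<and> 2 * card S \<le> N}"
  define C where "C S = {a. (\<Sum>x\<in>S. \<Sum>y\<in>verts N - S. active_adj a x y) \<le> real N * rate / 8 * real (card S)}" for S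
  define G where "G x = {a. (\<Sum>y\<in>verts N. active_adj a x y) \<ge> 3 * (real N * rate)}" for x
  have finF: "finite F" unfolding F_def by (rule finite_subset[of _ "Pow (verts N)"]) auto
  have "{a. \<not> poincare (verts N) (adj {e. a e}) (real N * rate / 384)} \<subseteq> (\<Union>S\<in>F. C S) \<union> (\<Union>x\<in>verts N. G x)"
  proof (rule ccontr)
    assume "\<not> ?thesis"
    then obtain a where np: "\<not> poincare (verts N) (adj {e. a e}) (real N * rate / 384)"
      and aC: "\<And>S. S \<in> F \<Longrightarrow> a \<notin> C S" and aG: "\<And>x. x \<in> verts N \<Longrightarrow> a \<notin> G x" by blast
    have "poincare (verts N) (active_adj a) ((real N * rate / 8)\<^sup>2 / (2 * (3 * (real N * rate))))"
    proof (rule cheeger_poincare)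
      show "real N * rate / 8 * real (card S) \<le> (\<Sum>x\<in>S. \<Sum>y\<in>verts N - S. active_adj a x y)"
        if "S \<subseteq> verts N" "2 * card S \<le> card (verts N)" for S
      proof (cases "S = {}")
        case False
        then show ?thesis using aC[of S] that by (simp add: F_def C_def)
      qed simp
      show "(\<Sum>y\<in>verts N. active_adj a x y) \<le> 3 * (real N * rate)" if "x \<in> verts N" for x
        using aG[OF that] by (simp add: G_def)
    qed (use rate N in \<open>auto simp: active_adj_def active_commute insert_commute\<close>)
    then have "poincare (verts N) (adj {e. a e}) ((real N * rate / 8)\<^sup>2 / (2 * (3 * (real N * rate))))"
      by (rule poincare_mono) (auto simp: active_adj_def adj_def)
    also have "(real N * rate / 8)\<^sup>2 / (2 * (3 * (real N * rate))) = real N * rate / 384"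
      using rate N by (simp add: power2_eq_square)
    finally show False using np by simp
  qed
  then have "measure Q {a. \<not> poincare (verts N) (adj {e. a e}) (real N * rate / 384)}
      \<le> measure Q ((\<Union>S\<in>F. C S) \<union> (\<Union>x\<in>verts N. G x))"
    by (intro measure_pmf.finite_measure_mono) auto
  also have "\<dots> \<le> measure Q (\<Union>S\<in>F. C S) + measure Q (\<Union>x\<in>verts N. G x)"
    by (rule measure_Un_le) auto
  also have "\<dots> \<le> (\<Sum>S\<in>F. measure Q (C S)) + (\<Sum>x\<in>verts N. measure Q (G x))"
    using finF by (intro add_mono measure_UNION_le) auto
  also have "\<dots> \<le> (\<Sum>S\<in>F. exp (- (real N * rate / 32)) ^ card S) + (\<Sum>x\<in>verts N. exp (- (real N * rate)))"
    unfolding C_def G_def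
    by (intro add_mono sum_mono prob_small_cut prob_large_active_degree) (auto simp: F_def)
  also have "(\<Sum>S\<in>F. exp (- (real N * rate / 32)) ^ card S)
      \<le> (\<Sum>S\<in>Pow (verts N) - {{}}. exp (- (real N * rate / 32)) ^ card S)"
    by (rule sum_mono2) (auto simp: F_def)
  also have "\<dots> = (\<Sum>S\<in>Pow (verts N). exp (- (real N * rate / 32)) ^ card S) - 1"
    by (simp add: sum_diff1)
  also have "(\<Sum>S\<in>Pow (verts N). exp (- (real N * rate / 32)) ^ card S) = (1 + exp (- (real N * rate / 32))) ^ N"
    using prod_add[of "verts N" "\<lambda>_. exp (- (real N * rate / 32))" "\<lambda>_. 1"] by (simp add: add.commute)
  finally show ?thesis by simp
qed

end

section \<open>A non-asymptotic bound for the characteristic function\<close>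

text \<open>On the event described by the hypotheses, \<open>H\<close> is \<open>N - N (d - D) / D\<close> up to a small error:
  \<open>H\<close> is close to \<open>vol / d\<close>, and \<open>vol / d\<close> is linearized at \<open>vol = N D\<close>, \<open>d = D\<close>.\<close>

lemma linearized_hitting_error:
  fixes n d D vol H sig lam :: real
  assumes n: "n > 0" and sig: "sig \<ge> 16" "sig\<^sup>2 \<le> D"
    and lam: "lam > 0" "2 * lam \<le> D" "2 * lam \<le> n"
    and d: "(d - D)\<^sup>2 \<le> sig\<^sup>2 * sqrt sig" and vol: "\<bar>vol - n * D\<bar> \<le> n * sqrt sig"
    and H: "\<bar>H - vol / d\<bar> \<le> 2 + vol / d\<^sup>2 + (vol / d + n) / lam"
  shows "\<bar>H - n + n * ((d - D) / D)\<bar> \<le> 4 * n * sqrt sig / D + 6 * n / lam"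
proof -
  define u where "u = sqrt sig"
  \<comment> \<open>Since D >= u^4 >= 64 u, the deviation of \<open>d\<close> is at most D / 8,
    whence 1 / d <= 2 / D.\<close>
  have u: "u \<ge> 4" "sig = u\<^sup>2" using sig real_sqrt_le_mono[of 16 sig] by (simp_all add: u_def)
  have D: "D \<ge> u ^ 4" using sig(2) u by (simp add: power_mult[symmetric])
  have u64: "64 * u \<le> u ^ 4"
    using power_mono[of 4 u 3] u mult_right_mono[of 64 "u ^ 3" u] by (simp add: power4_eq_xxxx power3_eq_cube)
  have D64: "64 * u \<le> D" using D u64 by linarith
  then have D0: "D > 0" using u by linarith
  have d': "(d - D)\<^sup>2 \<le> u * D"
  proof -
    have "(d - D)\<^sup>2 \<le> sig\<^sup>2 * u" using d by (simp add: u_def)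
    also have "\<dots> \<le> D * u" using sig u by (intro mult_right_mono) auto
    finally show ?thesis by (simp add: mult.commute)
  qed
  have "\<bar>d - D\<bar> \<le> D / 8"
  proof -
    have "u * D \<le> D / 64 * D" using D64 D0 by (intro mult_right_mono) auto
    with d' have "(d - D)\<^sup>2 \<le> (D / 8)\<^sup>2" by (simp add: power2_eq_square)
    then show ?thesis using abs_le_square_iff[of "d - D" "D / 8"] D0 by simp
  qed
  then have dd: "d \<ge> 7 / 8 * D" by linarith
  then have d0: "d > 0" using D0 by linarith
  have dlam: "lam \<le> d" using dd lam D0 by linarith
  have volle: "vol \<le> n * (D * (65 / 64))"
  proof -
    have "vol \<le> n * D + n * u" using vol by (simp add: u_def)
    also have "n * u \<le> n * (D / 64)" using D64 n by (intro mult_left_mono) auto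
    finally show ?thesis by (simp add: algebra_simps)
  qed
  have vd: "vol / d \<le> 2 * n"
  proof -
    have "vol \<le> 2 * n * (7 / 8 * D)" 
      using volle mult_pos_pos[OF n D0] by (simp add: algebra_simps)
    also have "\<dots> \<le> 2 * n * d" using dd n by (intro mult_left_mono) auto
    finally show ?thesis using d0 by (simp add: field_simps)
  qed
  have vol0: "vol \<ge> 0"
  proof -
    have "n * u \<le> n * D" using D64 u n by (intro mult_left_mono) auto
    then show ?thesis using vol by (simp add: u_def abs_le_iff)
  qed
  have 1: "\<bar>H - vol / d\<bar> \<le> 6 * n / lam"
  proof -
    have "vol / d\<^sup>2 = (vol / d) / d" by (simp add: power2_eq_square)
    also have "\<dots> \<le> (2 * n) / lam" using vd dlam lam n by (intro frac_le) auto
    finally have a: "vol / d\<^sup>2 \<le> 2 * n / lam" .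
    have b: "(vol / d + n) / lam \<le> 3 * n / lam" using vd lam by (intro divide_right_mono) auto
    have c: "2 \<le> n / lam" using lam by (simp add: field_simps)
    have "6 * n / lam = 2 * n / lam + 3 * n / lam + n / lam" by (simp add: add_divide_distrib[symmetric])
    then show ?thesis using H a b c by linarith
  qed
  have 2: "\<bar>vol / d - n + n * ((d - D) / D)\<bar> \<le> 4 * n * u / D"
  proof -
    \<comment> \<open>The terms linear in d - D cancel; what is left is the volume error and a
      quadratic remainder.\<close>
    have eq: "vol / d - n + n * ((d - D) / D) = (vol - n * D) / d + n * ((d - D)\<^sup>2 / (d * D))"
      using d0 D0 by (simp add: power2_eq_square field_simps)
    have fr: "1 / d \<le> 2 / D" using dd d0 D0 by (simp add: field_simps)
    have "\<bar>(vol - n * D) / d\<bar> = \<bar>vol - n * D\<bar> * (1 / d)" using d0 by (simp add: abs_divide)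
    also have "\<dots> \<le> n * u * (2 / D)" 
    proof (rule mult_mono)
      show "\<bar>vol - n * D\<bar> \<le> n * u" using vol by (simp only: u_def)
    qed (use fr n u d0 in simp_all)
    finally have a: "\<bar>(vol - n * D) / d\<bar> \<le> 2 * n * u / D" by (simp add: mult_ac)
    have "(d - D)\<^sup>2 / (d * D) = (d - D)\<^sup>2 / D * (1 / d)" by simp
    also have "\<dots> \<le> u * (2 / D)"
    proof (rule mult_mono)
      show "(d - D)\<^sup>2 / D \<le> u" using d' D0 by (simp add: divide_le_eq)
    qed (use fr d0 u in simp_all)
    finally have "n * ((d - D)\<^sup>2 / (d * D)) \<le> n * (u * (2 / D))" using n by (intro mult_left_mono) auto
    then have b: "\<bar>n * ((d - D)\<^sup>2 / (d * D))\<bar> \<le> 2 * n * u / D"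
      using n d0 D0 by (simp add: mult_ac)
    have "4 * n * u / D = 2 * n * u / D + 2 * n * u / D" by simp
    show ?thesis
      unfolding eq \<open>4 * n * u / D = 2 * n * u / D + 2 * n * u / D\<close>
      by (intro order_trans[OF abs_triangle_ineq] add_mono a b)
  qed
  have "H - n + n * ((d - D) / D) = (H - vol / d) + (vol / d - n + n * ((d - D) / D))" by simp
  also have "\<bar>\<dots>\<bar> \<le> 6 * n / lam + 4 * n * u / D" by (rule order_trans[OF abs_triangle_ineq add_mono[OF 1 2]])
  finally show ?thesis by (simp add: u_def)
qed

lemma norm_iexp_diff_le: "cmod (iexp x - iexp y) \<le> \<bar>x - y\<bar>"
proof -
  have "iexp x - iexp y = iexp y * (iexp (x - y) - 1)"
    by (simp add: right_diff_distrib mult_exp_exp algebra_simps)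
  then show ?thesis using iexp_approx1[of "x - y" 0] by (simp add: norm_mult)
qed

section \<open>Degree and volume of the random graph, and the resulting characteristic
  function\<close>

context block_model
begin

definition mean_degree :: real where
  "mean_degree = real N / real M * p + (real N - real N / real M) * q"

definition var_degree :: real where
  "var_degree = real N / real M * (p * (1 - p)) + (real N - real N / real M) * (q * (1 - q))"

lemma N_div_M_le: "real N / real M \<le> real N"
  using M divide_left_mono[of 1 "real M" "real N"] by simp

lemma var_degree_le_mean: "var_degree \<le> mean_degree"
  unfolding var_degree_def mean_degree_def using p01 q01 N_div_M_le
  by (intro add_mono mult_left_mono) (auto simp: mult_left_le)

lemma var_degree_le: "var_degree \<le> real N"
proof -
  have "p * (1 - p) \<le> 1" "q * (1 - q) \<le> 1"
    using p01 q01 mult_mono[of p 1 "1 - p" 1] mult_mono[of q 1 "1 - q" 1] by auto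
  then have "var_degree \<le> real N / real M * 1 + (real N - real N / real M) * 1"
    unfolding var_degree_def using N_div_M_le by (intro add_mono mult_left_mono) auto
  then show ?thesis by simp
qed

lemma mean_degree_ge_rate: "real N * rate / 2 \<le> mean_degree"
proof (cases "M = 1")
  case True
  then have "mean_degree = real N * p" "rate = p" unfolding mean_degree_def rate_def by simp_all
  then show ?thesis using p01 by simp
next
  case False
  then have "real N / real M \<le> real N / 2" using M by (intro divide_left_mono) auto
  then have "(real N / 2) * q \<le> (real N - real N / real M) * q" using q01 by (intro mult_right_mono) auto
  moreover have "0 \<le> real N / real M * p" using p01 by simp
  moreover have "real N * rate / 2 = (real N / 2) * q" using False by (simp add: rate_def)
  ultimately show ?thesis unfolding mean_degree_def by linarith
qed

lemma sum_edge_prob: "x \<in> verts N \<Longrightarrow> (\<Sum>y\<in>verts N. edge_prob M B p q {x, y}) = mean_degree"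
  unfolding edge_prob_pair mean_degree_def by (rule sum_same_block)

lemma sum_edge_var:
  assumes "x \<in> verts N"
  shows "(\<Sum>y\<in>verts N. edge_prob M B p q {x, y} * (1 - edge_prob M B p q {x, y})) = var_degree"
  unfolding var_degree_def sum_same_block[OF assms, symmetric] edge_prob_pair
  by (intro sum.cong) auto

definition star :: "nat \<Rightarrow> nat set set" where
  "star w = (\<lambda>u. {w, u}) ` verts N"

lemma star_subset: "w \<in> verts N \<Longrightarrow> star w \<subseteq> vpairs N"
  unfolding star_def vpairs_def by (intro image_subsetI CollectI) blast

lemma sum_star: "(\<Sum>e\<in>star w. f e) = (\<Sum>u\<in>verts N. (f {w, u} :: real))"
proof -
  have "inj_on (\<lambda>u. {w, u}) (verts N)"
    by (rule inj_onI) (auto simp: doubleton_eq_iff)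
  then show ?thesis by (simp add: star_def sum.reindex)
qed

lemma degree_deviation:
  assumes "w \<in> verts N"
  shows "(\<Sum>e\<in>star w. of_bool (a e) - edge_prob M B p q e) = real (deg N {e. a e} w) - mean_degree"
  unfolding sum_star sum_subtractf sum_edge_prob[OF assms] by (simp add: sum_adj[symmetric] adj_def)

lemma vol_deviation:
  "(\<Sum>e\<in>vpairs N. (if \<exists>v. e = {v} then 1 else 2) * (of_bool (a e) - edge_prob M B p q e))
    = vol N {e. a e} - real N * mean_degree"
proof -
  have "vol N {e. a e} = (\<Sum>v\<in>verts N. \<Sum>u\<in>verts N. of_bool (a {v, u}))"
    unfolding vol_def by (intro sum.cong refl) (simp add: sum_adj[symmetric] adj_def)
  moreover have "(\<Sum>v\<in>verts N. \<Sum>u\<in>verts N. edge_prob M B p q {v, u}) = real N * mean_degree"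
    by (simp add: sum_edge_prob)
  ultimately show ?thesis
    unfolding sum_pairs_eq_sum_vpairs[where F = "\<lambda>e. of_bool (a e)"]
      sum_pairs_eq_sum_vpairs[where F = "edge_prob M B p q"] right_diff_distrib sum_subtractf
    by simp
qed

text \<open>The threshold sig^(5/4) is far above the standard deviation, so exceeding it is rare.
  Still, as sig^2 <= D, it keeps the quadratic remainder N (d - D)^2 / D^2 below N sqrt(sig) / D,
  which is small against the scale N sig / D of the fluctuations.\<close>

lemma prob_degree_deviation:
  assumes w: "w \<in> verts N" and sig: "sig > 0" "sig\<^sup>2 = var_degree"
  shows "measure Q {a. (real (deg N {e. a e} w) - mean_degree)\<^sup>2 \<ge> sig\<^sup>2 * sqrt sig} \<le> 1 / sqrt sig"
proof -
  define x where "x = sqrt (sig\<^sup>2 * sqrt sig)"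
  have x: "x > 0" "x\<^sup>2 = sig\<^sup>2 * sqrt sig" using sig(1) by (simp_all add: x_def)
  have var: "(\<Sum>e\<in>star w. 1\<^sup>2 * (edge_prob M B p q e * (1 - edge_prob M B p q e))) = sig\<^sup>2"
    unfolding sum_star sig using sum_edge_var[OF w] by simp
  have "measure Q {a. \<bar>\<Sum>e\<in>star w. 1 * (of_bool (a e) - edge_prob M B p q e)\<bar> \<ge> x} \<le> sig\<^sup>2 / x\<^sup>2"
    using chebyshev[OF star_subset[OF w] x(1), of "\<lambda>_. 1"] unfolding var .
  also have "\<dots> = 1 / sqrt sig" using sig(1) by (simp add: x(2))
  also have "{a. \<bar>\<Sum>e\<in>star w. 1 * (of_bool (a e) - edge_prob M B p q e)\<bar> \<ge> x}
      = {a. (real (deg N {e. a e} w) - mean_degree)\<^sup>2 \<ge> sig\<^sup>2 * sqrt sig}"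
    using x(1) unfolding mult_1 degree_deviation[OF w] x(2)[symmetric]
    by (intro Collect_cong) (simp add: abs_le_square_iff[symmetric])
  finally show ?thesis .
qed

text \<open>The degree sum has variance at most 2 N sig^2, so Chebyshev gives 2 sig / N, and sig^2
  <= N.\<close>

lemma prob_vol_deviation:
  assumes N: "N \<ge> 1" and sig: "sig > 0" "sig\<^sup>2 = var_degree"
  shows "measure Q {a. \<bar>vol N {e. a e} - real N * mean_degree\<bar> \<ge> real N * sqrt sig} \<le> 2 / sig"
proof -
  let ?c = "\<lambda>e :: nat set. if \<exists>v. e = {v} then 1 else 2 :: real"
  let ?v = "\<lambda>e. edge_prob M B p q e * (1 - edge_prob M B p q e)"
  have v0: "?v e \<ge> 0" for e using pr_nonneg[of e] pr_le_1[of e] by simp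
  have x: "real N * sqrt sig > 0" using N sig by simp
  \<comment> \<open>Weights 1 and 2 satisfy c^2 <= 2 c; the linear weights turn back into a sum over
    ordered pairs.\<close>
  have "(\<Sum>e\<in>vpairs N. (?c e)\<^sup>2 * ?v e) \<le> (\<Sum>e\<in>vpairs N. 2 * (?c e * ?v e))"
    using v0 by (intro sum_mono) auto
  also have "\<dots> = 2 * (\<Sum>v\<in>verts N. \<Sum>u\<in>verts N. ?v {v, u})"
    by (simp only: sum_pairs_eq_sum_vpairs[where F = ?v] sum_distrib_left)
  also have "\<dots> = 2 * (real N * sig\<^sup>2)" by (simp add: sum_edge_var sig(2))
  finally have var: "(\<Sum>e\<in>vpairs N. (?c e)\<^sup>2 * ?v e) \<le> 2 * (real N * sig\<^sup>2)" .
  have "measure Q {a. \<bar>\<Sum>e\<in>vpairs N. ?c e * (of_bool (a e) - edge_prob M B p q e)\<bar> \<ge> real N * sqrt sig}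
      \<le> (\<Sum>e\<in>vpairs N. (?c e)\<^sup>2 * ?v e) / (real N * sqrt sig)\<^sup>2"
    by (rule chebyshev[OF order_refl x])
  also have "\<dots> \<le> 2 * (real N * sig\<^sup>2) / (real N * sqrt sig)\<^sup>2"
    by (intro divide_right_mono var) simp
  also have "\<dots> = 2 * sig\<^sup>2 / (real N * sig)"
    using N sig by (simp add: power_mult_distrib power2_eq_square)
  also have "\<dots> \<le> 2 * sig\<^sup>2 / (sig\<^sup>2 * sig)"
    using var_degree_le N sig(1) unfolding sig(2)[symmetric]
    by (intro divide_left_mono mult_right_mono mult_pos_pos) auto
  also have "\<dots> = 2 / sig" using sig(1) by simp
  finally show ?thesis unfolding vol_deviation .
qed

lemma set_pmf_Q_subset:
  assumes "a \<in> set_pmf Q"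
  shows "{e. a e} \<subseteq> vpairs N"
  using set_Pi_pmf_subset[OF finite_vpairs, of N False "\<lambda>e. bernoulli_pmf (edge_prob M B p q e)"] assms
  unfolding Q_def by auto

text \<open>On \<open>U\<close> the difference is bounded trivially by 2. In this way disconnected
  graphs, with their conventional hitting times, vanish in the limit.\<close>

lemma norm_expectation_diff_le:
  fixes f g :: "(nat set \<Rightarrow> bool) \<Rightarrow> complex"
  assumes 1: "\<And>a. cmod (f a) \<le> 1" "\<And>a. cmod (g a) \<le> 1"
    and diff: "\<And>a. a \<in> set_pmf Q \<Longrightarrow> a \<notin> U \<Longrightarrow> cmod (f a - g a) \<le> \<delta>" and \<delta>: "\<delta> \<ge> 0"
  shows "cmod ((\<integral>a. f a \<partial>Q) - (\<integral>a. g a \<partial>Q)) \<le> \<delta> + 2 * measure Q U"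
proof -
  have "cmod ((\<integral>a. f a \<partial>Q) - (\<integral>a. g a \<partial>Q)) = cmod (\<integral>a. f a - g a \<partial>Q)"
    by (simp add: Bochner_Integration.integral_diff)
  also have "\<dots> \<le> (\<integral>a. cmod (f a - g a) \<partial>Q)" by (rule integral_norm_bound)
  also have "\<dots> \<le> (\<integral>a. \<delta> + 2 * indicator U a \<partial>Q)"
  proof (intro integral_mono_AE AE_pmfI integrable_Q)
    fix a assume a: "a \<in> set_pmf Q"
    have "cmod (f a - g a) \<le> 2" using 1[of a] norm_triangle_ineq4[of "f a" "g a"] by linarith
    then show "cmod (f a - g a) \<le> \<delta> + 2 * indicator U a"
      using diff[OF a] \<delta> by (cases "a \<in> U") auto
  qed
  also have "\<dots> = \<delta> + 2 * measure Q U" by simp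
  finally show ?thesis .
qed

text \<open>Three errors add up: the normal approximation of the standardized degree
  \<open>W\<close>, the distance between the scaled hitting time and \<open>- c * W\<close> on the
  good event, and twice the probability of the bad event. The minus sign disappears because the
  Gaussian is symmetric.\<close>

lemma char_target_hitting:
  assumes N: "N \<ge> 2" and w: "w \<in> verts N" and rate: "rate > 0"
    and sig: "sig \<ge> 16" "sig\<^sup>2 = var_degree" and r: "r \<ge> 0"
    and c: "c = r * real N * sig / mean_degree"
  shows "cmod ((\<integral>a. iexp (t * (r * (enn2real (target_hitting N {e. a e} w) - real N))) \<partial>Q) - exp (- ((c * t)\<^sup>2 / 2)))
    \<le> \<bar>c * t\<bar> ^ 3 / sig + (c * t) ^ 4 / sig\<^sup>2 + \<bar>t\<bar> * (4 * c / sqrt sig + 6 * 384 * (r / rate))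
      + 2 * (1 / sqrt sig + 2 / sig
        + ((1 + exp (- (real N * rate / 32))) ^ N - 1 + real N * exp (- (real N * rate))))"
proof -
  define lam where "lam = real N * rate / 384"
  define X where "X a = r * (enn2real (target_hitting N {e. a e} w) - real N)" for a
  define W where "W a = (\<Sum>e\<in>star w. of_bool (a e) - edge_prob M B p q e) / sig" for a
  define K where "K = 4 * c / sqrt sig + 6 * 384 * (r / rate)"
  define U1 where "U1 = {a. (real (deg N {e. a e} w) - mean_degree)\<^sup>2 \<ge> sig\<^sup>2 * sqrt sig}"
  define U2 where "U2 = {a. \<bar>vol N {e. a e} - real N * mean_degree\<bar> \<ge> real N * sqrt sig}"
  define U3 where "U3 = {a. \<not> poincare (verts N) (adj {e. a e}) lam}"
  have sig0: "sig > 0" and D: "sig\<^sup>2 \<le> mean_degree"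
    using sig var_degree_le_mean by simp_all
  then have D0: "mean_degree > 0" using zero_less_power[OF sig0, of 2] by linarith
  have c0: "c \<ge> 0" using r sig0 D0 by (simp add: c)
  have K0: "K \<ge> 0" using c0 r rate sig0 by (simp add: K_def)
  have lam0: "lam > 0" using rate N by (simp add: lam_def)
  have lamD: "2 * lam \<le> mean_degree" using mean_degree_ge_rate lam0 by (simp add: lam_def)
  have lamN: "2 * lam \<le> real N" using rate01 mult_left_le[of rate "real N"] by (simp add: lam_def)
  have close: "\<bar>X a - (- c) * W a\<bar> \<le> K" if a: "a \<in> set_pmf Q" "a \<notin> U1 \<union> U2 \<union> U3" for a
  proof -
    define E where "E = {e. a e}"
    define d where "d = real (deg N E w)"
    have P: "poincare (verts N) (adj E) lam" using a by (simp add: U3_def E_def)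
    have "\<bar>enn2real (target_hitting N E w) - real N + real N * ((d - mean_degree) / mean_degree)\<bar>
        \<le> 4 * real N * sqrt sig / mean_degree + 6 * real N / lam"
    proof (rule linearized_hitting_error[OF _ sig(1) D lam0 lamD lamN])
      show "(d - mean_degree)\<^sup>2 \<le> sig\<^sup>2 * sqrt sig" using a by (simp add: U1_def d_def E_def)
      show "\<bar>vol N E - real N * mean_degree\<bar> \<le> real N * sqrt sig" using a by (simp add: U2_def E_def)
      show "\<bar>enn2real (target_hitting N E w) - vol N E / d\<bar>
          \<le> 2 + vol N E / d\<^sup>2 + (vol N E / d + real N) / lam"
        unfolding d_def
        by (rule abs_target_hitting_diff_le[OF N _ P lam0 w]) (use set_pmf_Q_subset[OF a(1)] in \<open>simp add: E_def\<close>)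
    qed (use N in simp)
    then have "r * \<bar>enn2real (target_hitting N E w) - real N + real N * ((d - mean_degree) / mean_degree)\<bar>
        \<le> r * (4 * real N * sqrt sig / mean_degree + 6 * real N / lam)" using r by (rule mult_left_mono)
    also have "r * (4 * real N * sqrt sig / mean_degree + 6 * real N / lam) = K"
    proof -
      have "sqrt sig * sqrt sig = sig" "sqrt sig > 0" using sig0 by simp_all
      \<comment> \<open>Written this way, the linearization error contains the factor c and is of
        order c / sqrt(sig).\<close>
      then have "sqrt sig = sig / sqrt sig" by (simp add: field_simps)
      then have "r * (4 * real N * (sig / sqrt sig) / mean_degree) = r * (4 * real N * sqrt sig / mean_degree)"
        by simp
      moreover have "r * (4 * real N * (sig / sqrt sig) / mean_degree) = 4 * c / sqrt sig"
        unfolding c by (simp add: field_simps)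
      ultimately have "r * (4 * real N * sqrt sig / mean_degree) = 4 * c / sqrt sig" by (rule trans[OF sym])
      moreover have "r * (6 * real N / lam) = 6 * 384 * (r / rate)" using N rate by (simp add: lam_def)
      ultimately show ?thesis by (simp only: K_def distrib_left)
    qed
    also have "r * \<bar>enn2real (target_hitting N E w) - real N + real N * ((d - mean_degree) / mean_degree)\<bar>
        = \<bar>X a - (- c) * W a\<bar>"
    proof -
      have "c * W a = r * (real N * ((d - mean_degree) / mean_degree))"
        using sig0 by (simp add: W_def degree_deviation[OF w] c d_def E_def)
      then have "X a - (- c) * W a
          = r * (enn2real (target_hitting N E w) - real N + real N * ((d - mean_degree) / mean_degree))"
        by (simp add: X_def E_def distrib_left)
      then show ?thesis using r by (simp add: abs_mult)
    qed
    finally show ?thesis .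
  qed
  have 1: "cmod ((\<integral>a. iexp (t * X a) \<partial>Q) - (\<integral>a. iexp ((- c * t) * W a) \<partial>Q))
      \<le> \<bar>t\<bar> * K + 2 * measure Q (U1 \<union> U2 \<union> U3)"
  proof (rule norm_expectation_diff_le)
    fix a assume a: "a \<in> set_pmf Q" "a \<notin> U1 \<union> U2 \<union> U3"
    have "cmod (iexp (t * X a) - iexp ((- c * t) * W a)) \<le> \<bar>t * X a - (- c * t) * W a\<bar>"
      by (rule norm_iexp_diff_le)
    also have "t * X a - (- c * t) * W a = t * (X a - (- c) * W a)" by (simp add: algebra_simps)
    also have "\<bar>\<dots>\<bar> \<le> \<bar>t\<bar> * K" unfolding abs_mult by (intro mult_left_mono close a) auto
    finally show "cmod (iexp (t * X a) - iexp ((- c * t) * W a)) \<le> \<bar>t\<bar> * K" .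
  qed (use K0 in auto)
  have 2: "measure Q (U1 \<union> U2 \<union> U3) \<le> 1 / sqrt sig + 2 / sig
      + ((1 + exp (- (real N * rate / 32))) ^ N - 1 + real N * exp (- (real N * rate)))"
  proof -
    have "measure Q (U1 \<union> U2 \<union> U3) \<le> measure Q U1 + measure Q U2 + measure Q U3"
      by (intro order_trans[OF measure_Un_le] add_mono order_refl) auto
    also have "\<dots> \<le> 1 / sqrt sig + 2 / sig
      + ((1 + exp (- (real N * rate / 32))) ^ N - 1 + real N * exp (- (real N * rate)))"
      unfolding U1_def U2_def U3_def lam_def using N
      by (intro add_mono prob_degree_deviation prob_vol_deviation prob_not_poincare_le w sig0 sig rate) auto
    finally show ?thesis .
  qed
  have 3: "cmod ((\<integral>a. iexp ((- c * t) * W a) \<partial>Q) - exp (- ((c * t)\<^sup>2 / 2)))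
      \<le> \<bar>c * t\<bar> ^ 3 / sig + (c * t) ^ 4 / sig\<^sup>2"
  proof -
    have "sig\<^sup>2 = (\<Sum>e\<in>star w. edge_prob M B p q e * (1 - edge_prob M B p q e))"
      unfolding sum_star sum_edge_var[OF w] sig(2) ..
    from char_standardized_sum[OF star_subset[OF w] sig0 this, of "- c * t"]
    show ?thesis by (simp add: W_def abs_minus_cancel power2_eq_square)
  qed
  have "\<bar>t\<bar> * K + 2 * measure Q (U1 \<union> U2 \<union> U3) \<le> \<bar>t\<bar> * K + 2 * (1 / sqrt sig + 2 / sig
      + ((1 + exp (- (real N * rate / 32))) ^ N - 1 + real N * exp (- (real N * rate))))"
    by (intro add_left_mono mult_left_mono 2) auto
  from norm_diff_triangle_le[OF order_trans[OF 1 this] 3]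
  show ?thesis unfolding X_def K_def by (simp only: add_ac)
qed

end

section \<open>Asymptotics\<close>

text \<open>Where \<open>b\<close> vanishes, a positive \<open>a\<close> would make the extended
  quotient infinite, so \<open>a\<close> vanishes too. The product form therefore covers zero
  denominators.\<close>

lemma eratio_tendsto_0D:
  fixes a b :: "nat \<Rightarrow> real"
  assumes lim: "(\<lambda>k. eratio (a k) (b k)) \<longlonglongrightarrow> 0"
    and nn: "\<forall>\<^sub>F k in sequentially. a k \<ge> 0 \<and> b k \<ge> 0" and e: "e > 0"
  shows "\<forall>\<^sub>F k in sequentially. a k \<le> e * b k"
proof -
  have "\<forall>\<^sub>F k in sequentially. eratio (a k) (b k) < ereal e"
    using order_tendstoD(2)[OF lim, of "ereal e"] e by simp
  with nn show ?thesis
  proof eventually_elim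
    case (elim k)
    show ?case
    proof (cases "b k = 0")
      case True
      have "a k = 0"
      proof (rule ccontr)
        assume "a k \<noteq> 0"
        then have "eratio (a k) (b k) = \<infinity>" using elim True eratio_zero[of "a k"] by simp
        then show False using elim by simp
      qed
      then show ?thesis using True by simp
    next
      case False
      then have "a k / b k < e" using elim by (simp add: eratio_eq)
      then show ?thesis using False elim by (simp add: field_simps)
    qed
  qed
qed

lemma eratio_greaterD:
  assumes "eratio a b > ereal c" "a \<ge> 0" "b \<ge> 0"
  shows "c * b \<le> a"
proof (cases "b = 0")
  case False
  then have "c < a / b" using assms by (simp add: eratio_eq)
  then show ?thesis using False assms by (simp add: field_simps)
qed (use assms in simp)

text \<open>The index \<open>k\<close> stands for N = M k, and M < N means k >= 2; the ranges of the
  probabilities are assumed only there.\<close>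

locale sbm_regime =
  fixes M :: nat and P R :: "nat \<Rightarrow> real" and \<kappa> \<zeta> :: ereal
  assumes M: "M \<ge> 1"
    and P01: "\<And>k. k \<ge> 2 \<Longrightarrow> P k \<in> {0..1}" and R01: "\<And>k. k \<ge> 2 \<Longrightarrow> R k \<in> {0..1}"
    and variance: "(\<lambda>k. eratio (real M * ln (real (M * k)) ^ 4)
      (real (M * k) * P k * (1 - P k) + real (M * k) * (real M - 1) * R k * (1 - R k))) \<longlonglongrightarrow> 0"
    and P_less_1: "\<forall>\<^sub>F k in sequentially. P k < 1"
    and gap: "(\<lambda>k. eratio (sqrt (P k * ln (real (M * k)) / (real (M * k) * real M * (1 - P k)))) (R k)) \<longlonglongrightarrow> 0"
    and \<kappa>: "(\<lambda>k. eratio ((real M - 1) * R k * (1 - R k)) (P k * (1 - P k))) \<longlonglongrightarrow> \<kappa>"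
    and \<zeta>: "(\<lambda>k. eratio (1 - P k) (1 - R k)) \<longlonglongrightarrow> \<zeta>"
    and \<kappa>\<zeta>: "(0 < \<zeta> \<and> \<zeta> < \<infinity>) \<or> (\<kappa> \<in> {0, \<infinity>} \<and> \<zeta> = \<kappa>)"
begin

text \<open>\<open>v\<close> is \<open>M\<close> times the variance of a degree, and \<open>c2\<close> is the square of \<open>\<rho> N \<sigma> / D\<close>.\<close>

definition n :: "nat \<Rightarrow> real" where "n k = real (M * k)"
definition x :: "nat \<Rightarrow> real" where "x k = P k * (1 - P k)"
definition y :: "nat \<Rightarrow> real" where "y k = (real M - 1) * R k * (1 - R k)"
definition v :: "nat \<Rightarrow> real" where "v k = n k * (x k + y k)"
definition rat :: "nat \<Rightarrow> real" where "rat k = (if M = 1 then P k else R k)"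
definition \<rho> :: "nat \<Rightarrow> real" where "\<rho> k = rho M \<kappa> (M * k) (P k) (R k)"
definition c2 :: "nat \<Rightarrow> real" where "c2 k = (\<rho> k)\<^sup>2 * real M * v k / (P k + (real M - 1) * R k)\<^sup>2"

lemma ge2: "\<forall>\<^sub>F k in sequentially. k \<ge> (2::nat)"
  by (rule eventually_ge_at_top)

lemma xy_nonneg: "k \<ge> 2 \<Longrightarrow> x k \<ge> 0" "k \<ge> 2 \<Longrightarrow> y k \<ge> 0"
  using P01 R01 M by (auto simp: x_def y_def)

lemma n_pos: "k \<ge> 2 \<Longrightarrow> n k > 0"
  using M by (simp add: n_def)

lemma n_at_top: "filterlim n at_top sequentially"
proof (rule filterlim_at_top_mono[OF filterlim_real_sequentially])
  show "\<forall>\<^sub>F k in sequentially. real k \<le> n k" 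
    using M mult_right_mono[of 1 "real M" "real k" for k] by (intro always_eventually allI) (simp add: n_def)
qed

lemma ln_at_top: "filterlim (\<lambda>k. ln (n k)) at_top sequentially"
  by (rule filterlim_compose[OF ln_at_top n_at_top])

lemma ln_ge: "\<forall>\<^sub>F k in sequentially. ln (n k) \<ge> C"
  using ln_at_top by (auto simp: filterlim_at_top)

lemma v_ge:
  assumes "e > 0"
  shows "\<forall>\<^sub>F k in sequentially. real M * ln (n k) ^ 4 \<le> e * v k"
proof -
  have "(\<lambda>k. eratio (real M * ln (n k) ^ 4) (v k)) \<longlonglongrightarrow> 0"
    using variance by (simp add: n_def v_def x_def y_def distrib_left mult.assoc)
  moreover have "\<forall>\<^sub>F k in sequentially. real M * ln (n k) ^ 4 \<ge> 0 \<and> v k \<ge> 0"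
    using ge2 by eventually_elim (auto simp: v_def xy_nonneg intro!: mult_nonneg_nonneg order.strict_implies_order[OF n_pos])
  ultimately show ?thesis using assms by (rule eratio_tendsto_0D)
qed

lemma v_at_top: "filterlim v at_top sequentially"
  unfolding filterlim_at_top
proof
  fix C
  show "\<forall>\<^sub>F k in sequentially. C \<le> v k"
    using v_ge[of 1, simplified] ln_ge[of "max 1 C"]
  proof eventually_elim
    case (elim k)
    have "C \<le> ln (n k)" using elim by simp
    also have "\<dots> \<le> ln (n k) ^ 4" using elim by (intro self_le_power) auto
    also have "\<dots> \<le> real M * ln (n k) ^ 4"
      using M elim mult_right_mono[of 1 "real M" "ln (n k) ^ 4"] by simp
    also have "\<dots> \<le> v k" using elim by simp
    finally show ?case .
  qed
qed

lemma v_pos: "\<forall>\<^sub>F k in sequentially. v k > 0"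
  using v_at_top by (auto simp: filterlim_at_top_dense)

lemma gap_le:
  assumes "e > 0"
  shows "\<forall>\<^sub>F k in sequentially. sqrt (P k * ln (n k) / (n k * real M * (1 - P k))) \<le> e * R k"
proof (rule eratio_tendsto_0D[OF _ _ assms])
  show "(\<lambda>k. eratio (sqrt (P k * ln (n k) / (n k * real M * (1 - P k)))) (R k)) \<longlonglongrightarrow> 0"
    using gap by (simp add: n_def)
  show "\<forall>\<^sub>F k in sequentially. 0 \<le> sqrt (P k * ln (n k) / (n k * real M * (1 - P k))) \<and> 0 \<le> R k"
    using ge2 ln_ge[of 0]
  proof eventually_elim
    case (elim k)
    then show ?case using P01[of k] R01[of k] n_pos[of k] M
      by (auto intro!: divide_nonneg_nonneg mult_nonneg_nonneg)
  qed
qed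

text \<open>If M = 1 or P <= R, then v <= n M rat, and the variance hypothesis gives even ln^4.
  Otherwise the squared gap hypothesis bounds P ln / (n M) by e^2 R^2 <= e^2 R P, and P cancels;
  \<open>e\<close> is chosen to produce the constant \<open>C\<close>.\<close>

lemma ln_le_rate:
  assumes C: "C > 0"
  shows "\<forall>\<^sub>F k in sequentially. C * ln (n k) \<le> n k * rat k"
proof -
  define e where "e = sqrt (1 / (C * real M))"
  have Mpos: "real M \<ge> 1" using M by simp
  have e: "e > 0" "e\<^sup>2 = 1 / (C * real M)" using C Mpos by (simp_all add: e_def)
  show ?thesis
    using ge2 ln_ge[of "max 1 C"] v_ge[of 1, simplified] gap_le[OF e(1)] P_less_1
  proof eventually_elim
    case (elim k)
    define L where "L = ln (n k)"
    have L: "L \<ge> 1" "L \<ge> C" using elim by (simp_all add: L_def)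
    have n: "n k > 0" using n_pos elim by simp
    have p: "0 \<le> P k" "P k < 1" and q: "0 \<le> R k" "R k \<le> 1" using P01[of k] R01[of k] elim by auto
    have "C * L \<le> L * L" using L by (intro mult_right_mono) auto
    also have "\<dots> \<le> L ^ 4" using L power_increasing[of 2 4 L] by (simp add: power2_eq_square)
    finally have CL: "C * L \<le> L ^ 4" .
    have xP: "x k \<le> P k" using p by (simp add: x_def mult_left_le)
    have yR: "y k \<le> (real M - 1) * R k"
      unfolding y_def using Mpos q by (intro mult_left_le mult_nonneg_nonneg) auto
    show ?case
    proof (cases "M = 1 \<or> P k \<le> R k")
      case True
      have "x k + y k \<le> real M * rat k"
      proof (cases "M = 1")
        case True
        then have "y k = 0" "rat k = P k" unfolding y_def rat_def by simp_all
        then show ?thesis using True xP by simp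
      next
        case False
        then have "P k \<le> R k" "rat k = R k" using \<open>M = 1 \<or> P k \<le> R k\<close> by (simp_all add: rat_def)
        then show ?thesis using xP yR by (simp add: left_diff_distrib)
      qed
      then have "v k \<le> n k * (real M * rat k)" unfolding v_def using n by (intro mult_left_mono) auto
      moreover have "real M * L ^ 4 \<le> v k" using elim by (simp add: L_def)
      ultimately have "real M * L ^ 4 \<le> real M * (n k * rat k)" by (simp add: mult.left_commute)
      then have "L ^ 4 \<le> n k * rat k" using Mpos by simp
      then show ?thesis using CL by (simp add: L_def)
    next
      case False
      then have PR: "R k < P k" "rat k = R k" by (simp_all add: rat_def)
      have "P k * L / (n k * real M * (1 - P k)) \<le> (e * R k)\<^sup>2"
        using elim q by (simp add: L_def real_le_rsqrt sqrt_le_D)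
      moreover have "P k * L / (n k * real M) \<le> P k * L / (n k * real M * (1 - P k))"
        using p L n Mpos by (intro divide_left_mono mult_pos_pos) (auto simp: mult_left_le)
      ultimately have "P k * L / (n k * real M) \<le> R k * (e\<^sup>2 * R k)"
        by (simp add: power_mult_distrib power2_eq_square[of "R k"] mult.left_commute)
      also have "\<dots> \<le> P k * (e\<^sup>2 * R k)" using PR q by (intro mult_right_mono) auto
      finally have "P k * (L / (n k * real M)) \<le> P k * (e\<^sup>2 * R k)" by simp
      moreover have "P k > 0" using PR q by linarith
      ultimately have "L / (n k * real M) \<le> e\<^sup>2 * R k" by (simp only: mult_le_cancel_left_pos)
      then have "L / (n k * real M) \<le> R k / (C * real M)" by (simp add: e(2))
      then have "C * L \<le> n k * R k" using C n Mpos by (simp add: field_simps)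
      then show ?thesis by (simp add: PR L_def)
    qed
  qed
qed

lemma rate_pos: "\<forall>\<^sub>F k in sequentially. rat k > 0"
  using ge2 ln_le_rate[of 1, simplified] ln_ge[of 1]
proof eventually_elim
  case (elim k)
  then have "0 < n k * rat k" by simp
  then show ?case using n_pos[of k] elim by (simp add: zero_less_mult_iff)
qed

text \<open>The factor 64 in n rat >= 64 ln n makes both exponentials at most n^(-2), and (1 +
  n^(-2))^n <= exp(1 / n).\<close>

lemma no_expansion_limit:
  "(\<lambda>k. (1 + exp (- (n k * rat k / 32))) ^ (M * k) - 1 + n k * exp (- (n k * rat k))) \<longlonglongrightarrow> 0"
proof (rule tendsto_sandwich[where f = "\<lambda>_. 0" and h = "\<lambda>k. exp (1 / n k) - 1 + 1 / n k"])
  have inv: "(\<lambda>k. 1 / n k) \<longlonglongrightarrow> 0"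
    using tendsto_inverse_0_at_top[OF n_at_top] by (simp add: inverse_eq_divide)
  show "(\<lambda>k. exp (1 / n k) - 1 + 1 / n k) \<longlonglongrightarrow> 0"
    using tendsto_add[OF tendsto_diff[OF tendsto_exp[OF inv] tendsto_const[of 1]] inv] by simp
  show "\<forall>\<^sub>F k in sequentially. 0 \<le> (1 + exp (- (n k * rat k / 32))) ^ (M * k) - 1 + n k * exp (- (n k * rat k))"
    by (intro always_eventually allI add_nonneg_nonneg) (simp_all add: one_le_power n_def)
  show "\<forall>\<^sub>F k in sequentially. (1 + exp (- (n k * rat k / 32))) ^ (M * k) - 1 + n k * exp (- (n k * rat k))
      \<le> exp (1 / n k) - 1 + 1 / n k"
    using ge2 ln_le_rate[of 64, simplified] ln_ge[of 0]
  proof eventually_elim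
    case (elim k)
    have n: "n k > 0" using n_pos elim by simp
    have big: "2 * ln (n k) \<le> n k * rat k" "2 * ln (n k) \<le> n k * rat k / 32"
      using elim by linarith+
    have small: "exp (- z) \<le> 1 / (n k)\<^sup>2" if "2 * ln (n k) \<le> z" for z
    proof -
      have "exp (- z) \<le> exp (- (2 * ln (n k)))" using that by simp
      also have "\<dots> = 1 / (n k)\<^sup>2" using n by (simp add: exp_minus exp_double inverse_eq_divide)
      finally show ?thesis .
    qed
    have "(1 + exp (- (n k * rat k / 32))) ^ (M * k) \<le> exp (exp (- (n k * rat k / 32))) ^ (M * k)"
      by (intro power_mono) (auto intro: add_nonneg_nonneg)
    also have "\<dots> = exp (n k * exp (- (n k * rat k / 32)))"
      by (simp add: exp_of_nat_mult[symmetric] n_def)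
    also have "\<dots> \<le> exp (n k * (1 / (n k)\<^sup>2))"
      unfolding exp_le_cancel_iff using n by (intro mult_left_mono small big) auto
    also have "n k * (1 / (n k)\<^sup>2) = 1 / n k" using n by (simp add: power2_eq_square)
    finally have a: "(1 + exp (- (n k * rat k / 32))) ^ (M * k) \<le> exp (1 / n k)" .
    have "n k * exp (- (n k * rat k)) \<le> n k * (1 / (n k)\<^sup>2)"
      using n by (intro mult_left_mono small big) auto
    also have "\<dots> = 1 / n k" using n by (simp add: power2_eq_square)
    finally show ?case using a by simp
  qed
qed simp

lemma \<rho>_nonneg: "k \<ge> 2 \<Longrightarrow> \<rho> k \<ge> 0"
  using P01[of k] R01[of k] M by (auto simp: \<rho>_def rho_def intro!: divide_nonneg_nonneg mult_nonneg_nonneg)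

section \<open>The limit of the variance constant\<close>

lemma \<kappa>_lim: "(\<lambda>k. eratio (y k) (x k)) \<longlonglongrightarrow> \<kappa>"
  using \<kappa> by (simp add: x_def y_def)

text \<open>If x = 0, positivity of v forces y > 0 and the ratio is infinite, which a finite limit
  excludes eventually.\<close>

lemma eventually_x_pos:
  assumes "\<kappa> < \<infinity>"
  shows "\<forall>\<^sub>F k in sequentially. x k > 0"
  using order_tendstoD(2)[OF \<kappa>_lim assms] v_pos ge2
proof eventually_elim
  case (elim k)
  have "x k \<noteq> 0"
  proof
    assume 0: "x k = 0"
    then have "y k > 0" using elim n_pos[of k] by (simp add: v_def zero_less_mult_iff)
    then show False using elim 0 eratio_zero[of "y k"] by simp
  qed
  then show ?case using xy_nonneg[of k] elim by simp
qed

lemma eventually_R_less_1: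
  assumes "\<zeta> < \<infinity>"
  shows "\<forall>\<^sub>F k in sequentially. R k < 1"
  using order_tendstoD(2)[OF \<zeta> assms] P_less_1 ge2
proof eventually_elim
  case (elim k)
  have "1 - R k \<noteq> 0"
  proof
    assume "1 - R k = 0"
    then show False using elim eratio_zero[of "1 - P k"] by simp
  qed
  then show ?case using R01[of k] elim by auto
qed

lemma eventually_x_le_y:
  assumes "\<kappa> = \<infinity>"
  shows "\<forall>\<^sub>F k in sequentially. C * x k \<le> y k"
proof -
  have "\<forall>\<^sub>F k in sequentially. eratio (y k) (x k) > ereal C"
    using order_tendstoD(1)[OF \<kappa>_lim, of "ereal C"] assms by simp
  then show ?thesis using ge2 by eventually_elim (auto intro!: eratio_greaterD xy_nonneg)
qed

lemma eventually_y_pos: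
  assumes "\<kappa> = \<infinity>"
  shows "\<forall>\<^sub>F k in sequentially. y k > 0"
  using eventually_x_le_y[OF assms, of 1] v_pos ge2
proof eventually_elim
  case (elim k)
  then have "x k + y k > 0" using n_pos[of k] by (simp add: v_def zero_less_mult_iff)
  then show ?case using elim by simp
qed

lemma y_posD:
  assumes "y k > 0" "k \<ge> 2"
  shows "real M - 1 > 0" "R k > 0" "R k < 1"
proof -
  have "real M - 1 \<noteq> 0" "R k \<noteq> 0" "1 - R k \<noteq> 0" using assms(1) by (auto simp: y_def)
  then show "real M - 1 > 0" "R k > 0" "R k < 1" using M R01[OF assms(2)] by auto
qed

text \<open>Dividing by P^2 leaves only the two ratios with limits \<open>\<kappa>\<close> and
  \<open>\<zeta>\<close>, because (M - 1) R / P is their product.\<close>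

lemma c2_eq_finite:
  assumes \<kappa>: "\<kappa> < \<infinity>" and x: "x k > 0" and r: "R k < 1" and k: "k \<ge> 2"
  shows "c2 k = (1 + y k / x k) / (1 + y k / x k * ((1 - P k) / (1 - R k)))\<^sup>2"
proof -
  have p: "P k > 0" "1 - P k > 0"
    using x P01[OF k] by (auto simp: x_def zero_less_mult_iff)
  have m: "real M > 0" using M by simp
  note n = n_pos[OF k]
  have "(\<rho> k)\<^sup>2 = P k / (n k * real M * (1 - P k))"
    using \<kappa> p n m by (simp add: \<rho>_def rho_def n_def)
  then have "(\<rho> k)\<^sup>2 * real M * v k = P k * (x k + y k) / (1 - P k)"
    unfolding v_def by (simp only:) (use p n m in simp)
  also have "\<dots> = (P k)\<^sup>2 * (1 + y k / x k)"
    using p by (simp add: x_def power2_eq_square field_simps)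
  finally have 1: "(\<rho> k)\<^sup>2 * real M * v k = (P k)\<^sup>2 * (1 + y k / x k)" .
  have 2: "P k + (real M - 1) * R k = P k * (1 + y k / x k * ((1 - P k) / (1 - R k)))"
  proof -
    have "y k / x k * ((1 - P k) / (1 - R k)) = (real M - 1) * R k / P k"
      unfolding x_def y_def using p r by simp
    then show ?thesis using p by (simp add: distrib_left)
  qed
  show ?thesis unfolding c2_def 1 2 using p by (simp add: power_mult_distrib)
qed

text \<open>The mirror image, normalized by (M - 1) R instead of P, so that the reciprocal ratios
  appear.\<close>

lemma c2_eq_infinite:
  assumes \<kappa>: "\<kappa> = \<infinity>" and y: "y k > 0" and p: "P k < 1" and k: "k \<ge> 2"
  shows "c2 k = (1 + x k / y k) / (1 + x k / y k * ((1 - R k) / (1 - P k)))\<^sup>2"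
proof -
  define s where "s = (real M - 1) * R k"
  note r = y_posD[OF y k]
  have s: "s > 0" using r by (simp add: s_def)
  have m: "real M > 0" using M by simp
  note n = n_pos[OF k]
  have yk: "y k = s * (1 - R k)" by (simp add: y_def s_def)
  have "(\<rho> k)\<^sup>2 = s / (n k * real M * (1 - R k))"
    unfolding \<rho>_def rho_def n_def[symmetric] using \<kappa> r s n m by (simp add: s_def)
  then have "(\<rho> k)\<^sup>2 * real M * v k = s * (x k + y k) / (1 - R k)"
    unfolding v_def by (simp only:) (use r n m in simp)
  also have "\<dots> = s\<^sup>2 * (1 + x k / y k)"
    using r s by (simp add: yk power2_eq_square field_simps)
  finally have 1: "(\<rho> k)\<^sup>2 * real M * v k = s\<^sup>2 * (1 + x k / y k)" .
  have 2: "P k + s = s * (1 + x k / y k * ((1 - R k) / (1 - P k)))"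
  proof -
    have "x k / y k * ((1 - R k) / (1 - P k)) = P k / s"
      unfolding x_def yk using p r by simp
    then show ?thesis using s by (simp add: distrib_left)
  qed
  show ?thesis unfolding c2_def s_def[symmetric] 1 2 using s by (simp add: power_mult_distrib)
qed

lemma c2_limit: "c2 \<longlonglongrightarrow> 1 - alpha \<kappa> \<zeta>" and alpha_less_1: "alpha \<kappa> \<zeta> < 1"
proof -
  have "c2 \<longlonglongrightarrow> 1 - alpha \<kappa> \<zeta> \<and> alpha \<kappa> \<zeta> < 1"
  proof (cases "\<kappa> < \<infinity>")
    case True
    have \<zeta>fin: "\<zeta> < \<infinity>" using \<kappa>\<zeta> True by auto
    have nn: "\<forall>\<^sub>F k in sequentially. x k > 0 \<and> P k < 1 \<and> R k < 1 \<and> k \<ge> 2"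
      using eventually_x_pos[OF True] P_less_1 eventually_R_less_1[OF \<zeta>fin] ge2 by eventually_elim simp
    have lk: "(\<lambda>k. ereal (y k / x k)) \<longlonglongrightarrow> \<kappa>"
    proof (rule Lim_transform_eventually[OF \<kappa>_lim])
      show "\<forall>\<^sub>F k in sequentially. eratio (y k) (x k) = ereal (y k / x k)"
        using nn by eventually_elim (simp add: eratio_eq)
    qed
    have lz: "(\<lambda>k. ereal ((1 - P k) / (1 - R k))) \<longlonglongrightarrow> \<zeta>"
    proof (rule Lim_transform_eventually[OF \<zeta>])
      show "\<forall>\<^sub>F k in sequentially. eratio (1 - P k) (1 - R k) = ereal ((1 - P k) / (1 - R k))"
        using nn by eventually_elim (simp add: eratio_eq)
    qed
    have "0 \<le> \<kappa>"
    proof (rule tendsto_lowerbound[OF lk])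
      show "\<forall>\<^sub>F k in sequentially. 0 \<le> ereal (y k / x k)"
        using nn by eventually_elim (simp add: xy_nonneg)
    qed simp
    moreover have "0 \<le> \<zeta>" using \<kappa>\<zeta> \<open>0 \<le> \<kappa>\<close> by auto
    ultimately obtain k0 z0 where kz: "\<kappa> = ereal k0" "\<zeta> = ereal z0" "k0 \<ge> 0" "z0 \<ge> 0"
      using True \<zeta>fin by (cases \<kappa>; cases \<zeta>) auto
    have k0: "(\<lambda>k. y k / x k) \<longlonglongrightarrow> k0" using lk unfolding kz(1) by (simp add: lim_ereal)
    have z0: "(\<lambda>k. (1 - P k) / (1 - R k)) \<longlonglongrightarrow> z0" using lz unfolding kz(2) by (simp add: lim_ereal)
    have pos: "1 + k0 * z0 > 0" using kz by (simp add: add_pos_nonneg)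
    have "(\<lambda>k. (1 + y k / x k) / (1 + y k / x k * ((1 - P k) / (1 - R k)))\<^sup>2)
        \<longlonglongrightarrow> (1 + k0) / (1 + k0 * z0)\<^sup>2"
      using pos by (intro tendsto_intros k0 z0) auto
    then have lim: "c2 \<longlonglongrightarrow> (1 + k0) / (1 + k0 * z0)\<^sup>2"
      by (rule Lim_transform_eventually)
        (use nn in eventually_elim, simp add: c2_eq_finite[OF True])
    have eq: "1 - alpha \<kappa> \<zeta> = (1 + k0) / (1 + k0 * z0)\<^sup>2"
    proof (cases "k0 = 0")
      case False
      then have "alpha \<kappa> \<zeta> = k0 * (2 * z0 - 1 + k0 * z0\<^sup>2) / (1 + k0 * z0)\<^sup>2"
        using kz by (simp add: alpha_def Let_def mult.commute)
      moreover have "(1 + k0 * z0)\<^sup>2 - k0 * (2 * z0 - 1 + k0 * z0\<^sup>2) = 1 + k0"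
        by (simp add: power2_eq_square algebra_simps)
      moreover have "1 - a / b = (b - a) / b" if "b \<noteq> 0" for a b :: real
        using that by (simp add: diff_divide_distrib)
      ultimately show ?thesis using pos by simp
    qed (simp add: kz alpha_def)
    moreover have "(1 + k0) / (1 + k0 * z0)\<^sup>2 > 0" using pos kz by simp
    ultimately show ?thesis using lim by simp
  next
    case False
    then have \<kappa>inf: "\<kappa> = \<infinity>" by simp
    have "\<zeta> > 0" using \<kappa>\<zeta> \<kappa>inf by auto
    \<comment> \<open>\<open>\<zeta>\<close> may be infinite here; a positive lower bound for the
      ratio is enough, as it keeps (1 - R) / (1 - P) bounded.\<close>
    then obtain c where c: "c > 0" "ereal c < \<zeta>"
      using ereal_dense2[of 0 \<zeta>] by auto
    have nn: "\<forall>\<^sub>F k in sequentially. y k > 0 \<and> P k < 1 \<and> k \<ge> 2 \<and> c * (1 - R k) \<le> 1 - P k"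
      using eventually_y_pos[OF \<kappa>inf] P_less_1 ge2 order_tendstoD(1)[OF \<zeta> c(2)]
    proof eventually_elim
      case (elim k)
      then show ?case using P01[of k] R01[of k] by (auto intro!: eratio_greaterD)
    qed
    have xy: "(\<lambda>k. x k / y k) \<longlonglongrightarrow> 0"
    proof (rule tendstoI)
      fix e :: real assume e: "e > 0"
      show "\<forall>\<^sub>F k in sequentially. dist (x k / y k) 0 < e"
        using eventually_x_le_y[OF \<kappa>inf, of "2 / e"] nn
      proof eventually_elim
        case (elim k)
        then have "x k / y k \<le> e / 2" using e by (simp add: field_simps)
        moreover have "dist (x k / y k) 0 = x k / y k" using elim xy_nonneg[of k] by (simp add: dist_real_def)
        ultimately show ?case using e by linarith
      qed
    qed
    have g: "(\<lambda>k. x k / y k * ((1 - R k) / (1 - P k))) \<longlonglongrightarrow> 0"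
    proof (rule tendsto_sandwich[where f = "\<lambda>_. 0" and h = "\<lambda>k. x k / y k * (1 / c)"])
      show "\<forall>\<^sub>F k in sequentially. 0 \<le> x k / y k * ((1 - R k) / (1 - P k))"
        using nn
      proof eventually_elim
        case (elim k)
        then show ?case using R01[of k] by (auto intro!: mult_nonneg_nonneg divide_nonneg_nonneg xy_nonneg)
      qed
      show "\<forall>\<^sub>F k in sequentially. x k / y k * ((1 - R k) / (1 - P k)) \<le> x k / y k * (1 / c)"
        using nn
      proof eventually_elim
        case (elim k)
        then have "(1 - R k) / (1 - P k) \<le> 1 / c" using c by (simp add: field_simps)
        then show ?case using elim by (intro mult_left_mono) (auto simp: xy_nonneg)
      qed
      show "(\<lambda>k. x k / y k * (1 / c)) \<longlonglongrightarrow> 0" using tendsto_mult_right[OF xy, of "1 / c"] by simp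
    qed simp
    have "(\<lambda>k. (1 + x k / y k) / (1 + x k / y k * ((1 - R k) / (1 - P k)))\<^sup>2) \<longlonglongrightarrow> (1 + 0) / (1 + 0)\<^sup>2"
      by (intro tendsto_intros xy g) auto
    then have "c2 \<longlonglongrightarrow> (1 + 0) / (1 + 0)\<^sup>2"
      by (rule Lim_transform_eventually)
        (use nn in eventually_elim, simp add: c2_eq_infinite[OF \<kappa>inf])
    then show ?thesis by (simp add: alpha_def \<kappa>inf)
  qed
  then show "c2 \<longlonglongrightarrow> 1 - alpha \<kappa> \<zeta>" "alpha \<kappa> \<zeta> < 1" by simp_all
qed

text \<open>The spectral part of the error in \<open>char_target_hitting\<close> is a multiple of
  \<rho> / rat. For finite \<open>\<kappa>\<close>, it is controlled by \<rho>^2 = P^2 / v if M = 1,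
  and by the gap hypothesis with ln n >= 1 if M >= 2. For infinite \<open>\<kappa>\<close>, y
  dominates v, which tends to infinity.\<close>

lemma \<rho>_le_rate:
  assumes e: "e > 0"
  shows "\<forall>\<^sub>F k in sequentially. \<rho> k \<le> e * rat k"
proof (cases "\<kappa> < \<infinity>")
  case fin: True
  have \<rho>: "\<rho> k = sqrt (P k / (n k * real M * (1 - P k)))" for k
    using fin by (simp add: \<rho>_def rho_def n_def)
  show ?thesis
  proof (cases "M = 1")
    case True
    have "\<forall>\<^sub>F k in sequentially. v k \<ge> 1 / e\<^sup>2" using v_at_top by (auto simp: filterlim_at_top)
    then show ?thesis using v_pos eventually_x_pos[OF fin] ge2
    proof eventually_elim
      case (elim k)
      have p: "P k > 0" "1 - P k > 0"
        using elim P01[of k] by (auto simp: x_def zero_less_mult_iff)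
      have n: "n k > 0" using n_pos elim by simp
      have vk: "v k = n k * (P k * (1 - P k))" unfolding v_def x_def y_def using True by simp
      have "P k / (n k * real M * (1 - P k)) = (P k)\<^sup>2 * (1 / v k)"
        unfolding vk using True p n by (simp add: power2_eq_square)
      also have "1 / v k \<le> e\<^sup>2" using elim e by (simp add: field_simps)
      then have "(P k)\<^sup>2 * (1 / v k) \<le> (P k)\<^sup>2 * e\<^sup>2" by (intro mult_left_mono) auto
      finally have "P k / (n k * real M * (1 - P k)) \<le> (e * P k)\<^sup>2" by (simp add: power_mult_distrib mult.commute)
      then have "\<rho> k \<le> e * P k" unfolding \<rho> using e p by (intro real_le_lsqrt) auto
      moreover have "rat k = P k" unfolding rat_def using True by simp
      ultimately show ?case by simp
    qed
  next
    case False
    show ?thesis using gap_le[OF e] ln_ge[of 1] ge2 P_less_1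
    proof eventually_elim
      case (elim k)
      have n: "n k > 0" using n_pos elim by simp
      have "P k * 1 / (n k * real M * (1 - P k)) \<le> P k * ln (n k) / (n k * real M * (1 - P k))"
        using elim n P01[of k] M by (intro divide_right_mono mult_left_mono) auto
      then have "\<rho> k \<le> sqrt (P k * ln (n k) / (n k * real M * (1 - P k)))" unfolding \<rho> by simp
      also have "\<dots> \<le> e * R k" using elim by simp
      finally show ?case using False by (simp add: rat_def)
    qed
  qed
next
  case False
  then have inf: "\<kappa> = \<infinity>" by simp
  have "\<forall>\<^sub>F k in sequentially. v k \<ge> 2 * (real M - 1)\<^sup>2 / e\<^sup>2" using v_at_top by (auto simp: filterlim_at_top)
  then show ?thesis using eventually_x_le_y[OF inf, of 1] eventually_y_pos[OF inf] ge2
  proof eventually_elim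
    case (elim k)
    have n: "n k > 0" using n_pos elim by simp
    note r = y_posD[OF elim(3,4)]
    define m where "m = real M - 1"
    have m: "m > 0" "real M \<ge> 1" using r M by (simp_all add: m_def)
    \<comment> \<open>As y = m R (1 - R), the lower bound 2 m^2 / e^2 for v becomes m <= e^2 n R (1
      - R), that is, the desired bound on \<rho>^2 up to the factor M >= 1.\<close>
    have "v k \<le> n k * (2 * y k)" unfolding v_def using elim n by (intro mult_left_mono) auto
    moreover have "2 * m\<^sup>2 \<le> e\<^sup>2 * v k" using elim e by (simp add: m_def field_simps)
    ultimately have "2 * m\<^sup>2 \<le> e\<^sup>2 * (n k * (2 * y k))" by (meson e mult_left_mono order_trans zero_le_power2)
    then have "2 * (m * m) \<le> 2 * (m * (e\<^sup>2 * (n k * (R k * (1 - R k)))))"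
      by (simp only: y_def m_def[symmetric] power2_eq_square mult_ac)
    then have "m * m \<le> m * (e\<^sup>2 * (n k * (R k * (1 - R k))))" by linarith
    then have "m \<le> e\<^sup>2 * (n k * (R k * (1 - R k)))" using m by simp
    then have "m * R k \<le> (e\<^sup>2 * (n k * (R k * (1 - R k)))) * R k" using r by (intro mult_right_mono) auto
    also have "\<dots> = (e * R k)\<^sup>2 * (n k * 1 * (1 - R k))" by (simp add: power2_eq_square mult_ac)
    also have "\<dots> \<le> (e * R k)\<^sup>2 * (n k * real M * (1 - R k))"
      using n r m by (intro mult_left_mono mult_right_mono) auto
    finally have "m * R k / (n k * real M * (1 - R k)) \<le> (e * R k)\<^sup>2"
      using n r m by (simp add: divide_le_eq)
    then have "sqrt (m * R k / (n k * real M * (1 - R k))) \<le> e * R k"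
      using e r by (intro real_le_lsqrt) auto
    moreover have "\<rho> k = sqrt (m * R k / (n k * real M * (1 - R k)))"
      unfolding \<rho>_def rho_def n_def[symmetric] m_def[symmetric] using inf by simp
    moreover have "rat k = R k" using r by (auto simp: rat_def)
    ultimately show ?case by simp
  qed
qed

lemma \<rho>_div_rate_limit: "(\<lambda>k. \<rho> k / rat k) \<longlonglongrightarrow> 0"
proof (rule tendstoI)
  fix e :: real assume e: "e > 0"
  show "\<forall>\<^sub>F k in sequentially. dist (\<rho> k / rat k) 0 < e"
    using \<rho>_le_rate[OF half_gt_zero[OF e]] rate_pos ge2
  proof eventually_elim
    case (elim k)
    then have "\<rho> k / rat k \<le> e / 2" by (simp add: divide_le_eq)
    moreover have "dist (\<rho> k / rat k) 0 = \<rho> k / rat k" using elim \<rho>_nonneg[of k] by (simp add: dist_real_def)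
    ultimately show ?case using e by linarith
  qed
qed

end

section \<open>Convergence in distribution\<close>

lemma prob_space_normal_law: "prob_space (normal_law \<mu> s)" if "s > 0"
  unfolding normal_law_def using that by (intro prob_space_normal_density) simp

lemma char_normal_law:
  assumes s: "s > 0"
  shows "char (normal_law 0 s) t = exp (- (s * t\<^sup>2 / 2))"
proof -
  let ?N = "normal_law 0 s"
  interpret prob_space ?N by (rule prob_space_normal_law[OF s])
  have sq: "sqrt s > 0" using s by simp
  have "distributed ?N lborel (\<lambda>x. x) (normal_density 0 (sqrt s))"
    unfolding distributed_def normal_law_def by (auto intro!: measure_eqI simp: emeasure_distr)
  then have "distributed ?N lborel (\<lambda>x. (x - 0) / sqrt s) std_normal_density"
    unfolding normal_standard_normal_convert[OF sq] .
  then have d: "distr ?N lborel (\<lambda>x. x / sqrt s) = std_normal_distribution"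
    by (simp add: distributed_def)
  have sets: "sets ?N = sets borel" by (simp add: normal_law_def)
  have "char ?N t = (CLINT x|?N. iexp ((t * sqrt s) * (x / sqrt s)))"
    using sq by (simp add: char_def)
  also have "\<dots> = (CLINT x|distr ?N lborel (\<lambda>x. x / sqrt s). iexp ((t * sqrt s) * x))"
    by (subst integral_distr) (auto simp: measurable_cong_sets[OF sets refl])
  also have "\<dots> = char std_normal_distribution (t * sqrt s)"
    unfolding d char_def ..
  also have "\<dots> = exp (- (s * t\<^sup>2 / 2))"
    using s by (simp add: char_std_normal_distribution power_mult_distrib mult.commute)
  finally show ?thesis .
qed

lemma real_distribution_normal_law:
  assumes "s > 0"
  shows "real_distribution (normal_law 0 s)"
proof -
  interpret prob_space "normal_law 0 s" by (rule prob_space_normal_law[OF assms])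
  show ?thesis by unfold_locales (simp add: normal_law_def)
qed

context block_model
begin

lemma mean_degree_eq: "mean_degree = real N * (p + (real M - 1) * q) / real M"
  using M by (simp add: mean_degree_def field_simps)

lemma var_degree_eq: "var_degree = real N * (p * (1 - p) + (real M - 1) * q * (1 - q)) / real M"
proof -
  have "real N - real N / real M = real N * (real M - 1) / real M" using M by (simp add: field_simps)
  then show ?thesis unfolding var_degree_def by (simp add: distrib_left add_divide_distrib mult.assoc)
qed

lemma sbm_eq: "sbm M N B p q = map_pmf (\<lambda>a. {e. a e}) Q"
  by (simp add: sbm_def Q_def)

end

text \<open>Levy's continuity theorem: the characteristic functions differ by a null sequence from
  Gaussian ones whose standard deviations c converge to that of the limit. The limit has a density
  because alpha < 1.\<close>

theorem theorem8p5:
  fixes M :: nat and B :: "nat \<Rightarrow> nat \<Rightarrow> nat set" and w :: "nat \<Rightarrow> nat"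
    and p q :: "nat \<Rightarrow> real" and \<kappa> \<zeta> :: ereal
  assumes "M \<ge> 1"
    and "\<And>N. M dvd N \<Longrightarrow> M < N \<Longrightarrow> equal_blocks M N (B N)"
    and "\<And>N. M dvd N \<Longrightarrow> M < N \<Longrightarrow> w N \<in> verts N"
    and "\<And>N. M dvd N \<Longrightarrow> M < N \<Longrightarrow> p N \<in> {0..1} \<and> q N \<in> {0..1}"
    and "(\<lambda>k. let N = M * k in
           eratio (real M * (ln (real N)) ^ 4)
             (real N * p N * (1 - p N) + real N * (real M - 1) * q N * (1 - q N))) \<longlonglongrightarrow> 0"
    and "\<forall>\<^sub>F k in sequentially. p (M * k) < 1"
    and "(\<lambda>k. q (M * k)) \<ggreater>
         (\<lambda>k. let N = M * k in sqrt (p N * ln (real N) / (real N * real M * (1 - p N))))"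
    and "(\<lambda>k. let N = M * k in
           eratio ((real M - 1) * q N * (1 - q N)) (p N * (1 - p N))) \<longlonglongrightarrow> \<kappa>"
    and "(\<lambda>k. let N = M * k in eratio (1 - p N) (1 - q N)) \<longlonglongrightarrow> \<zeta>"
    and "(0 < \<zeta> \<and> \<zeta> < \<infinity>) \<or> (\<kappa> \<in> {0, \<infinity>} \<and> \<zeta> = \<kappa>)"
  shows "weak_conv_m
           (\<lambda>k. let N = M * k in
              distr (measure_pmf (sbm M N (B N) (p N) (q N))) borel
                (\<lambda>E. rho M \<kappa> N (p N) (q N) * (enn2real (target_hitting N E (w N)) - real N)))
           (normal_law 0 (1 - alpha \<kappa> \<zeta>))"
proof -
  define P where "P k = p (M * k)" for k
  define R where "R k = q (M * k)" for k
  have dvd: "M dvd M * k" and less: "M < M * k" if "k \<ge> 2" for k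
    using that assms(1) by auto
  interpret sbm_regime M P R \<kappa> \<zeta>
  proof
    show "P k \<in> {0..1}" "R k \<in> {0..1}" if "k \<ge> 2" for k
      using assms(4)[OF dvd less] that by (auto simp: P_def R_def)
  qed (use assms(1,5-10) in \<open>simp_all add: P_def R_def much_greater_def Let_def\<close>)
  define X where "X k E = \<rho> k * (enn2real (target_hitting (M * k) E (w (M * k))) - real (M * k))" for k E
  define \<mu> where "\<mu> k = measure_pmf (sbm M (M * k) (B (M * k)) (P k) (R k))" for k
  define sig where "sig k = sqrt (v k / real M)" for k
  define c where "c k = sqrt (c2 k)" for k
  define s where "s = 1 - alpha \<kappa> \<zeta>"
  have Mpos: "real M > 0" using assms(1) by simp
  have s: "s > 0" using alpha_less_1 by (simp add: s_def)
  have "filterlim (\<lambda>k. v k / real M) at_top sequentially"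
    using filterlim_tendsto_pos_mult_at_top[OF tendsto_const _ v_at_top, of "1 / real M"] Mpos by simp
  then have sig_top: "filterlim sig at_top sequentially"
    unfolding sig_def by (rule filterlim_compose[OF sqrt_at_top])
  have sqrt_sig_top: "filterlim (\<lambda>k. sqrt (sig k)) at_top sequentially"
    by (rule filterlim_compose[OF sqrt_at_top sig_top])
  have c_lim: "c \<longlonglongrightarrow> sqrt s"
    unfolding c_def s_def by (intro tendsto_real_sqrt c2_limit)
  have inv0: "(\<lambda>k. f k / g k) \<longlonglongrightarrow> 0" if "f \<longlonglongrightarrow> l" "filterlim g at_top sequentially" for f g :: "nat \<Rightarrow> real" and l
    using tendsto_mult[OF that(1) tendsto_inverse_0_at_top[OF that(2)]] by (simp add: divide_inverse)
  have "weak_conv_m (\<lambda>k. distr (\<mu> k) borel (X k)) (normal_law 0 s)"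
  proof (rule levy_continuity)
    show "real_distribution (distr (\<mu> k) borel (X k))" for k
      unfolding \<mu>_def by (intro prob_space.real_distribution_distr prob_space_measure_pmf) simp
    show "real_distribution (normal_law 0 s)" by (rule real_distribution_normal_law[OF s])
    fix t :: real
    define bound where "bound k = \<bar>c k * t\<bar> ^ 3 / sig k + (c k * t) ^ 4 / (sig k)\<^sup>2
      + \<bar>t\<bar> * (4 * c k / sqrt (sig k) + 6 * 384 * (\<rho> k / rat k))
      + 2 * (1 / sqrt (sig k) + 2 / sig k
        + ((1 + exp (- (n k * rat k / 32))) ^ (M * k) - 1 + n k * exp (- (n k * rat k))))" for k
    have "bound \<longlonglongrightarrow> 0 + 0 + \<bar>t\<bar> * (0 + 6 * 384 * 0) + 2 * (0 + 0 + 0)"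
      unfolding bound_def
    proof (intro tendsto_add tendsto_mult tendsto_const \<rho>_div_rate_limit no_expansion_limit)
      show "(\<lambda>k. \<bar>c k * t\<bar> ^ 3 / sig k) \<longlonglongrightarrow> 0"
        by (intro inv0[where l = "\<bar>sqrt s * t\<bar> ^ 3"] tendsto_intros c_lim sig_top)
      show "(\<lambda>k. (c k * t) ^ 4 / (sig k)\<^sup>2) \<longlonglongrightarrow> 0"
        by (intro inv0[where l = "(sqrt s * t) ^ 4"] tendsto_intros c_lim filterlim_pow_at_top sig_top) simp
      show "(\<lambda>k. 4 * c k / sqrt (sig k)) \<longlonglongrightarrow> 0"
        by (intro inv0[where l = "4 * sqrt s"] tendsto_intros c_lim sqrt_sig_top)
      show "(\<lambda>k. 1 / sqrt (sig k)) \<longlonglongrightarrow> 0" by (rule inv0[OF tendsto_const sqrt_sig_top])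
      show "(\<lambda>k. 2 / sig k) \<longlonglongrightarrow> 0" by (rule inv0[OF tendsto_const sig_top])
    qed
    then have bound0: "bound \<longlonglongrightarrow> 0" by simp
    have sig16: "\<forall>\<^sub>F k in sequentially. sig k \<ge> 16" using sig_top by (auto simp: filterlim_at_top)
    have close: "\<forall>\<^sub>F k in sequentially.
        cmod (char (distr (\<mu> k) borel (X k)) t - exp (- ((c k * t)\<^sup>2 / 2))) \<le> bound k"
      using ge2 rate_pos sig16
    proof eventually_elim
      case (elim k)
      interpret bm: block_model M "M * k" "B (M * k)" "P k" "R k"
        using assms(1) assms(2)[OF dvd less] P01 R01 elim by unfold_locales auto
      have rate: "bm.rate = rat k" unfolding bm.rate_def rat_def ..
      have "sqrt (v k / real M) > 0" using elim(3) unfolding sig_def by linarith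
      then have sq: "(sig k)\<^sup>2 = v k / real M" unfolding sig_def real_sqrt_gt_0_iff by simp
      have var: "(sig k)\<^sup>2 = bm.var_degree"
        unfolding sq bm.var_degree_eq v_def x_def y_def n_def ..
      have wv: "w (M * k) \<in> verts (M * k)" using assms(3)[OF dvd less] elim by simp
      have \<rho>0: "\<rho> k \<ge> 0" using \<rho>_nonneg elim by simp
      have md: "bm.mean_degree = n k * (P k + (real M - 1) * R k) / real M"
        unfolding bm.mean_degree_eq n_def ..
      have md0: "bm.mean_degree > 0"
      proof -
        have "(sig k)\<^sup>2 > 0" using elim(3) by simp
        then show ?thesis unfolding var using bm.var_degree_le_mean by linarith
      qed
      \<comment> \<open>With sig^2 = v / M and the mean degree expressed through P and R, the root
        of \<open>c2\<close> is the ratio of scales that \<open>char_target_hitting\<close>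
        expects.\<close>
      have c: "c k = \<rho> k * real (M * k) * sig k / bm.mean_degree"
      proof -
        have "(\<rho> k * real (M * k) * sig k / bm.mean_degree)\<^sup>2 = (\<rho> k * n k)\<^sup>2 * (v k / real M) / bm.mean_degree\<^sup>2"
          unfolding sq[symmetric] n_def by (simp add: power_mult_distrib power_divide)
        also have "\<dots> = c2 k"
          unfolding c2_def md using n_pos[OF elim(1)] Mpos
          by (simp add: power_mult_distrib power_divide power2_eq_square)
        finally have "c k = sqrt ((\<rho> k * real (M * k) * sig k / bm.mean_degree)\<^sup>2)" unfolding c_def by simp
        also have "\<dots> = \<rho> k * real (M * k) * sig k / bm.mean_degree"
          using \<rho>0 elim(3) md0 unfolding real_sqrt_abs
          by (intro abs_of_nonneg divide_nonneg_nonneg mult_nonneg_nonneg) auto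
        finally show ?thesis .
      qed
      have "char (distr (\<mu> k) borel (X k)) t = (\<integral>E. iexp (t * X k E) \<partial>\<mu> k)"
        unfolding char_def \<mu>_def by (rule integral_distr) auto
      also have "\<dots> = (\<integral>a. iexp (t * X k {e. a e}) \<partial>bm.Q)"
        unfolding \<mu>_def bm.sbm_eq by simp
      finally have ch: "char (distr (\<mu> k) borel (X k)) t = (\<integral>a. iexp (t * X k {e. a e}) \<partial>bm.Q)" .
      have "M * k \<ge> 2" using elim(1) assms(1) by (metis le_trans mult_le_mono1 nat_mult_1)
      from bm.char_target_hitting[OF this wv _ elim(3) var \<rho>0 c, of t] elim(2)
      show ?case unfolding ch bound_def X_def rate n_def by simp
    qed
    \<comment> \<open>The comparison Gaussian still varies with \<open>k\<close> through
      \<open>c\<close>; its own convergence is added afterwards.\<close>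
    have "(\<lambda>k. char (distr (\<mu> k) borel (X k)) t - exp (- ((c k * t)\<^sup>2 / 2))) \<longlonglongrightarrow> 0"
      by (rule Lim_null_comparison[OF close bound0])
    moreover have "(\<lambda>k. complex_of_real (exp (- ((c k * t)\<^sup>2 / 2)))) \<longlonglongrightarrow> complex_of_real (exp (- ((sqrt s * t)\<^sup>2 / 2)))"
      by (intro tendsto_intros c_lim) auto
    ultimately have "(\<lambda>k. (char (distr (\<mu> k) borel (X k)) t - exp (- ((c k * t)\<^sup>2 / 2))) + exp (- ((c k * t)\<^sup>2 / 2)))
        \<longlonglongrightarrow> 0 + complex_of_real (exp (- ((sqrt s * t)\<^sup>2 / 2)))"
      by (rule tendsto_add)
    then show "(\<lambda>k. char (distr (\<mu> k) borel (X k)) t) \<longlonglongrightarrow> char (normal_law 0 s) t"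
      unfolding char_normal_law[OF s] using s by (simp add: power_mult_distrib)
  qed
  then show ?thesis by (simp add: Let_def s_def \<mu>_def X_def[abs_def] \<rho>_def P_def R_def)
qed

end
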